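(* Let $n_1,n_2$ be nonzero natural numbers and let $\omega_1,\omega_2$ be nonzero real numbers with $n_1\omega_2-n_2\omega_1=0$. Let $$L=\begin{pmatrix}0&1&&&&\\0&0&&&&\\&&0&\omega_1&&\\&&-\omega_1&0&&\\&&&&0&\omega_2\\&&&&-\omega_2&0\end{pmatrix}$$ act on $\mathbb{R}^6\cong\mathbb{R}^2\times\mathbb{C}^2$ with coordinates $(x_1,x_2,z_1,z_2)$. Let $\mathbf{Z}_2$ be generated by the involution $\phi(x_1,x_2,z_1,z_2)=(x_1,-x_2,\bar z_1,\bar z_2)$, regarded as a reversing symmetry. Let $\dot x=Lx+h(x)$ be a smooth $\mathbf{Z}_2$-reversible-equivariant system on $\mathbb{R}^6$, where $h$ has vanishing value and vanishing linear part at the origin. Then this system is formally conjugate to \begin{align*} \dot x_1&=x_2+x_1\,\mathrm{Im}(z_1^{n_2}\bar z_2^{n_1})f_0(X),\\ \dot x_2&=f_1(X)+x_2\,\mathrm{Im}(z_1^{n_2}\bar z_2^{n_1})f_0(X),\\ \dot z_1&=-i\omega_1z_1+iz_1f_2(X)+i\bar z_1^{n_2-1}z_2^{n_1}f_3(X)+z_1\,\mathrm{Im}(z_1^{n_2}\bar z_2^{n_1})f_4(X)+\bar z_1^{n_2-1}z_2^{n_1}\,\mathrm{Im}(z_1^{n_2}\bar z_2^{n_1})f_5(X),\\ \dot z_2&=-i\omega_2z_2+iz_2f_6(X)+iz_1^{n_2}\bar z_2^{n_1-1}f_7(X)+z_2\,\mathrm{Im}(z_1^{n_2}\bar z_2^{n_1})f_8(X)+z_1^{n_2}\bar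 z_2^{n_1-1}\,\mathrm{Im}(z_1^{n_2}\bar z_2^{n_1})f_9(X), \end{align*} for some functions $f_i:\mathbb{R}^4\to\mathbb{R}$, $i=0,\dots,9$, where $X=(x_1,|z_1|^2,|z_2|^2,\mathrm{Re}(z_1^{n_2}\bar z_2^{n_1}))$.
   Context: The identification $\mathbb{R}^6\cong\mathbb{R}^2\times\mathbb{C}^2$ writes each of the last two pairs of real coordinates $(a,b)$ as $z=a+ib$, so that $L(x_1,x_2,z_1,z_2)=(x_2,0,-i\omega_1z_1,-i\omega_2z_2)$. A system $\dot x=F(x)$ is $\mathbf{Z}_2$-reversible-equivariant (with $\phi$ a reversing symmetry) if $F(\phi x)=-\phi F(x)$ for all $x$. Formally conjugate means that the formal Taylor series at the origin of the two systems are conjugate as formal vector fields: there is a formal change of coordinates $x=\Phi(y)$, obtained as the (formal, infinite) composition of successive changes of coordinates $I+\xi_k$, $k\ge2$, with $\xi_k$ a homogeneous polynomial mapping of degree $k$ commuting with $\phi$, such that $(D\Phi)_{(y)}Y(y)=F(\Phi(y))$ as formal power series, where $F$ and $Y$ are the right-hand sides of the old and new systems. Only the Taylor series of the $f_i$ at $0$ matter.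
   Formalization: The natural numbers n1, n2 are assumed coprime; without this the claim is false, e.g. n1=n2=2, ω1=ω2=1, h=(0,0,i x1 z2,0), whose resonant term x1 z2 cannot be removed and is absent from the normal form. *)

theory Defs
  imports "HOL-Analysis.Analysis"
begin

section \<open>Formal power series in finitely many variables\<close>

text \<open>
  The variables are indexed by the finite type \<open>'n\<close>; multi-indices are elements of
  \<open>nat ^ 'n\<close>, on which \<open>\<le>\<close>, \<open>+\<close> and \<open>-\<close> are componentwise.
\<close>

typedef (overloaded) ('a, 'n::finite) mfps = "UNIV :: (nat ^ 'n \<Rightarrow> 'a) set"
  morphisms mcoeff Abs_mfps
  by simp

lemma mcoeff_Abs_mfps [simp]: "mcoeff (Abs_mfps f) = f"
  by (simp add: Abs_mfps_inverse)

lemma mfps_eqI: "(\<And>\<alpha>. mcoeff f \<alpha> = mcoeff g \<alpha>) \<Longrightarrow> f = g"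
  by (metis ext mcoeff_inject)

definition mdeg :: "nat ^ 'n::finite \<Rightarrow> nat" where
  "mdeg \<alpha> = (\<Sum>i\<in>UNIV. \<alpha> $ i)"

lemma finite_le_multiindex [simp]: "finite {\<alpha> :: nat ^ 'n::finite. \<alpha> \<le> \<beta>}"
proof -
  have "{\<alpha>. \<alpha> \<le> \<beta>} \<subseteq> vec_lambda ` (\<Pi>\<^sub>E i\<in>UNIV. {..\<beta> $ i})"
  proof
    fix \<alpha> :: "nat ^ 'n" assume "\<alpha> \<in> {\<alpha>. \<alpha> \<le> \<beta>}"
    then have "vec_nth \<alpha> \<in> (\<Pi>\<^sub>E i\<in>UNIV. {..\<beta> $ i})"
      by (auto simp: less_eq_vec_def)
    then show "\<alpha> \<in> vec_lambda ` (\<Pi>\<^sub>E i\<in>UNIV. {..\<beta> $ i})"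
      by (metis image_eqI vec_nth_inverse)
  qed
  then show ?thesis
    by (rule finite_subset) (intro finite_imageI finite_PiE; simp)
qed

lemma finite_mdeg_le [simp]: "finite {\<alpha> :: nat ^ 'n::finite. mdeg \<alpha> \<le> k}"
proof (rule finite_subset)
  show "{\<alpha> :: nat ^ 'n. mdeg \<alpha> \<le> k} \<subseteq> {\<alpha>. \<alpha> \<le> (\<chi> i. k)}"
    unfolding mdeg_def less_eq_vec_def
    by (auto intro: order_trans [OF member_le_sum [of _ UNIV]])
qed simp

lemma finite_mdeg_eq [simp]: "finite {\<alpha> :: nat ^ 'n::finite. mdeg \<alpha> = k}"
  by (rule finite_subset [OF _ finite_mdeg_le [of k]]) auto

instantiation mfps :: (comm_ring_1, finite) comm_ring_1
begin

definition zero_mfps :: "('a, 'b) mfps" where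
  "0 = Abs_mfps (\<lambda>\<alpha>. 0)"

definition one_mfps :: "('a, 'b) mfps" where
  "1 = Abs_mfps (\<lambda>\<alpha>. if \<alpha> = 0 then 1 else 0)"

definition plus_mfps :: "('a, 'b) mfps \<Rightarrow> ('a, 'b) mfps \<Rightarrow> ('a, 'b) mfps" where
  "f + g = Abs_mfps (\<lambda>\<alpha>. mcoeff f \<alpha> + mcoeff g \<alpha>)"

definition minus_mfps :: "('a, 'b) mfps \<Rightarrow> ('a, 'b) mfps \<Rightarrow> ('a, 'b) mfps" where
  "f - g = Abs_mfps (\<lambda>\<alpha>. mcoeff f \<alpha> - mcoeff g \<alpha>)"

definition uminus_mfps :: "('a, 'b) mfps \<Rightarrow> ('a, 'b) mfps" where
  "- f = Abs_mfps (\<lambda>\<alpha>. - mcoeff f \<alpha>)"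

definition times_mfps :: "('a, 'b) mfps \<Rightarrow> ('a, 'b) mfps \<Rightarrow> ('a, 'b) mfps" where
  "f * g = Abs_mfps (\<lambda>\<beta>. \<Sum>\<alpha> | \<alpha> \<le> \<beta>. mcoeff f \<alpha> * mcoeff g (\<beta> - \<alpha>))"

instance
proof
  fix f g h :: "('a, 'b) mfps"
  have comm: "f * g = g * f" for f g :: "('a, 'b) mfps"
  proof (rule mfps_eqI)
    fix \<beta> :: "nat ^ 'b"
    have diff_diff: "\<beta> - (\<beta> - \<alpha>) = \<alpha>" if "\<forall>i. \<alpha> $ i \<le> \<beta> $ i" for \<alpha>
      using that by (simp add: vec_eq_iff)
    have "(\<Sum>\<alpha> | \<alpha> \<le> \<beta>. mcoeff f \<alpha> * mcoeff g (\<beta> - \<alpha>)) =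
          (\<Sum>\<alpha> | \<alpha> \<le> \<beta>. mcoeff g \<alpha> * mcoeff f (\<beta> - \<alpha>))"
      by (rule sum.reindex_bij_witness [where i = "\<lambda>\<alpha>. \<beta> - \<alpha>" and j = "\<lambda>\<alpha>. \<beta> - \<alpha>"])
        (auto simp: less_eq_vec_def diff_diff mult.commute)
    then show "mcoeff (f * g) \<beta> = mcoeff (g * f) \<beta>"
      by (simp add: times_mfps_def)
  qed
  show "f * g = g * f"
    by (rule comm)
  show "f * g * h = f * (g * h)"
  proof (rule mfps_eqI)
    fix \<beta> :: "nat ^ 'b"
    let ?t = "\<lambda>\<gamma> \<delta> \<epsilon>. mcoeff f \<gamma> * mcoeff g \<delta> * mcoeff h \<epsilon>"
    have "mcoeff (f * g * h) \<beta> =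
        (\<Sum>\<alpha> | \<alpha> \<le> \<beta>. \<Sum>\<gamma> | \<gamma> \<le> \<alpha>. ?t \<gamma> (\<alpha> - \<gamma>) (\<beta> - \<alpha>))"
      by (simp add: times_mfps_def sum_distrib_right)
    also have "\<dots> = (\<Sum>(\<alpha>, \<gamma>)\<in>(SIGMA \<alpha>:{\<alpha>. \<alpha> \<le> \<beta>}. {\<gamma>. \<gamma> \<le> \<alpha>}). ?t \<gamma> (\<alpha> - \<gamma>) (\<beta> - \<alpha>))"
      by (rule sum.Sigma) auto
    also have "\<dots> = (\<Sum>(\<gamma>, \<delta>)\<in>(SIGMA \<gamma>:{\<gamma>. \<gamma> \<le> \<beta>}. {\<delta>. \<delta> \<le> \<beta> - \<gamma>}). ?t \<gamma> \<delta> (\<beta> - \<gamma> - \<delta>))"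
    proof (rule sum.reindex_bij_witness
        [where j = "\<lambda>(\<alpha>, \<gamma>). (\<gamma>, \<alpha> - \<gamma>)" and i = "\<lambda>(\<gamma>, \<delta>). (\<gamma> + \<delta>, \<gamma>)"], goal_cases)
      case (1 a)
      then show ?case by (auto simp: less_eq_vec_def vec_eq_iff)
    next
      case (2 a)
      then show ?case
        by (clarsimp simp: less_eq_vec_def) (meson diff_le_mono order_trans)
    next
      case (3 b)
      then show ?case by (simp add: case_prod_beta vec_eq_iff prod_eq_iff)
    next
      case (4 b)
      obtain \<gamma> \<delta> where b: "b = (\<gamma>, \<delta>)" by (cases b)
      have "\<gamma> $ i + \<delta> $ i \<le> \<beta> $ i" for i
      proof -
        have "\<gamma> $ i \<le> \<beta> $ i" "\<delta> $ i \<le> \<beta> $ i - \<gamma> $ i"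
          using 4 by (simp_all add: b less_eq_vec_def)
        then show ?thesis by linarith
      qed
      then show ?case by (simp add: b less_eq_vec_def)
    next
      case (5 a)
      obtain \<alpha> \<gamma> where a: "a = (\<alpha>, \<gamma>)" by (cases a)
      with 5 have "\<beta> - \<gamma> - (\<alpha> - \<gamma>) = \<beta> - \<alpha>"
        by (simp add: less_eq_vec_def vec_eq_iff)
      then show ?case by (simp add: a)
    qed
    also have "\<dots> = (\<Sum>\<gamma> | \<gamma> \<le> \<beta>. \<Sum>\<delta> | \<delta> \<le> \<beta> - \<gamma>. ?t \<gamma> \<delta> (\<beta> - \<gamma> - \<delta>))"
      by (rule sum.Sigma [symmetric]) auto
    also have "\<dots> = mcoeff (f * (g * h)) \<beta>"
      by (simp add: times_mfps_def sum_distrib_left mult.assoc)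
    finally show "mcoeff (f * g * h) \<beta> = mcoeff (f * (g * h)) \<beta>" .
  qed
  show "1 * f = f"
  proof (rule mfps_eqI)
    fix \<beta> :: "nat ^ 'b"
    have "mcoeff (1 * f) \<beta> =
        (\<Sum>\<alpha> | \<alpha> \<le> \<beta>. if \<alpha> = 0 then mcoeff f (\<beta> - \<alpha>) else 0)"
      by (simp add: times_mfps_def one_mfps_def if_distrib [of "\<lambda>x. x * _"] cong: if_cong)
    also have "\<dots> = mcoeff f (\<beta> - 0)"
      by (simp add: sum.delta less_eq_vec_def [of 0])
    also have "\<beta> - 0 = \<beta>"
      by (simp add: vec_eq_iff)
    finally show "mcoeff (1 * f) \<beta> = mcoeff f \<beta>" .
  qed
  show "(f + g) * h = f * h + g * h"
    by (rule mfps_eqI) (simp add: times_mfps_def plus_mfps_def distrib_right sum.distrib)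
  show "(0 :: ('a, 'b) mfps) \<noteq> 1"
  proof
    assume "(0 :: ('a, 'b) mfps) = 1"
    then have "mcoeff (0 :: ('a, 'b) mfps) 0 = mcoeff (1 :: ('a, 'b) mfps) 0"
      by simp
    then show False
      by (simp add: zero_mfps_def one_mfps_def)
  qed
qed (rule mfps_eqI, simp add: plus_mfps_def zero_mfps_def minus_mfps_def uminus_mfps_def)+

end

definition mvar :: "'n::finite \<Rightarrow> ('a::comm_ring_1, 'n) mfps" where
  "mvar i = Abs_mfps (\<lambda>\<alpha>. if \<alpha> = axis i 1 then 1 else 0)"

definition mfps_deriv :: "'n::finite \<Rightarrow> ('a::comm_ring_1, 'n) mfps \<Rightarrow> ('a, 'n) mfps" where
  "mfps_deriv j f = Abs_mfps (\<lambda>\<alpha>. of_nat (\<alpha> $ j + 1) * mcoeff f (\<alpha> + axis j 1))"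

text \<open>
  Substitution of a vector \<open>G\<close> of series without constant terms: the monomials of degree larger
  than \<open>mdeg \<beta>\<close> do not contribute to the coefficient at \<open>\<beta>\<close>, so the sum is finite.
\<close>

definition mfps_compose ::
    "('a::comm_ring_1, 'm::finite) mfps \<Rightarrow> ('a, 'n::finite) mfps ^ 'm \<Rightarrow> ('a, 'n) mfps" where
  "mfps_compose f G = Abs_mfps (\<lambda>\<beta>. \<Sum>\<alpha> | mdeg \<alpha> \<le> mdeg \<beta>.
     mcoeff f \<alpha> * mcoeff (\<Prod>i\<in>UNIV. (G $ i) ^ (\<alpha> $ i)) \<beta>)"

type_synonym 'n formal_map = "(real, 'n) mfps ^ 'n"

definition formal_comp :: "'n::finite formal_map \<Rightarrow> 'n formal_map \<Rightarrow> 'n formal_map" where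
  "formal_comp F G = (\<chi> i. mfps_compose (F $ i) G)"

text \<open>The vector \<open>(D\<Phi>) Y\<close>.\<close>

definition formal_jacobian_apply :: "'n::finite formal_map \<Rightarrow> 'n formal_map \<Rightarrow> 'n formal_map" where
  "formal_jacobian_apply \<Phi> Y = (\<chi> i. \<Sum>j\<in>UNIV. mfps_deriv j (\<Phi> $ i) * Y $ j)"


section \<open>Smooth functions and their Taylor series at the origin\<close>

definition partial_deriv ::
    "'n::finite \<Rightarrow> (real ^ 'n \<Rightarrow> 'b::real_normed_vector) \<Rightarrow> real ^ 'n \<Rightarrow> 'b" where
  "partial_deriv i f x = vector_derivative (\<lambda>t. f (x + t *\<^sub>R axis i 1)) (at 0)"

text \<open>
  \<open>C\<^sup>\<infinity>\<close> on the whole space: all iterated partial derivatives exist and are differentiable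
  (hence continuous).
\<close>

definition smooth :: "(real ^ 'n::finite \<Rightarrow> 'b::real_normed_vector) \<Rightarrow> bool" where
  "smooth f \<longleftrightarrow> (\<forall>js. foldr partial_deriv js f differentiable_on UNIV)"

text \<open>
  For smooth \<open>f\<close> the order of differentiation is irrelevant; the list below enumerates
  all variables in some order.
\<close>

definition multi_deriv ::
    "nat ^ 'n::finite \<Rightarrow> (real ^ 'n \<Rightarrow> 'b::real_normed_vector) \<Rightarrow> real ^ 'n \<Rightarrow> 'b" where
  "multi_deriv \<alpha> f = foldr (\<lambda>i. partial_deriv i ^^ (\<alpha> $ i)) (SOME js. distinct js \<and> set js = UNIV) f"

definition taylor :: "(real ^ 'n::finite \<Rightarrow> real) \<Rightarrow> (real, 'n) mfps" where
  "taylor f = Abs_mfps (\<lambda>\<alpha>. multi_deriv \<alpha> f 0 / (\<Prod>i\<in>UNIV. fact (\<alpha> $ i)))"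

definition taylor_map :: "(real ^ 'n::finite \<Rightarrow> real ^ 'n) \<Rightarrow> 'n formal_map" where
  "taylor_map F = (\<chi> i. taylor (\<lambda>x. F x $ i))"


section \<open>Reversibility and formal conjugacy\<close>

definition reversible_equivariant ::
    "(real ^ 'n \<Rightarrow> real ^ 'n) \<Rightarrow> (real ^ 'n \<Rightarrow> real ^ 'n) \<Rightarrow> bool" where
  "reversible_equivariant \<phi> F \<longleftrightarrow> (\<forall>x. F (\<phi> x) = - \<phi> (F x))"

definition homogeneous_polymap :: "nat \<Rightarrow> (real ^ 'n::finite \<Rightarrow> real ^ 'n) \<Rightarrow> bool" where
  "homogeneous_polymap k p \<longleftrightarrow>
     (\<exists>c :: nat ^ 'n \<Rightarrow> real ^ 'n. \<forall>x. p x = (\<Sum>\<alpha> | mdeg \<alpha> = k. (\<Prod>i\<in>UNIV. x $ i ^ (\<alpha> $ i)) *\<^sub>R c \<alpha>))"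

text \<open>\<open>formal_changes \<xi> m = (I + \<xi> 2) \<circ> (I + \<xi> 3) \<circ> \<dots> \<circ> (I + \<xi> (m + 1))\<close>\<close>

primrec formal_changes ::
    "(nat \<Rightarrow> real ^ 'n \<Rightarrow> real ^ 'n) \<Rightarrow> nat \<Rightarrow> 'n::finite formal_map" where
  "formal_changes \<xi> 0 = (\<chi> i. mvar i)"
| "formal_changes \<xi> (Suc m) =
     formal_comp (formal_changes \<xi> m) (taylor_map (\<lambda>x. x + \<xi> (m + 2) x))"

text \<open>
  The infinite composition of the \<open>I + \<xi> k\<close>, \<open>k \<ge> 2\<close>, is the coefficientwise limit of the finite
  ones: every coefficient is eventually constant.
\<close>

definition is_infinite_composition ::
    "(nat \<Rightarrow> real ^ 'n \<Rightarrow> real ^ 'n) \<Rightarrow> 'n::finite formal_map \<Rightarrow> bool" where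
  "is_infinite_composition \<xi> \<Phi> \<longleftrightarrow>
     (\<forall>i \<beta>. \<forall>\<^sub>F m in sequentially. mcoeff (formal_changes \<xi> m $ i) \<beta> = mcoeff (\<Phi> $ i) \<beta>)"

text \<open>Formal conjugacy of \<open>x' = F x\<close> (old system) to \<open>y' = Y y\<close> (new system) via \<open>x = \<Phi> y\<close>.\<close>

definition formally_conjugate ::
    "(real ^ 'n::finite \<Rightarrow> real ^ 'n) \<Rightarrow> (real ^ 'n \<Rightarrow> real ^ 'n) \<Rightarrow> (real ^ 'n \<Rightarrow> real ^ 'n)
     \<Rightarrow> bool" where
  "formally_conjugate \<phi> F Y \<longleftrightarrow>
     (\<exists>\<xi> \<Phi>. (\<forall>k\<ge>2. homogeneous_polymap k (\<xi> k) \<and> (\<forall>x. \<xi> k (\<phi> x) = \<phi> (\<xi> k x))) \<and>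
        is_infinite_composition \<xi> \<Phi> \<and>
        formal_jacobian_apply \<Phi> (taylor_map Y) = formal_comp (taylor_map F) \<Phi>)"


section \<open>The system on \<open>\<real>\<^sup>6 = \<real>\<^sup>2 \<times> \<complex>\<^sup>2\<close>\<close>

definition z1 :: "real ^ 6 \<Rightarrow> complex" where
  "z1 x = Complex (x $ 3) (x $ 4)"

definition z2 :: "real ^ 6 \<Rightarrow> complex" where
  "z2 x = Complex (x $ 5) (x $ 6)"

definition of_coords :: "real \<Rightarrow> real \<Rightarrow> complex \<Rightarrow> complex \<Rightarrow> real ^ 6" where
  "of_coords a b z w = vector [a, b, Re z, Im z, Re w, Im w]"

definition Lmat :: "real \<Rightarrow> real \<Rightarrow> real ^ 6 ^ 6" where
  "Lmat \<omega>1 \<omega>2 = vector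
    [vector [0, 1,   0,  0,   0,  0],
     vector [0, 0,   0,  0,   0,  0],
     vector [0, 0,   0,  \<omega>1,  0,  0],
     vector [0, 0, - \<omega>1, 0,   0,  0],
     vector [0, 0,   0,  0,   0,  \<omega>2],
     vector [0, 0,   0,  0, - \<omega>2, 0]]"

definition \<phi> :: "real ^ 6 \<Rightarrow> real ^ 6" where
  "\<phi> x = of_coords (x $ 1) (- x $ 2) (cnj (z1 x)) (cnj (z2 x))"

definition invariants :: "nat \<Rightarrow> nat \<Rightarrow> real ^ 6 \<Rightarrow> real ^ 4" where
  "invariants n1 n2 x = vector [x $ 1, (cmod (z1 x))\<^sup>2, (cmod (z2 x))\<^sup>2, Re (z1 x ^ n2 * cnj (z2 x) ^ n1)]"

definition normal_form ::
    "nat \<Rightarrow> nat \<Rightarrow> real \<Rightarrow> real \<Rightarrow> (nat \<Rightarrow> real ^ 4 \<Rightarrow> real) \<Rightarrow> real ^ 6 \<Rightarrow> real ^ 6" where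
  "normal_form n1 n2 \<omega>1 \<omega>2 f x =
    (let z = z1 x; w = z2 x;
         J = Im (z ^ n2 * cnj w ^ n1);
         g = (\<lambda>i. f i (invariants n1 n2 x));
         c = (\<lambda>i. complex_of_real (g i))
     in of_coords
       (x $ 2 + x $ 1 * J * g 0)
       (g 1 + x $ 2 * J * g 0)
       (- \<i> * \<omega>1 * z + \<i> * z * c 2 + \<i> * cnj z ^ (n2 - 1) * w ^ n1 * c 3
         + z * J * c 4 + cnj z ^ (n2 - 1) * w ^ n1 * J * c 5)
       (- \<i> * \<omega>2 * w + \<i> * w * c 6 + \<i> * z ^ n2 * cnj w ^ (n1 - 1) * c 7
         + w * J * c 8 + z ^ n2 * cnj w ^ (n1 - 1) * J * c 9))"

end

theory Submission
  imports Defs "HOL-Library.Z2"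
begin

text \<open>
  In each degree \<open>k\<close> one removes from the residual \<open>(D\<Phi>) Y - F \<circ> \<Phi>\<close> everything outside a complement of
  the image of the homological operator \<open>\<xi> \<mapsto> (D\<xi>) L - L \<xi>\<close>. In the coordinates
  \<open>x\<^sub>1, i x\<^sub>2, z\<^sub>1, cnj z\<^sub>1, z\<^sub>2, cnj z\<^sub>2\<close> the derivation \<open>f \<mapsto> i (Df) L\<close> multiplies a monomial by its
  frequency and adds a nilpotent part that trades \<open>x\<^sub>1\<close> for \<open>i x\<^sub>2\<close>; so nonresonant monomials are
  reached by induction on the exponent of \<open>x\<^sub>1\<close>, while resonant ones with enough factors \<open>x\<^sub>2\<close> are images of
  monomials with fewer such factors. Coprimality of \<open>n\<^sub>1, n\<^sub>2\<close> turns the remaining resonant monomials into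
  products of the four invariants, \<open>Im (z\<^sub>1\<^bsup>n\<^sub>2\<^esup> cnj z\<^sub>2\<^bsup>n\<^sub>1\<^esup>)\<close> and the equivariant generators. Reversible
  fields are those with real coefficients (up to a factor \<open>i\<close>) in these coordinates, so the reversing symmetry
  is respected throughout. Borel's lemma turns the resulting formal coefficients into smooth functions;
  no bump functions are needed, since scaled products of sines have small low-order derivatives.
\<close>


text \<open>The nilpotent block shapes the argument. The first component of the homological equation
  can be solved for \<open>\<xi> $ 2\<close>; substitution merges the first two components into one
  second-order equation for \<open>\<xi> $ 1\<close>, whose cokernel keeps resonant monomials with
  at most one factor \<open>x\<^sub>2\<close>. Those with one such factor must be absorbed by
  \<open>f\<^sub>0\<close>, which occurs in both components, and this requires inverting 2 + x1
  d/dx1 on series in the invariants. The imaginary part of the resonant monomial is needed only to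
  first power, because its square is a polynomial in the four invariants. Solutions are found
  without control of their degree and then truncated: every operator in the equation commutes with
  taking homogeneous parts. Each coefficient of each \<open>f\<^sub>i\<close> contributes to exactly
  one degree of the field, so the choices made in different degrees never compete and assemble into
  ten formal series in four variables.\<close>

declare One_nat_def [simp del]

section \<open>Calculus of formal power series\<close>

lemma mcoeff_zero [simp]: "mcoeff 0 \<beta> = 0"
  by (simp add: zero_mfps_def)

lemma mcoeff_one: "mcoeff 1 \<beta> = (if \<beta> = 0 then 1 else 0)"
  by (simp add: one_mfps_def)

lemma mcoeff_add [simp]: "mcoeff (f + g) \<beta> = mcoeff f \<beta> + mcoeff g \<beta>"
  by (simp add: plus_mfps_def)

lemma mcoeff_diff [simp]: "mcoeff (f - g) \<beta> = mcoeff f \<beta> - mcoeff g \<beta>"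
  by (simp add: minus_mfps_def)

lemma mcoeff_uminus [simp]: "mcoeff (- f) \<beta> = - mcoeff f \<beta>"
  by (simp add: uminus_mfps_def)

lemma mcoeff_mult: "mcoeff (f * g) \<beta> = (\<Sum>\<alpha> | \<alpha> \<le> \<beta>. mcoeff f \<alpha> * mcoeff g (\<beta> - \<alpha>))"
  by (simp add: times_mfps_def)

lemma mcoeff_sum [simp]: "mcoeff (\<Sum>a\<in>A. f a) \<beta> = (\<Sum>a\<in>A. mcoeff (f a) \<beta>)"
  by (induction A rule: infinite_finite_induct) auto

lemma mcoeff_mvar: "mcoeff (mvar i) \<alpha> = (if \<alpha> = axis i 1 then 1 else 0)"
  by (simp add: mvar_def)

lemma mcoeff_deriv: "mcoeff (mfps_deriv j f) \<alpha> = of_nat (\<alpha> $ j + 1) * mcoeff f (\<alpha> + axis j 1)"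
  by (simp add: mfps_deriv_def)

text \<open>Real scalars matter even on complex series: the homological equation is later solved on
  real spans, by \<open>span\<close> and \<open>subspace\<close>, since reversibility is a condition
  of real coefficients.\<close>

instantiation mfps :: ("{comm_ring_1, real_algebra_1}", finite) real_algebra_1
begin

definition scaleR_mfps :: "real \<Rightarrow> ('a, 'b) mfps \<Rightarrow> ('a, 'b) mfps" where
  "scaleR_mfps r f = Abs_mfps (\<lambda>\<alpha>. r *\<^sub>R mcoeff f \<alpha>)"

instance
  by standard
    (auto intro!: mfps_eqI
      simp: scaleR_mfps_def mcoeff_mult scaleR_right_distrib scaleR_left_distrib scaleR_sum_right)

end

lemma mcoeff_scaleR [simp]: "mcoeff (r *\<^sub>R f) \<alpha> = r *\<^sub>R mcoeff f \<alpha>"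
  by (simp add: scaleR_mfps_def)

section \<open>Degrees of multi-indices\<close>

lemma mdeg_0 [simp]: "mdeg 0 = 0"
  by (simp add: mdeg_def)

lemma mdeg_add [simp]: "mdeg (\<alpha> + \<beta>) = mdeg \<alpha> + mdeg \<beta>"
  by (simp add: mdeg_def sum.distrib)

lemma mdeg_axis [simp]: "mdeg (axis i k) = k"
  by (simp add: mdeg_def axis_def)

lemma mdeg_eq_0_iff [simp]: "mdeg \<alpha> = 0 \<longleftrightarrow> \<alpha> = 0"
  by (simp add: mdeg_def vec_eq_iff)

lemma multiindex_add_diff: "\<alpha> \<le> \<beta> \<Longrightarrow> \<alpha> + (\<beta> - \<alpha>) = (\<beta> :: nat ^ 'n::finite)"
  by (simp add: less_eq_vec_def vec_eq_iff)

lemma mdeg_diff: "\<alpha> \<le> \<beta> \<Longrightarrow> mdeg \<alpha> + mdeg (\<beta> - \<alpha>) = mdeg \<beta>"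
  by (metis mdeg_add multiindex_add_diff)

lemma multiindex_cases:
  fixes \<alpha> :: "nat ^ 'n::finite"
  obtains "\<alpha> = 0" | i \<alpha>' where "\<alpha> = \<alpha>' + axis i 1"
proof (cases "\<alpha> = 0")
  case False
  then obtain i where "\<alpha> $ i \<noteq> 0" by (auto simp: vec_eq_iff)
  then have "\<alpha> = (\<alpha> - axis i 1) + axis i 1"
    by (auto simp: vec_eq_iff axis_def)
  then show ?thesis using that by blast
qed (use that in auto)

lemma multiindex_induct [case_names 0 add]:
  fixes \<alpha> :: "nat ^ 'n::finite"
  assumes "P 0" "\<And>\<alpha> i. P \<alpha> \<Longrightarrow> P (\<alpha> + axis i 1)"
  shows "P \<alpha>"
proof (induction "mdeg \<alpha>" arbitrary: \<alpha>)
  case 0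
  then show ?case using assms(1) by simp
next
  case (Suc n)
  then show ?case
    by (cases \<alpha> rule: multiindex_cases) (use assms(2) in auto)
qed

section \<open>Formal partial derivatives\<close>

lemma mfps_deriv_add: "mfps_deriv j (f + g) = mfps_deriv j f + mfps_deriv j g"
  by (rule mfps_eqI) (simp add: mcoeff_deriv algebra_simps)

lemma mfps_deriv_0 [simp]: "mfps_deriv j 0 = 0"
  by (rule mfps_eqI) (simp add: mcoeff_deriv)

lemma mfps_deriv_diff: "mfps_deriv j (f - g) = mfps_deriv j f - mfps_deriv j g"
  by (rule mfps_eqI) (simp add: mcoeff_deriv algebra_simps)

lemma mfps_deriv_scaleR:
  "mfps_deriv j (r *\<^sub>R f :: ('a::{comm_ring_1, real_algebra_1}, 'n::finite) mfps) = r *\<^sub>R mfps_deriv j f"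
  by (rule mfps_eqI) (simp add: mcoeff_deriv)

lemma axis_eq_0_iff_nat [simp]: "axis i (1::nat) \<noteq> 0"
  by (metis mdeg_axis mdeg_0 zero_neq_one)

lemma mfps_deriv_1 [simp]: "mfps_deriv j 1 = 0"
proof (rule mfps_eqI)
  fix \<alpha> :: "nat ^ 'b"
  have "\<alpha> + axis j 1 \<noteq> 0"
    by (metis mdeg_add mdeg_axis mdeg_0 add_is_0 zero_neq_one)
  then show "mcoeff (mfps_deriv j (1 :: ('a, 'b) mfps)) \<alpha> = mcoeff 0 \<alpha>"
    by (simp add: mcoeff_deriv mcoeff_one)
qed

lemma mfps_deriv_mvar: "mfps_deriv j (mvar i) = (if i = j then 1 else 0)"
proof (rule mfps_eqI)
  fix \<alpha> :: "nat ^ 'b"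
  have "\<alpha> + axis j 1 = axis i 1 \<longleftrightarrow> \<alpha> = 0 \<and> i = j"
  proof
    assume eq: "\<alpha> + axis j 1 = axis i 1"
    then have "mdeg (\<alpha> + axis j 1) = mdeg (axis i 1 :: nat ^ 'b)" by simp
    then have "\<alpha> = 0" by simp
    then show "\<alpha> = 0 \<and> i = j" using eq by (auto simp: axis_eq_axis)
  qed auto
  then show "mcoeff (mfps_deriv j (mvar i :: ('a, 'b) mfps)) \<alpha> = mcoeff (if i = j then 1 else 0) \<alpha>"
    by (auto simp: mcoeff_deriv mcoeff_mvar mcoeff_one)
qed

text \<open>In each term of the Cauchy product at \<open>?B\<close> the factor
  \<open>\<beta> $ j + 1\<close> splits into \<open>\<alpha> $ j\<close> and
  \<open>(?B - \<alpha>) $ j\<close>; the two resulting sums are the two products of the Leibniz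
  rule.\<close>

lemma mfps_deriv_mult: "mfps_deriv j (f * g) = mfps_deriv j f * g + f * mfps_deriv j g"
proof (rule mfps_eqI)
  fix \<beta> :: "nat ^ 'b"
  let ?e = "axis j 1 :: nat ^ 'b"
  let ?B = "\<beta> + ?e"
  have split: "of_nat (\<beta> $ j + 1) * (mcoeff f \<alpha> * mcoeff g (?B - \<alpha>)) =
      of_nat (\<alpha> $ j) * (mcoeff f \<alpha> * mcoeff g (?B - \<alpha>)) +
      of_nat ((?B - \<alpha>) $ j) * (mcoeff f \<alpha> * mcoeff g (?B - \<alpha>))" if "\<alpha> \<le> ?B" for \<alpha>
  proof -
    have "\<alpha> $ j \<le> \<beta> $ j + 1"
      using that unfolding less_eq_vec_def
      by (metis vector_add_component axis_nth)
    then have "of_nat (\<beta> $ j + 1) = (of_nat (\<alpha> $ j) + of_nat ((?B - \<alpha>) $ j) :: 'a)"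
      by (simp flip: of_nat_add)
    then show ?thesis by (simp only: distrib_right)
  qed
  have inv: "a - ?e + ?e = a" if "a $ j \<noteq> 0" for a
    using that by (auto simp: vec_eq_iff axis_def)
  have inv': "a + ?e - ?e = a" for a
    by (auto simp: vec_eq_iff)
  have "mcoeff (mfps_deriv j (f * g)) \<beta> =
      (\<Sum>\<alpha> | \<alpha> \<le> ?B. of_nat (\<beta> $ j + 1) * (mcoeff f \<alpha> * mcoeff g (?B - \<alpha>)))"
    by (simp add: mcoeff_deriv mcoeff_mult sum_distrib_left)
  also have "\<dots> = (\<Sum>\<alpha> | \<alpha> \<le> ?B. of_nat (\<alpha> $ j) * (mcoeff f \<alpha> * mcoeff g (?B - \<alpha>))) +
      (\<Sum>\<alpha> | \<alpha> \<le> ?B. of_nat ((?B - \<alpha>) $ j) * (mcoeff f \<alpha> * mcoeff g (?B - \<alpha>)))"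
    unfolding sum.distrib [symmetric] by (intro sum.cong refl split) simp
  \<comment> \<open>Terms with \<open>\<alpha> $ j = 0\<close> carry the factor 0; without them the
    shift by \<open>?e\<close> is a bijection onto all
    \<open>\<alpha> \<le> \<beta>\<close>.\<close>
  also have "(\<Sum>\<alpha> | \<alpha> \<le> ?B. of_nat (\<alpha> $ j) * (mcoeff f \<alpha> * mcoeff g (?B - \<alpha>))) =
      (\<Sum>\<alpha> | \<alpha> \<le> \<beta>. of_nat (\<alpha> $ j + 1) * mcoeff f (\<alpha> + ?e) * mcoeff g (\<beta> - \<alpha>))"
    (is "sum ?g _ = _")
  proof (subst sum.mono_neutral_right [where S = "{\<alpha>. \<alpha> \<le> ?B \<and> \<alpha> $ j \<noteq> 0}"],
      goal_cases)
    case 4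
    show ?case
    proof (rule sum.reindex_bij_witness
          [where i = "\<lambda>\<alpha>. \<alpha> + ?e" and j = "\<lambda>\<alpha>. \<alpha> - ?e"], goal_cases)
      case (1 a)
      then show ?case by (intro inv) auto
    next
      case (2 a)
      then have "(a - ?e) $ i \<le> \<beta> $ i" for i
        by (auto simp: less_eq_vec_def le_diff_conv)
      then show ?case by (simp add: less_eq_vec_def)
    next
      case (4 a)
      then show ?case by (simp add: less_eq_vec_def)
    next
      case (5 a)
      then have a: "a - ?e + ?e = a" by (intro inv) auto
      have "?B - a = \<beta> - (a - ?e)"
        by (subst (1) a [symmetric]) (simp add: vec_eq_iff)
      moreover have "(a - ?e) $ j + 1 = a $ j"
        by (metis a axis_nth vector_add_component)
      ultimately show ?case by (simp only: a mult.assoc)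
    qed (auto simp: inv')
  qed auto
  also have "(\<Sum>\<alpha> | \<alpha> \<le> ?B. of_nat ((?B - \<alpha>) $ j) * (mcoeff f \<alpha> * mcoeff g (?B - \<alpha>))) =
      (\<Sum>\<alpha> | \<alpha> \<le> \<beta>. mcoeff f \<alpha> * (of_nat ((\<beta> - \<alpha>) $ j + 1) * mcoeff g (\<beta> - \<alpha> + ?e)))"
  proof (rule sum.mono_neutral_cong_right)
    show "{\<alpha>. \<alpha> \<le> \<beta>} \<subseteq> {\<alpha>. \<alpha> \<le> ?B}"
      by (auto simp: less_eq_vec_def intro: trans_le_add1)
    show "\<forall>\<alpha>\<in>{\<alpha>. \<alpha> \<le> ?B} - {\<alpha>. \<alpha> \<le> \<beta>}.
        of_nat ((?B - \<alpha>) $ j) * (mcoeff f \<alpha> * mcoeff g (?B - \<alpha>)) = 0"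
    proof
      fix \<alpha> assume \<alpha>: "\<alpha> \<in> {\<alpha>. \<alpha> \<le> ?B} - {\<alpha>. \<alpha> \<le> \<beta>}"
      then obtain i where "\<not> \<alpha> $ i \<le> \<beta> $ i" by (auto simp: less_eq_vec_def)
      moreover have "\<alpha> $ k \<le> \<beta> $ k + (if k = j then 1 else 0)" for k
        using \<alpha> by (auto simp: less_eq_vec_def axis_def split: if_splits)
      ultimately have "i = j" by (metis add.right_neutral)
      with \<open>\<not> \<alpha> $ i \<le> \<beta> $ i\<close> show "of_nat ((?B - \<alpha>) $ j) * (mcoeff f \<alpha> * mcoeff g (?B - \<alpha>)) = 0"
        by simp
    qed
    fix \<alpha> assume "\<alpha> \<in> {\<alpha>. \<alpha> \<le> \<beta>}"
    then have "?B - \<alpha> = \<beta> - \<alpha> + ?e"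
      by (auto simp: less_eq_vec_def vec_eq_iff)
    then show "of_nat ((?B - \<alpha>) $ j) * (mcoeff f \<alpha> * mcoeff g (?B - \<alpha>)) =
        mcoeff f \<alpha> * (of_nat ((\<beta> - \<alpha>) $ j + 1) * mcoeff g (\<beta> - \<alpha> + ?e))"
      by (simp add: algebra_simps)
  qed simp
  finally show "mcoeff (mfps_deriv j (f * g)) \<beta> = mcoeff (mfps_deriv j f * g + f * mfps_deriv j g) \<beta>"
    by (simp add: mcoeff_mult mcoeff_deriv mult.assoc)
qed

subsection \<open>Order of vanishing and gradings\<close>

text \<open>The filtration by powers of the ideal of series without constant term; degree-by-degree
  arguments are congruences modulo it.\<close>

definition order_ge :: "nat \<Rightarrow> ('a::comm_ring_1, 'n::finite) mfps \<Rightarrow> bool" where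
  "order_ge k f \<longleftrightarrow> (\<forall>\<beta>. mdeg \<beta> < k \<longrightarrow> mcoeff f \<beta> = 0)"

lemma order_ge_0 [simp]: "order_ge 0 f"
  by (simp add: order_ge_def)

lemma order_ge_zero [simp]: "order_ge k 0"
  by (simp add: order_ge_def)

lemma order_ge_mono: "order_ge k f \<Longrightarrow> l \<le> k \<Longrightarrow> order_ge l f"
  by (auto simp: order_ge_def)

lemma order_ge_add: "order_ge k f \<Longrightarrow> order_ge k g \<Longrightarrow> order_ge k (f + g)"
  by (auto simp: order_ge_def)

lemma order_ge_diff: "order_ge k f \<Longrightarrow> order_ge k g \<Longrightarrow> order_ge k (f - g)"
  by (auto simp: order_ge_def)

lemma order_ge_uminus: "order_ge k f \<Longrightarrow> order_ge k (- f)"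
  by (auto simp: order_ge_def)

lemma order_ge_sum: "(\<And>a. a \<in> A \<Longrightarrow> order_ge k (f a)) \<Longrightarrow> order_ge k (\<Sum>a\<in>A. f a)"
  by (auto simp: order_ge_def)

lemma order_ge_mult:
  assumes "order_ge k f" "order_ge l g" shows "order_ge (k + l) (f * g)"
  unfolding order_ge_def
proof (intro allI impI)
  fix \<beta> :: "nat ^ 'b" assume \<beta>: "mdeg \<beta> < k + l"
  have "mcoeff f \<alpha> * mcoeff g (\<beta> - \<alpha>) = 0" if "\<alpha> \<le> \<beta>" for \<alpha>
  proof (cases "mdeg \<alpha> < k")
    case False
    then have "mdeg (\<beta> - \<alpha>) < l" using mdeg_diff [OF that] \<beta> by linarith
    then show ?thesis using assms(2) by (simp add: order_ge_def)
  qed (use assms(1) in \<open>simp add: order_ge_def\<close>)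
  then show "mcoeff (f * g) \<beta> = 0"
    by (auto simp: mcoeff_mult intro: sum.neutral)
qed

lemma order_ge_mult': "order_ge k f \<Longrightarrow> order_ge l g \<Longrightarrow> m \<le> k + l \<Longrightarrow> order_ge m (f * g)"
  using order_ge_mono order_ge_mult by blast

lemma order_ge_deriv: "order_ge (Suc k) f \<Longrightarrow> order_ge k (mfps_deriv j f)"
  by (auto simp: order_ge_def mcoeff_deriv)

text \<open>Over the reals the factor \<open>\<alpha> $ j + 1\<close> cancels, so a series is
  determined by its constant term and its first derivatives. This is the induction step behind the
  identities for Taylor series.\<close>

lemma order_ge_Suc_deriv:
  fixes f :: "(real, 'n::finite) mfps"
  assumes "mcoeff f 0 = 0" "\<And>j. order_ge k (mfps_deriv j f)"
  shows "order_ge (Suc k) f"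
  unfolding order_ge_def
proof (intro allI impI)
  fix \<beta> :: "nat ^ 'n" assume "mdeg \<beta> < Suc k"
  then show "mcoeff f \<beta> = 0"
  proof (cases \<beta> rule: multiindex_cases)
    case (2 i \<alpha>)
    with \<open>mdeg \<beta> < Suc k\<close> have "mcoeff (mfps_deriv i f) \<alpha> = 0"
      using assms(2) [of i] by (simp add: order_ge_def)
    then show ?thesis by (simp add: 2 mcoeff_deriv del: of_nat_add of_nat_Suc)
  qed (use assms in auto)
qed

lemma mfps_eq_by_order: "(\<And>k. order_ge k (f - g)) \<Longrightarrow> f = g"
  by (rule mfps_eqI) (metis eq_iff_diff_eq_0 lessI mcoeff_diff order_ge_def)

lemma order_ge_power: "order_ge k f \<Longrightarrow> order_ge (n * k) (f ^ n)"
  by (induction n) (auto dest: order_ge_mult)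

lemma order_ge_prod:
  "(\<And>i. i \<in> A \<Longrightarrow> order_ge (k i) (f i)) \<Longrightarrow> order_ge (\<Sum>i\<in>A. k i) (\<Prod>i\<in>A. f i)"
  by (induction A rule: infinite_finite_induct) (auto intro: order_ge_mult)

lemma order_ge_mvar: "order_ge 1 (mvar i)"
  by (auto simp: order_ge_def mcoeff_mvar axis_eq_0_iff_nat [symmetric])

text \<open>One notion for two uses: \<open>mdeg\<close> gives homogeneity, \<open>parity\<close>
  the behaviour under \<phi>. The zero series has every grade, so sums and differences need no case
  distinction.\<close>

definition graded :: "(nat ^ 'n \<Rightarrow> 'g) \<Rightarrow> 'g \<Rightarrow> ('a::comm_ring_1, 'n::finite) mfps \<Rightarrow> bool" where
  "graded d c f \<longleftrightarrow> (\<forall>\<beta>. mcoeff f \<beta> \<noteq> 0 \<longrightarrow> d \<beta> = c)"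

lemma graded_0 [simp]: "graded d c 0"
  by (simp add: graded_def)

lemma graded_add: "graded d c f \<Longrightarrow> graded d c g \<Longrightarrow> graded d c (f + g)"
  unfolding graded_def by (metis add.right_neutral mcoeff_add)

lemma graded_diff: "graded d c f \<Longrightarrow> graded d c g \<Longrightarrow> graded d c (f - g)"
  unfolding graded_def by (metis diff_self mcoeff_diff)

lemma graded_uminus: "graded d c f \<Longrightarrow> graded d c (- f)"
  unfolding graded_def by simp

lemma graded_sum: "(\<And>a. a \<in> A \<Longrightarrow> graded d c (f a)) \<Longrightarrow> graded d c (\<Sum>a\<in>A. f a)"
  by (induction A rule: infinite_finite_induct) (auto intro: graded_add)

lemma graded_scaleR:
  "graded d c f \<Longrightarrow> graded d c (r *\<^sub>R f :: ('a::{comm_ring_1, real_algebra_1}, 'n::finite) mfps)"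
  by (auto simp: graded_def)

lemma graded_mult:
  assumes "graded d a f" "graded d b g" and d: "\<And>\<alpha> \<beta>. d (\<alpha> + \<beta>) = d \<alpha> + d \<beta>"
  shows "graded d (a + b) (f * g)"
  unfolding graded_def
proof (intro allI impI)
  fix \<beta> assume "mcoeff (f * g) \<beta> \<noteq> 0"
  then obtain \<alpha> where \<alpha>: "\<alpha> \<le> \<beta>" "mcoeff f \<alpha> * mcoeff g (\<beta> - \<alpha>) \<noteq> 0"
    unfolding mcoeff_mult by (rule sum.not_neutral_contains_not_neutral) auto
  from \<alpha>(2) have "mcoeff f \<alpha> \<noteq> 0" "mcoeff g (\<beta> - \<alpha>) \<noteq> 0" by auto
  then have "d \<alpha> = a" "d (\<beta> - \<alpha>) = b" using assms by (auto simp: graded_def)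
  then show "d \<beta> = a + b"
    using d [of \<alpha> "\<beta> - \<alpha>"] by (simp add: multiindex_add_diff [OF \<alpha>(1)])
qed

lemma graded_one: "d 0 = 0 \<Longrightarrow> graded d 0 1"
  by (auto simp: graded_def mcoeff_one split: if_splits)

lemma graded_power:
  fixes d :: "_ \<Rightarrow> 'g::comm_semiring_1"
  assumes "graded d a f" "d 0 = 0" and d: "\<And>\<alpha> \<beta>. d (\<alpha> + \<beta>) = d \<alpha> + d \<beta>"
  shows "graded d (of_nat n * a) (f ^ n)"
proof (induction n)
  case (Suc n)
  have "graded d (a + of_nat n * a) (f * f ^ n)"
    by (rule graded_mult) (use assms Suc in auto)
  then show ?case by (simp add: algebra_simps)
qed (use assms in \<open>auto intro: graded_one\<close>)

lemma graded_prod: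
  fixes d :: "_ \<Rightarrow> 'g::comm_monoid_add"
  assumes "\<And>i. i \<in> A \<Longrightarrow> graded d (a i) (f i)" "d 0 = 0" and d: "\<And>\<alpha> \<beta>. d (\<alpha> + \<beta>) = d \<alpha> + d \<beta>"
  shows "graded d (\<Sum>i\<in>A. a i) (\<Prod>i\<in>A. f i)"
  using assms(1)
  by (induction A rule: infinite_finite_induct) (auto intro: graded_one graded_mult assms)

lemma graded_mvar: "graded d (d (axis i 1)) (mvar i)"
  by (auto simp: graded_def mcoeff_mvar split: if_splits)

subsection \<open>Monomials and substitution\<close>

abbreviation mpow :: "('a::comm_ring_1, 'n::finite) mfps ^ 'm::finite \<Rightarrow> nat ^ 'm \<Rightarrow> ('a, 'n) mfps" where
  "mpow G \<alpha> \<equiv> (\<Prod>i\<in>UNIV. (G $ i) ^ (\<alpha> $ i))"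

lemma mpow_0 [simp]: "mpow G 0 = 1"
  by simp

lemma mpow_add: "mpow G (\<alpha> + \<beta>) = mpow G \<alpha> * mpow G \<beta>"
  by (simp add: power_add prod.distrib)

lemma mpow_axis [simp]: "mpow G (axis i n) = G $ i ^ n"
proof -
  have "mpow G (axis i n) = (\<Prod>j\<in>UNIV. if j = i then G $ i ^ n else 1)"
    by (rule prod.cong) (auto simp: axis_def)
  then show ?thesis by (simp only: prod.delta finite if_True UNIV_I)
qed

lemma graded_mpow:
  fixes d :: "_ \<Rightarrow> 'g::comm_semiring_1"
  assumes "\<And>i. graded d (a i) (G $ i)" "d 0 = 0" and d: "\<And>\<alpha> \<beta>. d (\<alpha> + \<beta>) = d \<alpha> + d \<beta>"
  shows "graded d (\<Sum>i\<in>UNIV. of_nat (\<alpha> $ i) * a i) (mpow G \<alpha>)"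
  by (rule graded_prod) (auto intro: graded_power assms)

lemma order_ge_mpow: "(\<And>i. order_ge 1 (G $ i)) \<Longrightarrow> order_ge (mdeg \<alpha>) (mpow G \<alpha>)"
  unfolding mdeg_def by (rule order_ge_prod) (metis mult.right_neutral order_ge_power)

lemma mcoeff_mult_mvar: "mcoeff (f * mvar i) (\<beta> + axis i 1) = mcoeff f \<beta>"
proof -
  have "mcoeff (mvar i * f) (\<beta> + axis i 1) =
      (\<Sum>\<alpha> | \<alpha> \<le> \<beta> + axis i 1. if \<alpha> = axis i 1 then mcoeff f (\<beta> + axis i 1 - \<alpha>) else 0)"
    unfolding mcoeff_mult by (rule sum.cong) (auto simp: mcoeff_mvar)
  also have "\<dots> = mcoeff f \<beta>"
    by (subst sum.delta [OF finite_le_multiindex])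
      (auto simp: less_eq_vec_def intro!: arg_cong [of _ _ "mcoeff f"] simp: vec_eq_iff)
  finally show ?thesis by (simp add: mult.commute)
qed

lemma mpow_mvar:
  fixes \<alpha> :: "nat ^ 'n::finite"
  shows
  "mpow (\<chi> i. mvar i) \<alpha> = Abs_mfps (\<lambda>\<beta>. if \<beta> = \<alpha> then 1 else (0::'a::comm_ring_1))"
proof (induction \<alpha> rule: multiindex_induct)
  case 0
  show ?case by (simp only: mpow_0 one_mfps_def)
next
  case (add \<alpha> i)
  have "mcoeff (mpow (\<chi> i. mvar i) \<alpha> * mvar i) \<beta> = (if \<beta> = \<alpha> + axis i 1 then 1 else (0::'a))" for \<beta>
  proof (cases "\<beta> $ i = 0")
    case True
    have "mcoeff (mpow (\<chi> i. mvar i) \<alpha> * mvar i) \<beta> = (0::'a)"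
      unfolding mcoeff_mult
    proof (intro sum.neutral ballI)
      fix \<gamma> assume "\<gamma> \<in> {\<gamma>. \<gamma> \<le> \<beta>}"
      have "\<beta> - \<gamma> \<noteq> axis i 1" using True by (auto simp: vec_eq_iff axis_def)
      then show "mcoeff (mpow (\<chi> i. mvar i) \<alpha>) \<gamma> * mcoeff (mvar i) (\<beta> - \<gamma>) = (0::'a)"
        by (simp add: mcoeff_mvar)
    qed
    then show ?thesis using True by (auto simp: axis_def)
  next
    case False
    then have \<beta>: "\<beta> = (\<beta> - axis i 1) + axis i 1" by (auto simp: vec_eq_iff axis_def)
    have "mcoeff (mpow (\<chi> i. mvar i) \<alpha> * mvar i) \<beta> =
        mcoeff (mpow (\<chi> i. mvar i) \<alpha> :: ('a, 'n) mfps) (\<beta> - axis i 1)"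
      by (subst \<beta>) (rule mcoeff_mult_mvar)
    also have "\<dots> = (if \<beta> - axis i 1 = \<alpha> then 1 else 0)"
      by (simp only: add.IH mcoeff_Abs_mfps)
    also have "\<beta> - axis i 1 = \<alpha> \<longleftrightarrow> \<beta> = \<alpha> + axis i 1"
      using \<beta> by (auto simp: vec_eq_iff)
    finally show ?thesis .
  qed
  then show ?case
    by (intro mfps_eqI) (simp only: mpow_add mpow_axis power_one_right, simp only: vec_lambda_beta mcoeff_Abs_mfps)
qed

text \<open>The bound \<open>N\<close> may exceed \<open>mdeg \<beta>\<close>, since
  \<open>mpow G \<alpha>\<close> has order at least \<open>mdeg \<alpha>\<close>. A bound common to
  all coefficients of a product lets the sums over exponents and over Cauchy indices be exchanged;
  the factor \<open>h\<close> serves the chain and product rules.\<close>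

lemma mcoeff_compose_mult:
  assumes G: "\<And>i. order_ge 1 (G $ i)" and N: "mdeg \<beta> \<le> N"
  shows "mcoeff (mfps_compose f G * h) \<beta> = (\<Sum>\<alpha> | mdeg \<alpha> \<le> N. mcoeff f \<alpha> * mcoeff (mpow G \<alpha> * h) \<beta>)"
proof -
  have *: "mcoeff (mfps_compose f G) \<gamma> = (\<Sum>\<alpha> | mdeg \<alpha> \<le> N. mcoeff f \<alpha> * mcoeff (mpow G \<alpha>) \<gamma>)"
    if "mdeg \<gamma> \<le> N" for \<gamma>
    unfolding mfps_compose_def mcoeff_Abs_mfps
    by (rule sum.mono_neutral_left)
      (use that order_ge_mpow [OF G] in \<open>auto simp: order_ge_def not_le\<close>)
  have "mcoeff (mfps_compose f G * h) \<beta> =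
      (\<Sum>\<gamma> | \<gamma> \<le> \<beta>. \<Sum>\<alpha> | mdeg \<alpha> \<le> N. mcoeff f \<alpha> * mcoeff (mpow G \<alpha>) \<gamma> * mcoeff h (\<beta> - \<gamma>))"
    unfolding mcoeff_mult
  proof (intro sum.cong refl)
    fix \<gamma> assume "\<gamma> \<in> {\<gamma>. \<gamma> \<le> \<beta>}"
    then have "mdeg \<gamma> \<le> N" using N mdeg_diff [of \<gamma> \<beta>] by auto
    then show "mcoeff (mfps_compose f G) \<gamma> * mcoeff h (\<beta> - \<gamma>) =
        (\<Sum>\<alpha> | mdeg \<alpha> \<le> N. mcoeff f \<alpha> * mcoeff (mpow G \<alpha>) \<gamma> * mcoeff h (\<beta> - \<gamma>))"
      by (simp only: * sum_distrib_right)
  qed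
  also have "\<dots> = (\<Sum>\<alpha> | mdeg \<alpha> \<le> N. mcoeff f \<alpha> * mcoeff (mpow G \<alpha> * h) \<beta>)"
    by (subst sum.swap) (simp add: mcoeff_mult sum_distrib_left mult.assoc)
  finally show ?thesis .
qed

lemma mcoeff_compose:
  assumes "\<And>i. order_ge 1 (G $ i)" "mdeg \<beta> \<le> N"
  shows "mcoeff (mfps_compose f G) \<beta> = (\<Sum>\<alpha> | mdeg \<alpha> \<le> N. mcoeff f \<alpha> * mcoeff (mpow G \<alpha>) \<beta>)"
  using mcoeff_compose_mult [OF assms, of f 1] by simp

lemma mfps_compose_add: "mfps_compose (f + g) G = mfps_compose f G + mfps_compose g G"
  by (rule mfps_eqI) (simp add: mfps_compose_def algebra_simps sum.distrib)

lemma mfps_compose_scaleR: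
  "mfps_compose (r *\<^sub>R f :: ('a::{comm_ring_1, real_algebra_1}, 'n::finite) mfps) G = r *\<^sub>R mfps_compose f G"
  by (rule mfps_eqI) (simp add: mfps_compose_def scaleR_sum_right)

lemma mfps_compose_0 [simp]: "mfps_compose 0 G = 0"
  by (rule mfps_eqI) (simp add: mfps_compose_def)

lemma mfps_compose_mpow:
  assumes G: "\<And>i. order_ge 1 (G $ i)"
  shows "mfps_compose (mpow (\<chi> i. mvar i) \<alpha>) G = mpow G \<alpha>"
proof (rule mfps_eqI)
  fix \<beta>
  have "mcoeff (mfps_compose (mpow (\<chi> i. mvar i) \<alpha>) G) \<beta> =
      (\<Sum>\<gamma> | mdeg \<gamma> \<le> max (mdeg \<alpha>) (mdeg \<beta>). if \<gamma> = \<alpha> then mcoeff (mpow G \<alpha>) \<beta> else 0)"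
    unfolding mcoeff_compose [OF G max.cobounded2 [of "mdeg \<beta>" "mdeg \<alpha>"]] mpow_mvar
    by (rule sum.cong) auto
  also have "\<dots> = mcoeff (mpow G \<alpha>) \<beta>"
    by (subst sum.delta) auto
  finally show "mcoeff (mfps_compose (mpow (\<chi> i. mvar i) \<alpha>) G) \<beta> = mcoeff (mpow G \<alpha>) \<beta>" .
qed

text \<open>Where \<open>\<alpha> $ i = 0\<close> the truncated \<open>\<alpha> - axis i 1\<close>
  is not a lowered exponent, but the factor \<open>of_nat (\<alpha> $ i)\<close> kills that
  term.\<close>

lemma mfps_deriv_mpow:
  "mfps_deriv j (mpow G \<alpha>) = (\<Sum>i\<in>UNIV. of_nat (\<alpha> $ i) * mpow G (\<alpha> - axis i 1) * mfps_deriv j (G $ i))"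
proof (induction \<alpha> rule: multiindex_induct)
  case 0
  show ?case by (simp only: mpow_0) simp
next
  case (add \<alpha> k)
  have "of_nat (\<alpha> $ i) * mpow G (\<alpha> - axis i 1) * mfps_deriv j (G $ i) * G $ k =
      of_nat (\<alpha> $ i) * mpow G (\<alpha> + axis k 1 - axis i 1) * mfps_deriv j (G $ i)" for i
  proof (cases "\<alpha> $ i = 0")
    case False
    then have "\<alpha> + axis k 1 - axis i 1 = (\<alpha> - axis i 1) + axis k 1"
      by (auto simp: vec_eq_iff axis_def)
    then show ?thesis by (simp only: mpow_add mpow_axis power_one_right ac_simps)
  qed simp
  then have "mfps_deriv j (mpow G (\<alpha> + axis k 1)) =
      (\<Sum>i\<in>UNIV. of_nat (\<alpha> $ i) * mpow G (\<alpha> + axis k 1 - axis i 1) * mfps_deriv j (G $ i)) +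
      mpow G \<alpha> * mfps_deriv j (G $ k)"
    by (simp only: mpow_add mpow_axis power_one_right mfps_deriv_mult add.IH sum_distrib_right)
  also have "mpow G \<alpha> * mfps_deriv j (G $ k) =
      (\<Sum>i\<in>UNIV. if i = k then mpow G (\<alpha> + axis k 1 - axis i 1) * mfps_deriv j (G $ i) else 0)"
    by (subst sum.delta) auto
  finally show ?case
    unfolding sum.distrib [symmetric]
    by (simp only:) (auto intro!: sum.cong simp: axis_def algebra_simps)
qed

lemma mfps_deriv_compose:
  fixes f :: "('a::comm_ring_1, 'm::finite) mfps" and G :: "('a, 'n::finite) mfps ^ 'm"
  assumes G: "\<And>i. order_ge 1 (G $ i)"
  shows "mfps_deriv j (mfps_compose f G) =
    (\<Sum>i\<in>UNIV. mfps_compose (mfps_deriv i f) G * mfps_deriv j (G $ i))"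
proof (rule mfps_eqI)
  fix \<beta> :: "nat ^ 'n"
  let ?M = "mdeg \<beta>"
  let ?h = "\<lambda>i. mfps_deriv j (G $ i)"
  \<comment> \<open>Differentiation reads a coefficient one degree higher, hence the bound
    \<open>Suc ?M\<close>; lowering the exponent of one inner variable brings it back to
    \<open>?M\<close>.\<close>
  have "mcoeff (mfps_deriv j (mfps_compose f G)) \<beta> =
      (\<Sum>\<alpha> | mdeg \<alpha> \<le> Suc ?M. mcoeff f \<alpha> * mcoeff (mfps_deriv j (mpow G \<alpha>)) \<beta>)"
    unfolding mcoeff_deriv
    by (subst mcoeff_compose [OF G, where N = "Suc ?M"]) (auto simp: sum_distrib_left algebra_simps)
  also have "\<dots> = (\<Sum>\<alpha> | mdeg \<alpha> \<le> Suc ?M. \<Sum>i\<in>UNIV.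
      of_nat (\<alpha> $ i) * mcoeff f \<alpha> * mcoeff (mpow G (\<alpha> - axis i 1) * ?h i) \<beta>)"
  proof -
    have of_nat: "mcoeff (of_nat n * g) \<beta> = of_nat n * mcoeff g \<beta>" for n and g :: "('a, 'n) mfps"
      by (induction n) (auto simp: algebra_simps)
    show ?thesis
      by (simp only: mfps_deriv_mpow mcoeff_sum sum_distrib_left mult.assoc of_nat)
        (simp only: ac_simps)
  qed
  also have "\<dots> = (\<Sum>i\<in>UNIV. \<Sum>\<alpha> | mdeg \<alpha> \<le> Suc ?M.
      of_nat (\<alpha> $ i) * mcoeff f \<alpha> * mcoeff (mpow G (\<alpha> - axis i 1) * ?h i) \<beta>)"
    by (rule sum.swap)
  also have "\<dots> = (\<Sum>i\<in>UNIV. \<Sum>\<alpha> | mdeg \<alpha> \<le> ?M.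
      of_nat (\<alpha> $ i + 1) * mcoeff f (\<alpha> + axis i 1) * mcoeff (mpow G \<alpha> * ?h i) \<beta>)"
  proof (rule sum.cong [OF refl])
    fix i :: 'm
    let ?e = "axis i 1 :: nat ^ 'm"
    have inv: "a - ?e + ?e = a" if "a $ i \<noteq> 0" for a
      using that by (auto simp: vec_eq_iff axis_def)
    have inv': "a + ?e - ?e = a" for a
      by (auto simp: vec_eq_iff)
    show "(\<Sum>\<alpha> | mdeg \<alpha> \<le> Suc ?M. of_nat (\<alpha> $ i) * mcoeff f \<alpha> * mcoeff (mpow G (\<alpha> - ?e) * ?h i) \<beta>) =
        (\<Sum>\<alpha> | mdeg \<alpha> \<le> ?M. of_nat (\<alpha> $ i + 1) * mcoeff f (\<alpha> + ?e) * mcoeff (mpow G \<alpha> * ?h i) \<beta>)"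
    proof (subst sum.mono_neutral_right [where S = "{\<alpha>. mdeg \<alpha> \<le> Suc ?M \<and> \<alpha> $ i \<noteq> 0}"],
        goal_cases)
      case 4
      show ?case
      proof (rule sum.reindex_bij_witness
            [where i = "\<lambda>\<alpha>. \<alpha> + ?e" and j = "\<lambda>\<alpha>. \<alpha> - ?e"], goal_cases)
        case (1 a)
        then show ?case by (intro inv) auto
      next
        case (2 a)
        then have "mdeg (a - ?e + ?e) \<le> Suc ?M" by (subst inv) auto
        then show ?case by simp
      next
        case (5 a)
        then have a: "a - ?e + ?e = a" by (intro inv) auto
        then have "(a - ?e) $ i + 1 = a $ i" by (metis axis_nth vector_add_component)
        then show ?case by (simp only: a)
      qed (auto simp: inv')
    qed auto
  qed
  also have "\<dots> = mcoeff (\<Sum>i\<in>UNIV. mfps_compose (mfps_deriv i f) G * ?h i) \<beta>"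
    by (simp only: mcoeff_sum mcoeff_compose_mult [OF G order_refl] mcoeff_deriv)
  finally show "mcoeff (mfps_deriv j (mfps_compose f G)) \<beta> =
      mcoeff (\<Sum>i\<in>UNIV. mfps_compose (mfps_deriv i f) G * ?h i) \<beta>" .
qed

lemma graded_compose:
  fixes d :: "_ \<Rightarrow> 'g::comm_semiring_1"
  assumes "\<And>i. graded d (a i) (G $ i)" "d 0 = 0" "\<And>\<alpha> \<beta>. d (\<alpha> + \<beta>) = d \<alpha> + d \<beta>"
    and "graded (\<lambda>\<alpha>. \<Sum>i\<in>UNIV. of_nat (\<alpha> $ i) * a i) c f"
  shows "graded d c (mfps_compose f G)"
  unfolding graded_def
proof (intro allI impI)
  fix \<beta> assume "mcoeff (mfps_compose f G) \<beta> \<noteq> 0"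
  then obtain \<alpha> where "mcoeff f \<alpha> * mcoeff (mpow G \<alpha>) \<beta> \<noteq> 0"
    unfolding mfps_compose_def mcoeff_Abs_mfps by (rule sum.not_neutral_contains_not_neutral)
  then have "mcoeff f \<alpha> \<noteq> 0" "mcoeff (mpow G \<alpha>) \<beta> \<noteq> 0" by (auto simp del: prod_eq_iff)
  then show "d \<beta> = c"
    using graded_mpow [OF assms(1-3), of \<alpha>] assms(4) unfolding graded_def by simp
qed

subsection \<open>First order expansion of a substitution\<close>

text \<open>The factors are exchanged one at a time. Each exchange puts a difference of order
  \<open>k + 1\<close> in place of a factor of order 1, a gain of \<open>k\<close> over the order
  \<open>mdeg \<alpha>\<close> of the monomial.\<close>

lemma order_ge_mpow_perturb:
  fixes G G' :: "('a::comm_ring_1, 'n::finite) mfps ^ 'm::finite"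
  assumes G: "\<And>i. order_ge 1 (G $ i)" and G': "\<And>i. order_ge 1 (G' $ i)"
    and diff: "\<And>i. order_ge (Suc k) (G' $ i - G $ i)"
  shows "order_ge (k + mdeg \<alpha>) (mpow G' \<alpha> - mpow G \<alpha>)"
proof (induction \<alpha> rule: multiindex_induct)
  case 0
  then show ?case by simp
next
  case (add \<alpha> i)
  have eq: "mpow G' (\<alpha> + axis i 1) - mpow G (\<alpha> + axis i 1) =
      (mpow G' \<alpha> - mpow G \<alpha>) * G' $ i + mpow G \<alpha> * (G' $ i - G $ i)"
    by (simp only: mpow_add mpow_axis power_one_right) (simp add: algebra_simps)
  show ?case
    unfolding eq
    by (intro order_ge_add order_ge_mult' [OF add G'] order_ge_mult' [OF order_ge_mpow [OF G] diff]) auto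
qed

text \<open>With \<open>l = 1\<close> a perturbation of order \<open>k + 1\<close> passes through
  with its order; with \<open>l = 2\<close>, a nonlinear outer series, it gains one. The second case
  is why a normalisation step sees only the linear part of the field.\<close>

lemma order_ge_compose_perturb:
  fixes G G' :: "('a::comm_ring_1, 'n::finite) mfps ^ 'm::finite"
  assumes G: "\<And>i. order_ge 1 (G $ i)" and G': "\<And>i. order_ge 1 (G' $ i)"
    and diff: "\<And>i. order_ge (Suc k) (G' $ i - G $ i)"
    and f: "order_ge l f" "k + l \<ge> n"
  shows "order_ge n (mfps_compose f G' - mfps_compose f G)"
  unfolding order_ge_def
proof (intro allI impI)
  fix \<beta> :: "nat ^ 'n" assume \<beta>: "mdeg \<beta> < n"
  have "mcoeff f \<alpha> * mcoeff (mpow G' \<alpha> - mpow G \<alpha>) \<beta> = 0" for \<alpha>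
  proof (cases "mdeg \<alpha> < l")
    case False
    then have "mdeg \<beta> < k + mdeg \<alpha>" using \<beta> f(2) by simp
    then show ?thesis using order_ge_mpow_perturb [OF assms(1-3), where \<alpha> = \<alpha>]
      unfolding order_ge_def by simp
  qed (use f(1) in \<open>simp add: order_ge_def\<close>)
  then have "(\<Sum>\<alpha> | mdeg \<alpha> \<le> mdeg \<beta>. mcoeff f \<alpha> * mcoeff (mpow G' \<alpha> - mpow G \<alpha>) \<beta>) = 0"
    by (rule sum.neutral [rule_format])
  then show "mcoeff (mfps_compose f G' - mfps_compose f G) \<beta> = 0"
    by (simp add: mfps_compose_def algebra_simps sum_subtractf)
qed

lemma mfps_compose_mvar:
  assumes "\<And>i. order_ge 1 (G $ i)"
  shows "mfps_compose (mvar j) G = G $ j"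
proof -
  have "mvar j = mpow (\<chi> i. mvar i) (axis j 1)"
    by (subst mpow_axis) simp
  then have "mfps_compose (mvar j) G = mpow G (axis j 1)"
    by (metis mfps_compose_mpow [OF assms])
  then show ?thesis by (simp only: mpow_axis power_one_right)
qed

lemma mfps_compose_diff: "mfps_compose (f - g) G = mfps_compose f G - mfps_compose g G"
  by (metis add_diff_cancel diff_add_cancel mfps_compose_add)

lemma mfps_compose_mult:
  fixes f g :: "('a::comm_ring_1, 'm::finite) mfps" and G :: "('a, 'n::finite) mfps ^ 'm"
  assumes G: "\<And>i. order_ge 1 (G $ i)"
  shows "mfps_compose (f * g) G = mfps_compose f G * mfps_compose g G"
proof (rule mfps_eqI)
  fix \<beta> :: "nat ^ 'n"
  let ?N = "mdeg \<beta>"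
  let ?T = "\<lambda>\<alpha> \<delta>. mcoeff f \<alpha> * mcoeff g \<delta> * mcoeff (mpow G (\<alpha> + \<delta>)) \<beta>"
  have "mcoeff (mfps_compose f G * mfps_compose g G) \<beta> =
      (\<Sum>\<alpha> | mdeg \<alpha> \<le> ?N. mcoeff f \<alpha> * mcoeff (mfps_compose g G * mpow G \<alpha>) \<beta>)"
    by (simp only: mcoeff_compose_mult [OF G order_refl] mult.commute)
  also have "\<dots> = (\<Sum>\<alpha> | mdeg \<alpha> \<le> ?N. \<Sum>\<delta> | mdeg \<delta> \<le> ?N. ?T \<alpha> \<delta>)"
    by (simp only: mcoeff_compose_mult [OF G order_refl] sum_distrib_left mpow_add mult.assoc)
      (simp only: ac_simps)
  also have "\<dots> = (\<Sum>(\<alpha>, \<delta>)\<in>{\<alpha>. mdeg \<alpha> \<le> ?N} \<times> {\<delta>. mdeg \<delta> \<le> ?N}. ?T \<alpha> \<delta>)"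
    by (rule sum.cartesian_product)
  \<comment> \<open>Pairs of total degree above \<open>?N\<close> drop out, because
    \<open>mpow G (\<alpha> + \<delta>)\<close> has order beyond \<open>mdeg \<beta>\<close>; the
    remaining triangle can be sorted by the sum of the two exponents.\<close>
  also have "\<dots> = (\<Sum>(\<alpha>, \<delta>)\<in>{(\<alpha>, \<delta>). mdeg (\<alpha> + \<delta>) \<le> ?N}. ?T \<alpha> \<delta>)"
  proof (rule sum.mono_neutral_right)
    show "\<forall>i\<in>{\<alpha>. mdeg \<alpha> \<le> ?N} \<times> {\<delta>. mdeg \<delta> \<le> ?N} - {(\<alpha>, \<delta>). mdeg (\<alpha> + \<delta>) \<le> ?N}.
        (case i of (\<alpha>, \<delta>) \<Rightarrow> ?T \<alpha> \<delta>) = 0"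
      using order_ge_mpow [OF G] by (auto simp only: order_ge_def not_le mem_Times_iff mult_eq_0_iff split: prod.splits) auto
  qed auto
  also have "\<dots> = (\<Sum>(\<gamma>, \<alpha>)\<in>(SIGMA \<gamma>:{\<gamma>. mdeg \<gamma> \<le> ?N}. {\<alpha>. \<alpha> \<le> \<gamma>}).
      mcoeff f \<alpha> * mcoeff g (\<gamma> - \<alpha>) * mcoeff (mpow G \<gamma>) \<beta>)"
  proof (rule sum.reindex_bij_witness
      [where j = "\<lambda>(\<alpha>, \<delta>). (\<alpha> + \<delta>, \<alpha>)" and i = "\<lambda>(\<gamma>, \<alpha>). (\<alpha>, \<gamma> - \<alpha>)"], goal_cases)
    case (5 a)
    have "fst a + snd a - fst a = snd a" by (simp add: vec_eq_iff)
    then show ?case by (simp add: case_prod_beta)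
  qed (auto simp: multiindex_add_diff mdeg_diff vec_eq_iff less_eq_vec_def)
  also have "\<dots> = (\<Sum>\<gamma> | mdeg \<gamma> \<le> ?N. \<Sum>\<alpha> | \<alpha> \<le> \<gamma>. mcoeff f \<alpha> * mcoeff g (\<gamma> - \<alpha>) * mcoeff (mpow G \<gamma>) \<beta>)"
    by (rule sum.Sigma [symmetric]) auto
  also have "\<dots> = mcoeff (mfps_compose (f * g) G) \<beta>"
    by (simp only: mcoeff_compose [OF G order_refl] mcoeff_mult sum_distrib_right)
  finally show "mcoeff (mfps_compose (f * g) G) \<beta> = mcoeff (mfps_compose f G * mfps_compose g G) \<beta>"
    by simp
qed


section \<open>Smooth functions and their Taylor series\<close>

lemma partial_deriv_eq:
  fixes f :: "real ^ 'n::finite \<Rightarrow> real"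
  assumes "(f has_derivative D) (at x)"
  shows "partial_deriv i f x = D (axis i 1)"
proof -
  have "((\<lambda>t. x + t *\<^sub>R axis i 1) has_derivative (\<lambda>t. t *\<^sub>R axis i 1)) (at 0)"
    by (auto intro!: derivative_eq_intros)
  moreover have "(f has_derivative D) (at (x + 0 *\<^sub>R axis i 1))" using assms by simp
  ultimately have "((\<lambda>t. f (x + t *\<^sub>R axis i 1)) has_derivative (\<lambda>t. D (t *\<^sub>R axis i 1))) (at 0)"
    by (rule has_derivative_compose)
  moreover have "D (t *\<^sub>R axis i 1) = t *\<^sub>R D (axis i 1)" for t
    using assms by (simp add: has_derivative_bounded_linear linear_simps)
  ultimately have "((\<lambda>t. f (x + t *\<^sub>R axis i 1)) has_vector_derivative D (axis i 1)) (at 0)"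
    by (simp add: has_vector_derivative_def)
  then show ?thesis
    unfolding partial_deriv_def by (rule vector_derivative_at)
qed

lemma has_derivative_partial_derivs:
  fixes f :: "real ^ 'n::finite \<Rightarrow> real"
  assumes "f differentiable (at x)"
  shows "(f has_derivative (\<lambda>h. \<Sum>i\<in>UNIV. h $ i * partial_deriv i f x)) (at x)"
proof -
  obtain D where D: "(f has_derivative D) (at x)"
    using assms by (auto simp: differentiable_def)
  have "D h = (\<Sum>i\<in>UNIV. h $ i * partial_deriv i f x)" for h
  proof -
    have "h = (\<Sum>i\<in>UNIV. h $ i *\<^sub>R axis i 1)"
      by (subst basis_expansion [symmetric]) (simp add: scalar_mult_eq_scaleR)
    then have "D h = D (\<Sum>i\<in>UNIV. h $ i *\<^sub>R axis i 1)" by simp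
    also have "\<dots> = (\<Sum>i\<in>UNIV. h $ i * D (axis i 1))"
      using has_derivative_linear [OF D] by (simp add: linear_sum linear_cmul)
    finally show ?thesis by (simp add: partial_deriv_eq [OF D])
  qed
  then have "D = (\<lambda>h. \<Sum>i\<in>UNIV. h $ i * partial_deriv i f x)" by blast
  with D show ?thesis by simp
qed

lemma partial_deriv_line:
  fixes f :: "real ^ 'n::finite \<Rightarrow> real"
  assumes "f differentiable_on UNIV"
  shows "((\<lambda>t. f (x + t *\<^sub>R axis i 1)) has_real_derivative partial_deriv i f (x + t *\<^sub>R axis i 1)) (at t)"
proof -
  let ?y = "x + t *\<^sub>R axis i 1"
  obtain D where D: "(f has_derivative D) (at ?y)"
    using assms by (auto simp: differentiable_on_def differentiable_def)
  have "((\<lambda>t. x + t *\<^sub>R axis i 1) has_derivative (\<lambda>t. t *\<^sub>R axis i 1)) (at t)"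
    by (auto intro!: derivative_eq_intros)
  from has_derivative_compose [OF this D]
  have "((\<lambda>t. f (x + t *\<^sub>R axis i 1)) has_derivative (\<lambda>s. D (s *\<^sub>R axis i 1))) (at t)" .
  moreover have "D (s *\<^sub>R axis i 1) = partial_deriv i f ?y * s" for s
    using has_derivative_linear [OF D] by (simp add: linear_cmul partial_deriv_eq [OF D])
  ultimately show ?thesis by (simp add: has_field_derivative_def)
qed

text \<open>\<open>smooth\<close> quantifies over lists of directions and offers no induction on
  functions. This recursion removes the innermost derivative, so that products and composites, whose
  derivatives are sums of products, can be treated by induction on \<open>k\<close>.\<close>

primrec diff_upto :: "nat \<Rightarrow> (real ^ 'n::finite \<Rightarrow> real) \<Rightarrow> bool" where
  "diff_upto 0 f \<longleftrightarrow> f differentiable_on UNIV"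
| "diff_upto (Suc k) f \<longleftrightarrow> f differentiable_on UNIV \<and> (\<forall>i. diff_upto k (partial_deriv i f))"

lemma diff_upto_iff_foldr:
  "diff_upto k f \<longleftrightarrow> (\<forall>js. length js \<le> k \<longrightarrow> foldr partial_deriv js f differentiable_on UNIV)"
proof (induction k arbitrary: f)
  case (Suc k)
  show ?case
  proof
    assume L: "diff_upto (Suc k) f"
    show "\<forall>js. length js \<le> Suc k \<longrightarrow> foldr partial_deriv js f differentiable_on UNIV"
    proof (intro allI impI)
      fix js :: "'a list" assume "length js \<le> Suc k"
      then show "foldr partial_deriv js f differentiable_on UNIV"
        by (cases js rule: rev_cases) (use L Suc in auto)
    qed
  next
    assume R: "\<forall>js. length js \<le> Suc k \<longrightarrow> foldr partial_deriv js f differentiable_on UNIV"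
    then have "f differentiable_on UNIV" by (auto dest: spec [of _ "[]"])
    moreover have "foldr partial_deriv (js @ [i]) f differentiable_on UNIV" if "length js \<le> k" for js i
      using R that by (metis Suc_le_mono length_append_singleton)
    ultimately show "diff_upto (Suc k) f" using Suc by simp
  qed
qed auto

lemma smooth_iff_diff_upto: "smooth f \<longleftrightarrow> (\<forall>k. diff_upto k f)"
  for f :: "real ^ 'n::finite \<Rightarrow> real"
  unfolding smooth_def diff_upto_iff_foldr by auto

lemma diff_upto_Suc_D: "diff_upto (Suc k) f \<Longrightarrow> diff_upto k f"
  by (induction k arbitrary: f) auto

lemma diff_upto_differentiable: "diff_upto k f \<Longrightarrow> f differentiable (at x)"
  by (cases k) (auto simp: differentiable_on_def)

lemma smooth_differentiable: "smooth f \<Longrightarrow> f differentiable (at x)" for f :: "real ^ 'n::finite \<Rightarrow> real"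
  using diff_upto_differentiable smooth_iff_diff_upto by blast

lemma smooth_differentiable_on: "smooth f \<Longrightarrow> f differentiable_on UNIV" for f :: "real ^ 'n::finite \<Rightarrow> real"
  by (simp add: differentiable_on_def smooth_differentiable)

lemma smooth_partial_deriv: "smooth f \<Longrightarrow> smooth (partial_deriv i f)" for f :: "real ^ 'n::finite \<Rightarrow> real"
  by (metis diff_upto.simps(2) smooth_iff_diff_upto)

lemma partial_deriv_const [simp]: "partial_deriv i (\<lambda>x. c) = (\<lambda>x. 0)" for c :: real
  by (rule ext) (simp add: partial_deriv_eq [OF has_derivative_const])

lemma partial_deriv_coord: "partial_deriv i (\<lambda>x. x $ j) = (\<lambda>x. if i = j then 1 else 0)"
  by (rule ext) (subst partial_deriv_eq [where D = "\<lambda>h. h $ j"],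
    auto intro!: bounded_linear_imp_has_derivative bounded_linear_vec_nth simp: axis_def)

lemma partial_deriv_add:
  fixes f g :: "real ^ 'n::finite \<Rightarrow> real"
  assumes "f differentiable_on UNIV" "g differentiable_on UNIV"
  shows "partial_deriv i (\<lambda>x. f x + g x) = (\<lambda>x. partial_deriv i f x + partial_deriv i g x)"
proof
  fix x
  obtain D E where D: "(f has_derivative D) (at x)" "(g has_derivative E) (at x)"
    using assms unfolding differentiable_on_def differentiable_def by auto metis
  show "partial_deriv i (\<lambda>x. f x + g x) x = partial_deriv i f x + partial_deriv i g x"
    by (simp add: partial_deriv_eq [OF has_derivative_add [OF D]] partial_deriv_eq [OF D(1)] partial_deriv_eq [OF D(2)])
qed

lemma partial_deriv_mult:
  fixes f g :: "real ^ 'n::finite \<Rightarrow> real"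
  assumes "f differentiable_on UNIV" "g differentiable_on UNIV"
  shows "partial_deriv i (\<lambda>x. f x * g x) = (\<lambda>x. f x * partial_deriv i g x + partial_deriv i f x * g x)"
proof
  fix x
  obtain D E where D: "(f has_derivative D) (at x)" "(g has_derivative E) (at x)"
    using assms unfolding differentiable_on_def differentiable_def by auto metis
  show "partial_deriv i (\<lambda>x. f x * g x) x = f x * partial_deriv i g x + partial_deriv i f x * g x"
    by (simp add: partial_deriv_eq [OF has_derivative_mult [OF D]] partial_deriv_eq [OF D(1)] partial_deriv_eq [OF D(2)])
qed

lemma partial_deriv_compose:
  fixes f :: "real ^ 'm::finite \<Rightarrow> real" and g :: "real ^ 'n::finite \<Rightarrow> real ^ 'm"
  assumes "f differentiable_on UNIV" "\<And>j. (\<lambda>x. g x $ j) differentiable_on UNIV"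
  shows "(\<lambda>x. f (g x)) differentiable_on UNIV"
    and "partial_deriv i (\<lambda>x. f (g x)) =
      (\<lambda>x. \<Sum>j\<in>UNIV. partial_deriv j f (g x) * partial_deriv i (\<lambda>x. g x $ j) x)"
proof -
  define E where "E x j = frechet_derivative (\<lambda>x. g x $ j) (at x)" for x j
  have E: "((\<lambda>x. g x $ j) has_derivative E x j) (at x)" for x j
    using assms(2) by (simp add: E_def differentiable_on_def frechet_derivative_works [symmetric])
  have g: "(g has_derivative (\<lambda>h. \<chi> j. E x j h)) (at x)" for x
    unfolding has_derivative_componentwise_within [of g]
    using E by (auto simp: Basis_vec_def inner_axis)
  have fg: "((\<lambda>x. f (g x)) has_derivative
      (\<lambda>h. \<Sum>j\<in>UNIV. (\<chi> j. E x j h) $ j * partial_deriv j f (g x))) (at x)" for x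
    by (rule has_derivative_compose [OF g has_derivative_partial_derivs])
      (use assms(1) in \<open>auto simp: differentiable_on_def\<close>)
  then show "(\<lambda>x. f (g x)) differentiable_on UNIV"
    unfolding differentiable_on_def differentiable_def by auto
  show "partial_deriv i (\<lambda>x. f (g x)) =
      (\<lambda>x. \<Sum>j\<in>UNIV. partial_deriv j f (g x) * partial_deriv i (\<lambda>x. g x $ j) x)"
    by (rule ext) (simp add: partial_deriv_eq [OF fg] partial_deriv_eq [OF E] mult.commute)
qed

lemma diff_upto_add: "diff_upto k f \<Longrightarrow> diff_upto k g \<Longrightarrow> diff_upto k (\<lambda>x. f x + g x)"
  by (induction k arbitrary: f g) (auto simp: partial_deriv_add intro: differentiable_on_add)

lemma diff_upto_const: "diff_upto k (\<lambda>x. c)"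
  by (induction k arbitrary: c) auto

lemma diff_upto_sum: "(\<And>a. a \<in> A \<Longrightarrow> diff_upto k (f a)) \<Longrightarrow> diff_upto k (\<lambda>x. \<Sum>a\<in>A. f a x)"
  by (induction A rule: infinite_finite_induct) (auto intro: diff_upto_add diff_upto_const)

lemma diff_upto_mult: "diff_upto k f \<Longrightarrow> diff_upto k g \<Longrightarrow> diff_upto k (\<lambda>x. f x * g x)"
proof (induction k arbitrary: f g)
  case 0
  then show ?case by (auto intro: differentiable_on_mult)
next
  case (Suc k)
  then have "diff_upto k f" "diff_upto k g" by (auto dest: diff_upto_Suc_D simp del: diff_upto.simps)
  with Suc show ?case
    by (auto simp: partial_deriv_mult intro!: differentiable_on_mult diff_upto_add)
qed

lemma diff_upto_compose:
  fixes f :: "real ^ 'm::finite \<Rightarrow> real" and g :: "real ^ 'n::finite \<Rightarrow> real ^ 'm"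
  assumes "diff_upto k f" "\<And>j. diff_upto k (\<lambda>x. g x $ j)"
  shows "diff_upto k (\<lambda>x. f (g x))"
  using assms
proof (induction k arbitrary: f)
  case 0
  then show ?case using partial_deriv_compose(1) [of f g] by simp
next
  case (Suc k)
  have g: "diff_upto k (\<lambda>x. g x $ j)" "(\<lambda>x. g x $ j) differentiable_on UNIV"
    "diff_upto k (partial_deriv i (\<lambda>x. g x $ j))" for i j
    using Suc.prems(2) [of j] by (auto dest: diff_upto_Suc_D simp del: diff_upto.simps) auto
  have f: "f differentiable_on UNIV" "diff_upto k (partial_deriv j f)" for j
    using Suc.prems(1) by auto
  have "diff_upto k (\<lambda>x. partial_deriv j f (g x))" for j
    by (rule Suc.IH [OF f(2) g(1)])
  then have "diff_upto k (\<lambda>x. \<Sum>j\<in>UNIV. partial_deriv j f (g x) * partial_deriv i (\<lambda>x. g x $ j) x)" for i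
    by (intro diff_upto_sum diff_upto_mult g)
  then show ?case
    using partial_deriv_compose [OF f(1) g(2)] by simp
qed

lemma smooth_const [simp, intro]: "smooth (\<lambda>x :: real ^ 'n::finite. c)" for c :: real
  by (simp add: smooth_iff_diff_upto diff_upto_const)

lemma smooth_coord [simp, intro]: "smooth (\<lambda>x :: real ^ 'n::finite. x $ j)"
proof -
  have "diff_upto k (\<lambda>x :: real ^ 'n::finite. x $ j)" for k
    by (cases k) (auto simp: partial_deriv_coord diff_upto_const intro!: derivative_intros
        bounded_linear_imp_differentiable_on bounded_linear_vec_nth)
  then show ?thesis by (simp add: smooth_iff_diff_upto)
qed

context
  fixes f g :: "real ^ 'n::finite \<Rightarrow> real"
begin

lemma smooth_add [intro]: "smooth f \<Longrightarrow> smooth g \<Longrightarrow> smooth (\<lambda>x. f x + g x)"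
  by (simp add: smooth_iff_diff_upto diff_upto_add)

lemma smooth_mult [intro]: "smooth f \<Longrightarrow> smooth g \<Longrightarrow> smooth (\<lambda>x. f x * g x)"
  by (simp add: smooth_iff_diff_upto diff_upto_mult)

lemma smooth_uminus [intro]: "smooth f \<Longrightarrow> smooth (\<lambda>x. - f x)"
  using diff_upto_mult [OF diff_upto_const [of _ "-1"], of _ f] by (simp add: smooth_iff_diff_upto)

end

lemma smooth_diff [intro]: "smooth f \<Longrightarrow> smooth g \<Longrightarrow> smooth (\<lambda>x. f x - g x)"
  for f g :: "real ^ 'n::finite \<Rightarrow> real"
  using smooth_add [OF _ smooth_uminus, of f g] by simp

lemma smooth_sum [intro]: "(\<And>a. a \<in> A \<Longrightarrow> smooth (f a)) \<Longrightarrow> smooth (\<lambda>x. \<Sum>a\<in>A. f a x)"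
  for f :: "_ \<Rightarrow> real ^ 'n::finite \<Rightarrow> real"
  by (simp add: smooth_iff_diff_upto diff_upto_sum)

lemma smooth_power [intro]: "smooth f \<Longrightarrow> smooth (\<lambda>x. f x ^ n)"
  for f :: "real ^ 'n::finite \<Rightarrow> real"
  by (induction n) auto

lemma smooth_prod [intro]: "(\<And>a. a \<in> A \<Longrightarrow> smooth (f a)) \<Longrightarrow> smooth (\<lambda>x. \<Prod>a\<in>A. f a x)"
  for f :: "_ \<Rightarrow> real ^ 'n::finite \<Rightarrow> real"
  by (induction A rule: infinite_finite_induct) auto

lemma smooth_compose:
  fixes f :: "real ^ 'm::finite \<Rightarrow> real" and g :: "real ^ 'n::finite \<Rightarrow> real ^ 'm"
  shows "smooth f \<Longrightarrow> (\<And>j. smooth (\<lambda>x. g x $ j)) \<Longrightarrow> smooth (\<lambda>x. f (g x))"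
  by (simp add: smooth_iff_diff_upto diff_upto_compose)

text \<open>Smoothness of the field \<open>h\<close> speaks of vector-valued partial derivatives,
  whereas Taylor series are taken component by component.\<close>

lemma partial_deriv_component:
  fixes F :: "real ^ 'n::finite \<Rightarrow> real ^ 'm::finite"
  assumes "F differentiable_on UNIV"
  shows "partial_deriv i (\<lambda>x. F x $ j) = (\<lambda>x. partial_deriv i F x $ j)"
    and "(\<lambda>x. F x $ j) differentiable_on UNIV"
proof -
  have D: "\<exists>D. (F has_derivative D) (at x)" for x
    using assms by (auto simp: differentiable_on_def differentiable_def)
  show "(\<lambda>x. F x $ j) differentiable_on UNIV"
    unfolding differentiable_on_def differentiable_def
    using D bounded_linear.has_derivative [OF bounded_linear_vec_nth] by fastforce
  show "partial_deriv i (\<lambda>x. F x $ j) = (\<lambda>x. partial_deriv i F x $ j)"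
  proof
    fix x
    obtain D where D: "(F has_derivative D) (at x)" using D by blast
    have "((\<lambda>t. x + t *\<^sub>R axis i 1) has_derivative (\<lambda>t. t *\<^sub>R axis i 1)) (at 0)"
      by (auto intro!: derivative_eq_intros)
    moreover have "(F has_derivative D) (at (x + 0 *\<^sub>R axis i 1))" using D by simp
    ultimately have "((\<lambda>t. F (x + t *\<^sub>R axis i 1)) has_derivative (\<lambda>t. D (t *\<^sub>R axis i 1))) (at 0)"
      by (rule has_derivative_compose)
    moreover have "D (t *\<^sub>R axis i 1) = t *\<^sub>R D (axis i 1)" for t
      using has_derivative_linear [OF D] by (simp add: linear_cmul)
    ultimately have "((\<lambda>t. F (x + t *\<^sub>R axis i 1)) has_vector_derivative D (axis i 1)) (at 0)"
      by (simp add: has_vector_derivative_def)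
    then have "partial_deriv i F x = D (axis i 1)"
      unfolding partial_deriv_def by (rule vector_derivative_at)
    moreover have "partial_deriv i (\<lambda>x. F x $ j) x = D (axis i 1) $ j"
      by (rule partial_deriv_eq [OF bounded_linear.has_derivative [OF bounded_linear_vec_nth D]])
    ultimately show "partial_deriv i (\<lambda>x. F x $ j) x = partial_deriv i F x $ j" by simp
  qed
qed

lemma smooth_component:
  fixes F :: "real ^ 'n::finite \<Rightarrow> real ^ 'm::finite"
  assumes "smooth F"
  shows "smooth (\<lambda>x. F x $ j)"
proof -
  have "foldr partial_deriv js (\<lambda>x. F x $ j) = (\<lambda>x. foldr partial_deriv js F x $ j)" for js
    by (induction js) (use assms in \<open>simp_all add: smooth_def partial_deriv_component\<close>)
  then show ?thesis
    using assms partial_deriv_component(2) by (auto simp: smooth_def)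
qed

subsection \<open>Symmetry of mixed partial derivatives\<close>

text \<open>Mean value theorem twice, first in direction \<open>i\<close>, then in direction
  \<open>j\<close>. The second difference is symmetric in \<open>i\<close> and \<open>j\<close>,
  while the mixed derivative keeps its order; this asymmetry is what yields commutation.\<close>

lemma second_difference:
  fixes f :: "real ^ 'n::finite \<Rightarrow> real"
  assumes f: "smooth f" and h: "h > 0"
  obtains s t where "0 < s" "s < h" "0 < t" "t < h"
    "f (x + h *\<^sub>R axis i 1 + h *\<^sub>R axis j 1) - f (x + h *\<^sub>R axis i 1) - f (x + h *\<^sub>R axis j 1) + f x =
      h * h * partial_deriv j (partial_deriv i f) (x + s *\<^sub>R axis i 1 + t *\<^sub>R axis j 1)"
proof -
  let ?ei = "axis i 1 :: real ^ 'n" and ?ej = "axis j 1 :: real ^ 'n"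
  let ?\<phi> = "\<lambda>s. f (x + h *\<^sub>R ?ej + s *\<^sub>R ?ei) - f (x + s *\<^sub>R ?ei)"
  let ?\<phi>' = "\<lambda>s. partial_deriv i f (x + h *\<^sub>R ?ej + s *\<^sub>R ?ei) - partial_deriv i f (x + s *\<^sub>R ?ei)"
  have "(?\<phi> has_real_derivative ?\<phi>' s) (at s)" for s
    using f by (intro DERIV_diff partial_deriv_line smooth_differentiable_on)
  then obtain s where s: "0 < s" "s < h" "?\<phi> h - ?\<phi> 0 = (h - 0) * ?\<phi>' s"
    using MVT2 [OF h, of ?\<phi> ?\<phi>'] by blast
  let ?\<psi> = "\<lambda>t. partial_deriv i f ((x + s *\<^sub>R ?ei) + t *\<^sub>R ?ej)"
  let ?\<psi>' = "\<lambda>t. partial_deriv j (partial_deriv i f) ((x + s *\<^sub>R ?ei) + t *\<^sub>R ?ej)"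
  have "(?\<psi> has_real_derivative ?\<psi>' t) (at t)" for t
    using f by (intro partial_deriv_line smooth_differentiable_on smooth_partial_deriv)
  then obtain t where t: "0 < t" "t < h" "?\<psi> h - ?\<psi> 0 = (h - 0) * ?\<psi>' t"
    using MVT2 [OF h, of ?\<psi> ?\<psi>'] by blast
  have "?\<phi>' s = h * ?\<psi>' t"
    using t(3) by (simp add: algebra_simps)
  with s(3) have "?\<phi> h - ?\<phi> 0 = h * h * ?\<psi>' t" by simp
  with s t that show ?thesis by (simp add: algebra_simps)
qed

text \<open>Both orders represent the same second difference with step 1/(n+1), at intermediate
  points tending to \<open>x\<close>. The second derivatives are differentiable, hence continuous,
  and the limits agree.\<close>

lemma partial_deriv_commute:
  fixes f :: "real ^ 'n::finite \<Rightarrow> real"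
  assumes f: "smooth f"
  shows "partial_deriv i (partial_deriv j f) = partial_deriv j (partial_deriv i f)"
proof
  fix x
  let ?ei = "axis i 1 :: real ^ 'n" and ?ej = "axis j 1 :: real ^ 'n"
  let ?h = "\<lambda>n. inverse (real (Suc n))"
  have "\<exists>s t. s \<in> {0<..<?h n} \<and> t \<in> {0<..<?h n} \<and>
      f (x + ?h n *\<^sub>R axis k 1 + ?h n *\<^sub>R axis l 1) - f (x + ?h n *\<^sub>R axis k 1) - f (x + ?h n *\<^sub>R axis l 1) + f x =
      ?h n * ?h n * partial_deriv l (partial_deriv k f) (x + s *\<^sub>R axis k 1 + t *\<^sub>R axis l 1)" for n k l
  proof -
    have "?h n > 0" by simp
    from second_difference [OF f this, of x k l] show ?thesis
      by (metis greaterThanLessThan_iff)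
  qed
  then obtain s t where st: "\<And>n k l. s n k l \<in> {0<..<?h n}" "\<And>n k l. t n k l \<in> {0<..<?h n}"
    and eq: "\<And>n k l. f (x + ?h n *\<^sub>R axis k 1 + ?h n *\<^sub>R axis l 1) - f (x + ?h n *\<^sub>R axis k 1) -
      f (x + ?h n *\<^sub>R axis l 1) + f x =
      ?h n * ?h n * partial_deriv l (partial_deriv k f) (x + s n k l *\<^sub>R axis k 1 + t n k l *\<^sub>R axis l 1)"
    by metis
  have to0: "r \<longlonglongrightarrow> 0" if "\<And>n. r n \<in> {0<..<?h n}" for r
    by (rule tendsto_sandwich [OF _ _ tendsto_const LIMSEQ_inverse_real_of_nat])
      (use that in \<open>auto intro!: always_eventually less_imp_le\<close>)
  have cont: "isCont (partial_deriv k (partial_deriv l f)) x" for k l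
    using f by (intro differentiable_imp_continuous_within smooth_differentiable smooth_partial_deriv)
  have lim: "(\<lambda>n. partial_deriv l (partial_deriv k f) (x + s n k l *\<^sub>R axis k 1 + t n k l *\<^sub>R axis l 1))
      \<longlonglongrightarrow> partial_deriv l (partial_deriv k f) x" for k l
  proof (rule isCont_tendsto_compose [OF cont])
    have "(\<lambda>n. x + s n k l *\<^sub>R axis k 1 + t n k l *\<^sub>R axis l 1) \<longlonglongrightarrow>
        x + 0 *\<^sub>R axis k 1 + 0 *\<^sub>R axis l 1"
      by (intro tendsto_intros to0 st)
    then show "(\<lambda>n. x + s n k l *\<^sub>R axis k 1 + t n k l *\<^sub>R axis l 1) \<longlonglongrightarrow> x" by simp
  qed
  have "partial_deriv j (partial_deriv i f) (x + s n i j *\<^sub>R axis i 1 + t n i j *\<^sub>R axis j 1) =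
      partial_deriv i (partial_deriv j f) (x + s n j i *\<^sub>R axis j 1 + t n j i *\<^sub>R axis i 1)" for n
  proof -
    have swap: "x + ?h n *\<^sub>R axis i 1 + ?h n *\<^sub>R axis j 1 = x + ?h n *\<^sub>R axis j 1 + ?h n *\<^sub>R axis i 1"
      by (simp only: add.assoc add.commute [of "?h n *\<^sub>R axis i 1"])
    have "?h n * ?h n * partial_deriv j (partial_deriv i f) (x + s n i j *\<^sub>R axis i 1 + t n i j *\<^sub>R axis j 1) =
        ?h n * ?h n * partial_deriv i (partial_deriv j f) (x + s n j i *\<^sub>R axis j 1 + t n j i *\<^sub>R axis i 1)"
      using eq [of n i j] eq [of n j i] unfolding swap by linarith
    then show ?thesis by (simp del: of_nat_Suc)
  qed
  with lim [of j i] lim [of i j]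
  show "partial_deriv i (partial_deriv j f) x = partial_deriv j (partial_deriv i f) x"
    by (simp add: LIMSEQ_unique)
qed

subsection \<open>Algebra of Taylor series\<close>

text \<open>The enumeration of variables in \<open>multi_deriv\<close> is fixed but unknown.
  Commutation moves the new derivative through it to the block of index \<open>i\<close>, which
  occurs exactly once because the list is distinct and exhaustive.\<close>

lemma multi_deriv_partial_deriv:
  fixes f :: "real ^ 'n::finite \<Rightarrow> real"
  assumes f: "smooth f"
  shows "multi_deriv \<alpha> (partial_deriv i f) = multi_deriv (\<alpha> + axis i 1) f"
proof -
  have smooth_pow: "smooth ((partial_deriv k ^^ n) g)" if "smooth g" for n k and g :: "real ^ 'n \<Rightarrow> real"
    by (induction n) (use that in \<open>auto intro: smooth_partial_deriv\<close>)
  have comm_pow: "(partial_deriv k ^^ n) (partial_deriv i g) = partial_deriv i ((partial_deriv k ^^ n) g)"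
    if "smooth g" for n k and g :: "real ^ 'n \<Rightarrow> real"
    by (induction n) (use that smooth_pow in \<open>auto simp: partial_deriv_commute\<close>)
  have smooth_fold: "smooth (foldr (\<lambda>k. partial_deriv k ^^ (\<alpha> $ k)) js f)" for js \<alpha>
    by (induction js) (use f smooth_pow in auto)
  have comm: "foldr (\<lambda>k. partial_deriv k ^^ (\<alpha> $ k)) js (partial_deriv i f) =
      partial_deriv i (foldr (\<lambda>k. partial_deriv k ^^ (\<alpha> $ k)) js f)" for js
    by (induction js) (use comm_pow smooth_fold in auto)
  have *: "foldr (\<lambda>k. partial_deriv k ^^ (\<alpha> $ k)) js (partial_deriv i f) =
      foldr (\<lambda>k. partial_deriv k ^^ ((\<alpha> + axis i 1) $ k)) js f" if "distinct js" "i \<in> set js" for js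
    using that
  proof (induction js)
    case (Cons k js)
    show ?case
    proof (cases "k = i")
      case True
      with Cons.prems have "i \<notin> set js" by simp
      then have "foldr (\<lambda>k. partial_deriv k ^^ ((\<alpha> + axis i 1) $ k)) js f =
          foldr (\<lambda>k. partial_deriv k ^^ (\<alpha> $ k)) js f"
        by (intro foldr_cong) (auto simp: axis_def)
      then show ?thesis
        using True by (simp add: comm funpow_Suc_right flip: Suc_eq_plus1 del: funpow.simps(2))
    next
      case False
      with Cons show ?thesis by (simp add: axis_def)
    qed
  qed simp
  have "\<exists>js :: 'n list. distinct js \<and> set js = UNIV"
    using finite_distinct_list [OF finite, of "UNIV :: 'n set"] by blast
  then have "distinct (SOME js :: 'n list. distinct js \<and> set js = UNIV)"
    "set (SOME js :: 'n list. distinct js \<and> set js = UNIV) = UNIV"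
    by (metis (mono_tags, lifting) someI_ex)+
  with * show ?thesis by (simp add: multi_deriv_def)
qed

lemma mcoeff_taylor_0 [simp]: "mcoeff (taylor f) 0 = f 0"
proof -
  have "foldr (\<lambda>i. partial_deriv i ^^ 0) js f = f" for js by (induction js) auto
  then show ?thesis by (simp add: taylor_def multi_deriv_def)
qed

text \<open>Together with the value at 0 this characterises \<open>taylor\<close>; the algebraic
  rules and the chain rule below rest on these two facts instead of the coefficient formula.\<close>

lemma mfps_deriv_taylor:
  fixes f :: "real ^ 'n::finite \<Rightarrow> real"
  assumes "smooth f"
  shows "mfps_deriv i (taylor f) = taylor (partial_deriv i f)"
proof (rule mfps_eqI)
  fix \<alpha> :: "nat ^ 'n"
  have "(\<Prod>j\<in>UNIV. fact ((\<alpha> + axis i 1) $ j) :: real) =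
      (\<Prod>j\<in>UNIV. (if j = i then real (\<alpha> $ i + 1) else 1) * fact (\<alpha> $ j))"
    by (rule prod.cong) (auto simp: axis_def simp flip: Suc_eq_plus1)
  also have "\<dots> = real (\<alpha> $ i + 1) * (\<Prod>j\<in>UNIV. fact (\<alpha> $ j))"
    by (simp add: prod.distrib)
  finally show "mcoeff (mfps_deriv i (taylor f)) \<alpha> = mcoeff (taylor (partial_deriv i f)) \<alpha>"
    by (simp add: taylor_def mcoeff_deriv multi_deriv_partial_deriv [OF assms] del: of_nat_Suc of_nat_add)
qed

lemma mcoeff_taylor_axis:
  fixes f :: "real ^ 'n::finite \<Rightarrow> real"
  assumes "smooth f"
  shows "mcoeff (taylor f) (axis i 1) = partial_deriv i f 0"
  using arg_cong [OF mfps_deriv_taylor [OF assms, of i], of "\<lambda>g. mcoeff g 0"]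
  by (simp add: mcoeff_deriv)

text \<open>Congruence modulo order \<open>k\<close> is proved for all functions at once:
  differentiation lowers the order by one and reproduces the statement for the derivatives. The
  product and chain rules follow the same pattern.\<close>

lemma taylor_add:
  fixes f g :: "real ^ 'n::finite \<Rightarrow> real"
  assumes "smooth f" "smooth g"
  shows "taylor (\<lambda>x. f x + g x) = taylor f + taylor g"
proof (rule mfps_eq_by_order)
  fix k
  from assms show "order_ge k (taylor (\<lambda>x. f x + g x) - (taylor f + taylor g))"
  proof (induction k arbitrary: f g)
    case (Suc k)
    show ?case
    proof (rule order_ge_Suc_deriv)
      fix j
      have "mfps_deriv j (taylor (\<lambda>x. f x + g x) - (taylor f + taylor g)) =
          taylor (\<lambda>x. partial_deriv j f x + partial_deriv j g x) -
            (taylor (partial_deriv j f) + taylor (partial_deriv j g))"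
        using Suc.prems
        by (simp add: mfps_deriv_diff mfps_deriv_add mfps_deriv_taylor smooth_add partial_deriv_add smooth_differentiable_on)
      then show "order_ge k (mfps_deriv j (taylor (\<lambda>x. f x + g x) - (taylor f + taylor g)))"
        using Suc by (simp add: smooth_partial_deriv)
    qed simp
  qed simp
qed

lemma taylor_mult:
  fixes f g :: "real ^ 'n::finite \<Rightarrow> real"
  assumes "smooth f" "smooth g"
  shows "taylor (\<lambda>x. f x * g x) = taylor f * taylor g"
proof (rule mfps_eq_by_order)
  fix k
  from assms show "order_ge k (taylor (\<lambda>x. f x * g x) - taylor f * taylor g)"
  proof (induction k arbitrary: f g)
    case (Suc k)
    show ?case
    proof (rule order_ge_Suc_deriv)
      fix j
      let ?f = "partial_deriv j f" and ?g = "partial_deriv j g"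
      have eq: "mfps_deriv j (taylor (\<lambda>x. f x * g x) - taylor f * taylor g) =
          (taylor (\<lambda>x. f x * ?g x) - taylor f * taylor ?g) +
          (taylor (\<lambda>x. ?f x * g x) - taylor ?f * taylor g)"
        using Suc.prems
        by (simp add: mfps_deriv_diff mfps_deriv_mult mfps_deriv_taylor smooth_mult partial_deriv_mult
            smooth_differentiable_on taylor_add smooth_partial_deriv)
      show "order_ge k (mfps_deriv j (taylor (\<lambda>x. f x * g x) - taylor f * taylor g))"
        unfolding eq by (intro order_ge_add Suc.IH smooth_partial_deriv Suc.prems)
    next
      have "mcoeff (taylor f * taylor g) 0 = f 0 * g 0"
      proof -
        have "{\<alpha> :: nat ^ 'n. \<alpha> \<le> 0} = {0}" by (auto simp: less_eq_vec_def vec_eq_iff)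
        then show ?thesis by (simp add: mcoeff_mult)
      qed
      then show "mcoeff (taylor (\<lambda>x. f x * g x) - taylor f * taylor g) 0 = 0" by simp
    qed
  qed simp
qed

lemma taylor_const_0 [simp]: "taylor (\<lambda>x :: real ^ 'n::finite. 0) = 0"
  using taylor_add [of "\<lambda>x. 0" "\<lambda>x :: real ^ 'n::finite. 0"] by simp

lemma taylor_const: "taylor (\<lambda>x :: real ^ 'n::finite. c) = of_real c"
proof (rule mfps_eq_by_order)
  fix k
  show "order_ge k (taylor (\<lambda>x :: real ^ 'n. c) - of_real c)"
  proof (cases k)
    case (Suc k)
    have "mfps_deriv j (taylor (\<lambda>x :: real ^ 'n. c) - of_real c) = 0" for j
      by (simp add: mfps_deriv_diff mfps_deriv_taylor of_real_def mfps_deriv_scaleR)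
    then have "order_ge (Suc k) (taylor (\<lambda>x :: real ^ 'n. c) - of_real c)"
      by (intro order_ge_Suc_deriv) (simp_all add: of_real_def mcoeff_one)
    then show ?thesis by (simp add: Suc)
  qed simp
qed

lemma taylor_coord: "taylor (\<lambda>x :: real ^ 'n::finite. x $ i) = mvar i"
proof (rule mfps_eq_by_order)
  fix k
  show "order_ge k (taylor (\<lambda>x :: real ^ 'n::finite. x $ i) - mvar i)"
  proof (cases k)
    case (Suc k)
    have "mfps_deriv j (taylor (\<lambda>x :: real ^ 'n::finite. x $ i) - mvar i) = 0" for j
      by (auto simp add: mfps_deriv_diff mfps_deriv_taylor partial_deriv_coord mfps_deriv_mvar taylor_const)
    then have "order_ge (Suc k) (taylor (\<lambda>x :: real ^ 'n::finite. x $ i) - mvar i)"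
      by (intro order_ge_Suc_deriv) (auto simp: mcoeff_mvar axis_eq_0_iff_nat [symmetric])
    then show ?thesis by (simp add: Suc)
  qed simp
qed

lemma taylor_cmult:
  fixes f :: "real ^ 'n::finite \<Rightarrow> real"
  assumes "smooth f"
  shows "taylor (\<lambda>x. c * f x) = c *\<^sub>R taylor f"
  by (simp add: taylor_mult [OF smooth_const assms] taylor_const scaleR_conv_of_real)

lemma taylor_uminus:
  fixes f :: "real ^ 'n::finite \<Rightarrow> real"
  assumes "smooth f"
  shows "taylor (\<lambda>x. - f x) = - taylor f"
  using taylor_cmult [OF assms, of "-1"] by simp

lemma taylor_diff:
  fixes f g :: "real ^ 'n::finite \<Rightarrow> real"
  assumes "smooth f" "smooth g"
  shows "taylor (\<lambda>x. f x - g x) = taylor f - taylor g"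
  using taylor_add [OF assms(1) smooth_uminus [OF assms(2)]] assms by (simp add: taylor_uminus)

lemma taylor_sum:
  fixes f :: "_ \<Rightarrow> real ^ 'n::finite \<Rightarrow> real"
  assumes "\<And>a. a \<in> A \<Longrightarrow> smooth (f a)"
  shows "taylor (\<lambda>x. \<Sum>a\<in>A. f a x) = (\<Sum>a\<in>A. taylor (f a))"
  using assms
  by (induction A rule: infinite_finite_induct) (auto simp: taylor_add smooth_sum)

lemma taylor_power:
  fixes f :: "real ^ 'n::finite \<Rightarrow> real"
  assumes "smooth f"
  shows "taylor (\<lambda>x. f x ^ n) = taylor f ^ n"
  by (induction n) (use assms in \<open>auto simp: taylor_const taylor_mult smooth_power\<close>)

lemma taylor_prod:
  fixes f :: "_ \<Rightarrow> real ^ 'n::finite \<Rightarrow> real"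
  assumes "\<And>a. a \<in> A \<Longrightarrow> smooth (f a)"
  shows "taylor (\<lambda>x. \<Prod>a\<in>A. f a x) = (\<Prod>a\<in>A. taylor (f a))"
  using assms
  by (induction A rule: infinite_finite_induct) (auto simp: taylor_mult taylor_const smooth_prod)

text \<open>The inner map stays fixed and only \<open>f\<close> varies in the induction, since both
  sides satisfy the chain rule with outer derivatives \<open>partial_deriv i f\<close>. The
  condition at 0 gives the inner series order 1, as formal substitution requires.\<close>

lemma taylor_compose:
  fixes f :: "real ^ 'm::finite \<Rightarrow> real" and g :: "real ^ 'n::finite \<Rightarrow> real ^ 'm"
  assumes f: "smooth f" and g: "\<And>j. smooth (\<lambda>x. g x $ j)" and g0: "g 0 = 0"
  shows "taylor (\<lambda>x. f (g x)) = mfps_compose (taylor f) (\<chi> j. taylor (\<lambda>x. g x $ j))"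
proof (rule mfps_eq_by_order)
  let ?G = "\<chi> j. taylor (\<lambda>x. g x $ j)"
  have G: "order_ge 1 (?G $ j)" for j
    by (simp add: order_ge_def g0)
  fix k
  from f show "order_ge k (taylor (\<lambda>x. f (g x)) - mfps_compose (taylor f) ?G)"
  proof (induction k arbitrary: f)
    case (Suc k)
    show ?case
    proof (rule order_ge_Suc_deriv)
      show "mcoeff (taylor (\<lambda>x. f (g x)) - mfps_compose (taylor f) ?G) 0 = 0"
        by (simp add: mfps_compose_def g0 mcoeff_one)
    next
      fix j
      have fg: "smooth (\<lambda>x. partial_deriv i f (g x))" for i
        by (rule smooth_compose [OF smooth_partial_deriv [OF Suc.prems] g])
      have dg: "smooth (partial_deriv j (\<lambda>x. g x $ i))" for i
        by (rule smooth_partial_deriv [OF g])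
      have "mfps_deriv j (taylor (\<lambda>x. f (g x))) = taylor (partial_deriv j (\<lambda>x. f (g x)))"
        by (rule mfps_deriv_taylor [OF smooth_compose [OF Suc.prems g]])
      also have "partial_deriv j (\<lambda>x. f (g x)) =
          (\<lambda>x. \<Sum>i\<in>UNIV. partial_deriv i f (g x) * partial_deriv j (\<lambda>x. g x $ i) x)"
        by (rule partial_deriv_compose(2) [OF smooth_differentiable_on [OF Suc.prems] smooth_differentiable_on [OF g]])
      also have "taylor \<dots> =
          (\<Sum>i\<in>UNIV. taylor (\<lambda>x. partial_deriv i f (g x) * partial_deriv j (\<lambda>x. g x $ i) x))"
        by (rule taylor_sum [OF smooth_mult [OF fg dg]])
      also have "\<dots> = (\<Sum>i\<in>UNIV. taylor (\<lambda>x. partial_deriv i f (g x)) * mfps_deriv j (?G $ i))"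
        by (simp only: taylor_mult [OF fg dg] mfps_deriv_taylor [OF g] vec_lambda_beta)
      finally have eq: "mfps_deriv j (taylor (\<lambda>x. f (g x)) - mfps_compose (taylor f) ?G) =
          (\<Sum>i\<in>UNIV. (taylor (\<lambda>x. partial_deriv i f (g x)) - mfps_compose (taylor (partial_deriv i f)) ?G) *
            mfps_deriv j (?G $ i))"
        using Suc.prems
        by (simp only: mfps_deriv_diff mfps_deriv_compose [OF G] mfps_deriv_taylor sum_subtractf left_diff_distrib)
      show "order_ge k (mfps_deriv j (taylor (\<lambda>x. f (g x)) - mfps_compose (taylor f) ?G))"
        unfolding eq
        by (intro order_ge_sum order_ge_mult' [OF Suc.IH order_ge_0] smooth_partial_deriv Suc.prems) simp
    qed
  qed simp
qed


section \<open>Borel's lemma\<close>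

primrec bdd_derivs :: "nat \<Rightarrow> (real ^ 'n::finite \<Rightarrow> real) \<Rightarrow> bool" where
  "bdd_derivs 0 f \<longleftrightarrow> bounded (range f)"
| "bdd_derivs (Suc k) f \<longleftrightarrow> bounded (range f) \<and> (\<forall>i. bdd_derivs k (partial_deriv i f))"

lemma bdd_derivs_Suc_D: "bdd_derivs (Suc k) f \<Longrightarrow> bdd_derivs k f"
  by (induction k arbitrary: f) auto

lemma bounded_range_iff: "bounded (range f) \<longleftrightarrow> (\<exists>B. \<forall>x. \<bar>f x\<bar> \<le> B)" for f :: "_ \<Rightarrow> real"
  by (auto simp: bounded_iff)

lemma bounded_range_mult:
  fixes f g :: "_ \<Rightarrow> real"
  assumes "bounded (range f)" "bounded (range g)"
  shows "bounded (range (\<lambda>x. f x * g x))"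
proof -
  obtain B C where "\<And>x. \<bar>f x\<bar> \<le> B" "\<And>x. \<bar>g x\<bar> \<le> C"
    using assms by (auto simp: bounded_range_iff)
  then have "\<bar>f x * g x\<bar> \<le> B * C" for x
    unfolding abs_mult by (intro mult_mono) (auto intro: order_trans [OF abs_ge_zero])
  then show ?thesis by (auto simp: bounded_range_iff)
qed

lemma bdd_derivs_add:
  "smooth f \<Longrightarrow> smooth g \<Longrightarrow> bdd_derivs k f \<Longrightarrow> bdd_derivs k g \<Longrightarrow> bdd_derivs k (\<lambda>x. f x + g x)"
  by (induction k arbitrary: f g)
    (auto simp: partial_deriv_add smooth_differentiable_on smooth_partial_deriv intro: bounded_plus_comp)

lemma bdd_derivs_mult:
  "smooth f \<Longrightarrow> smooth g \<Longrightarrow> bdd_derivs k f \<Longrightarrow> bdd_derivs k g \<Longrightarrow> bdd_derivs k (\<lambda>x. f x * g x)"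
proof (induction k arbitrary: f g)
  case 0
  then show ?case by (simp add: bounded_range_mult)
next
  case (Suc k)
  then have "bdd_derivs k f" "bdd_derivs k g" by (auto dest: bdd_derivs_Suc_D simp del: bdd_derivs.simps)
  with Suc show ?case
    by (auto simp: partial_deriv_mult smooth_differentiable_on bounded_range_mult
        intro!: bdd_derivs_add smooth_mult smooth_partial_deriv)
qed

lemma bdd_derivs_const: "bdd_derivs k (\<lambda>x. c)"
  by (induction k arbitrary: c) (auto simp: image_constant_conv)

lemma bdd_derivs_sum:
  assumes "\<And>a. a \<in> A \<Longrightarrow> smooth (f a)" "\<And>a. a \<in> A \<Longrightarrow> bdd_derivs k (f a)"
  shows "bdd_derivs k (\<lambda>x. \<Sum>a\<in>A. f a x)"
  using assms
  by (induction A rule: infinite_finite_induct) (auto simp: bdd_derivs_const bdd_derivs_add smooth_sum)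

lemma bdd_derivs_power: "smooth f \<Longrightarrow> bdd_derivs k f \<Longrightarrow> bdd_derivs k (\<lambda>x. f x ^ n)"
  by (induction n) (auto simp: bdd_derivs_const bdd_derivs_mult smooth_power)

lemma bdd_derivs_prod:
  assumes "\<And>a. a \<in> A \<Longrightarrow> smooth (f a)" "\<And>a. a \<in> A \<Longrightarrow> bdd_derivs k (f a)"
  shows "bdd_derivs k (\<lambda>x. \<Prod>a\<in>A. f a x)"
  using assms
  by (induction A rule: infinite_finite_induct) (auto simp: bdd_derivs_const bdd_derivs_mult smooth_prod)

lemma bdd_derivs_foldr:
  assumes "bdd_derivs k f" "length js \<le> k"
  shows "bounded (range (foldr partial_deriv js f))"
  using assms
proof (induction k arbitrary: f js)
  case (Suc k)
  then show ?case by (cases js rule: rev_cases) auto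
qed auto

lemma bdd_derivs_uniform:
  fixes f :: "real ^ 'n::finite \<Rightarrow> real"
  assumes "bdd_derivs k f"
  obtains B where "B > 0" "\<And>js x. length js \<le> k \<Longrightarrow> \<bar>foldr partial_deriv js f x\<bar> \<le> B"
proof -
  have "\<forall>js\<in>{js :: 'n list. length js \<le> k}. \<exists>B. \<forall>x. \<bar>foldr partial_deriv js f x\<bar> \<le> B"
    using bdd_derivs_foldr [OF assms] by (simp add: bounded_range_iff)
  then obtain B where B: "\<And>js x. length js \<le> k \<Longrightarrow> \<bar>foldr partial_deriv js f x\<bar> \<le> B js"
    by (metis mem_Collect_eq)
  have fin: "finite {js :: 'n list. length js \<le> k}"
    using finite_lists_length_le [of "UNIV :: 'n set" k] by simp
  show ?thesis
  proof
    show "0 < Max (insert 1 (B ` {js. length js \<le> k}))"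
      using fin by (subst Max_gr_iff) auto
    fix js :: "'n list" and x assume "length js \<le> k"
    then show "\<bar>foldr partial_deriv js f x\<bar> \<le> Max (insert 1 (B ` {js. length js \<le> k}))"
      using fin B by (subst Max_ge_iff) auto
  qed
qed

section \<open>Scaled sines as building blocks\<close>

lemma sin_shift_has_derivative:
  fixes x :: "real ^ 'n::finite"
  shows "((\<lambda>x. sin (l * x $ i + c)) has_derivative (\<lambda>h. l * h $ i * cos (l * x $ i + c))) (at x)"
proof -
  have "((\<lambda>x :: real ^ 'n. x $ i) has_derivative (\<lambda>h. h $ i)) (at x)"
    by (rule bounded_linear_imp_has_derivative) (rule bounded_linear_vec_nth)
  then show ?thesis by (auto intro!: derivative_eq_intros)
qed

text \<open>The cosine is written as a sine whose phase is moved by \<open>pi / 2\<close>: the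
  family over all phases \<open>c\<close> is then closed under differentiation, and inductions on
  the order need no second function.\<close>

lemma partial_deriv_sin_shift:
  "partial_deriv j (\<lambda>x. sin (l * x $ i + c)) = (\<lambda>x. (if j = i then l else 0) * sin (l * x $ i + (c + pi / 2)))"
proof
  fix x :: "real ^ 'a"
  have "cos (l * x $ i + c) = sin (l * x $ i + (c + pi / 2))"
    by (simp add: sin_add flip: add.assoc)
  then show "partial_deriv j (\<lambda>x. sin (l * x $ i + c)) x = (if j = i then l else 0) * sin (l * x $ i + (c + pi / 2))"
    by (simp only: partial_deriv_eq [OF sin_shift_has_derivative]) (simp add: axis_def)
qed

lemma smooth_sin_shift: "smooth (\<lambda>x. sin (l * x $ i + c))"
proof -
  have "diff_upto k (\<lambda>x. sin (l * x $ i + c))" for k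
  proof (induction k arbitrary: c)
    case 0
    then show ?case
      using sin_shift_has_derivative by (force simp: differentiable_on_def differentiable_def)
  next
    case (Suc k)
    have "(\<lambda>x. sin (l * x $ i + c)) differentiable_on UNIV"
      using sin_shift_has_derivative by (force simp: differentiable_on_def differentiable_def)
    then show ?case
      unfolding diff_upto.simps partial_deriv_sin_shift
      by (intro conjI allI diff_upto_mult diff_upto_const Suc.IH)
  qed
  then show ?thesis by (simp add: smooth_iff_diff_upto)
qed

lemma smooth_sin_coord: "smooth (\<lambda>x. sin (l * x $ i))"
  using smooth_sin_shift [of l i 0] by simp

lemma bdd_derivs_sin_shift: "bdd_derivs k (\<lambda>x. sin (x $ i + c))"
proof (induction k arbitrary: c)
  case 0
  then show ?case by (auto simp: bounded_range_iff intro!: exI [of _ 1])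
next
  case (Suc k)
  have "bounded (range (\<lambda>x :: real ^ 'a. sin (x $ i + c)))"
    by (auto simp: bounded_range_iff intro!: exI [of _ 1])
  moreover have "bdd_derivs k (partial_deriv j (\<lambda>x. sin (x $ i + c)))" for j
    using partial_deriv_sin_shift [of j 1 i c] smooth_sin_shift [of 1 i "c + pi / 2"]
    by (auto intro!: bdd_derivs_mult bdd_derivs_const Suc.IH)
  ultimately show ?case by simp
qed

lemma order_ge_2_iff:
  "order_ge 2 f \<longleftrightarrow> mcoeff f 0 = 0 \<and> (\<forall>i. mcoeff f (axis i 1) = 0)"
proof
  assume "mcoeff f 0 = 0 \<and> (\<forall>i. mcoeff f (axis i 1) = 0)"
  then show "order_ge 2 f"
    unfolding order_ge_def
  proof (intro allI impI)
    fix \<beta> :: "nat ^ 'b"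
    assume f: "mcoeff f 0 = 0 \<and> (\<forall>i. mcoeff f (axis i 1) = 0)" and "mdeg \<beta> < 2"
    then show "mcoeff f \<beta> = 0"
      by (cases \<beta> rule: multiindex_cases) auto
  qed
qed (simp add: order_ge_def)

lemma taylor_sin_coord:
  assumes "l \<noteq> 0"
  shows "order_ge 2 (taylor (\<lambda>x :: real ^ 'n::finite. sin (l * x $ i) / l) - mvar i)"
proof -
  have smooth: "smooth (\<lambda>x :: real ^ 'n. sin (l * x $ i) / l)"
    using smooth_mult [OF smooth_const [of "1 / l"] smooth_sin_coord [of l i]] by simp
  have "partial_deriv j (\<lambda>x :: real ^ 'n. sin (l * x $ i) / l) 0 = (if j = i then 1 else 0)" for j
  proof -
    have "((\<lambda>x :: real ^ 'n. sin (l * x $ i + 0) / l) has_derivative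
        (\<lambda>h. l * h $ i * cos (l * 0 $ i + 0) / l)) (at 0)"
      by (rule bounded_linear.has_derivative [OF bounded_linear_divide sin_shift_has_derivative])
    then have "((\<lambda>x :: real ^ 'n. sin (l * x $ i) / l) has_derivative (\<lambda>h. h $ i)) (at 0)"
      using assms by simp
    from partial_deriv_eq [OF this] show ?thesis by (auto simp: axis_def)
  qed
  then show ?thesis
    unfolding order_ge_2_iff
    by (auto simp: mcoeff_taylor_axis [OF smooth] mcoeff_mvar axis_eq_axis axis_eq_0_iff_nat [symmetric])
qed

lemma foldr_partial_deriv_scale:
  fixes f :: "real ^ 'n::finite \<Rightarrow> real"
  assumes "smooth f"
  shows "foldr partial_deriv js (\<lambda>x. c * f (l *\<^sub>R x)) =
    (\<lambda>x. c * l ^ length js * foldr partial_deriv js f (l *\<^sub>R x))"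
proof (induction js)
  case (Cons j js)
  let ?F = "foldr partial_deriv js f"
  have F: "smooth ?F"
    by (induction js) (use assms in \<open>auto intro: smooth_partial_deriv\<close>)
  have l: "(\<lambda>x :: real ^ 'n. (l *\<^sub>R x) $ i) differentiable_on UNIV" for i
    using smooth_mult [OF smooth_const [of l] smooth_coord [of i]] by (simp add: smooth_differentiable_on)
  have pl: "partial_deriv j (\<lambda>x :: real ^ 'n. (l *\<^sub>R x) $ i) = (\<lambda>x. if j = i then l else 0)" for i
    using partial_deriv_mult [OF smooth_differentiable_on smooth_differentiable_on, OF smooth_const [of l] smooth_coord [of i], of j]
    by (auto simp: partial_deriv_coord fun_eq_iff)
  have "partial_deriv j (\<lambda>x. ?F (l *\<^sub>R x)) = (\<lambda>x. l * partial_deriv j ?F (l *\<^sub>R x))"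
    unfolding partial_deriv_compose(2) [OF smooth_differentiable_on [OF F] l] pl
    by (simp add: if_distrib [of "\<lambda>x. x * _"] mult.commute cong: if_cong)
  moreover have "partial_deriv j (\<lambda>x. (c * l ^ length js) * ?F (l *\<^sub>R x)) =
      (\<lambda>x. (c * l ^ length js) * partial_deriv j (\<lambda>x. ?F (l *\<^sub>R x)) x)"
    using partial_deriv_mult [OF smooth_differentiable_on [OF smooth_const [of "c * l ^ length js"]]
        partial_deriv_compose(1) [OF smooth_differentiable_on [OF F] l], of j] by simp
  ultimately show ?case by (simp add: Cons algebra_simps)
qed simp

text \<open>For the combination \<open>G\<close> of products of sines with coefficients
  \<open>c\<close>, dividing \<open>G (l *\<^sub>R x)\<close> by \<open>l ^ n\<close> leaves the
  coefficients of degree \<open>n\<close> independent of \<open>l\<close>, while a derivative of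
  order j < n is multiplied by l^(j-n), which is at most 1/l when l is at least 1.\<close>

lemma taylor_correction:
  fixes c :: "nat ^ 'n::finite \<Rightarrow> real"
  assumes "\<epsilon> > 0"
  obtains g where "smooth g" "order_ge n (taylor g)" "\<And>\<beta>. mdeg \<beta> = n \<Longrightarrow> mcoeff (taylor g) \<beta> = c \<beta>"
    "\<And>js x. length js < n \<Longrightarrow> \<bar>foldr partial_deriv js g x\<bar> \<le> \<epsilon>"
proof -
  let ?A = "{\<alpha> :: nat ^ 'n. mdeg \<alpha> = n}"
  define S where "S \<alpha> x = (\<Prod>i\<in>UNIV. sin (x $ i) ^ (\<alpha> $ i))" for \<alpha> :: "nat ^ 'n" and x :: "real ^ 'n"
  define G where "G x = (\<Sum>\<alpha>\<in>?A. c \<alpha> * S \<alpha> x)" for x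
  have smooth_sin: "smooth (\<lambda>x :: real ^ 'n. sin (x $ i))" for i
    using smooth_sin_coord [of 1 i] by simp
  have bdd_sin: "bdd_derivs k (\<lambda>x :: real ^ 'n. sin (x $ i))" for i k
    using bdd_derivs_sin_shift [of k i 0] by simp
  have S: "smooth (S \<alpha>)" "bdd_derivs k (S \<alpha>)" for \<alpha> k
    unfolding S_def by (intro smooth_prod smooth_power smooth_sin bdd_derivs_prod bdd_derivs_power bdd_sin)+
  have G: "smooth G" "bdd_derivs n G"
    unfolding G_def by (intro smooth_sum smooth_mult smooth_const bdd_derivs_sum bdd_derivs_mult bdd_derivs_const S)+
  obtain B where B: "B > 0" "\<And>js x. length js \<le> n \<Longrightarrow> \<bar>foldr partial_deriv js G x\<bar> \<le> B"
    using bdd_derivs_uniform [OF G(2)] by blast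
  \<comment> \<open>The quotient \<open>B / \<epsilon>\<close> makes \<open>B / l\<close> at most
    \<epsilon>; the lower bound 1 makes powers of \<open>l\<close> increasing, so that the scaling
    factor is at most \<open>inverse l\<close>.\<close>
  define l where "l = max 1 (B / \<epsilon>)"
  have l: "l \<ge> 1" "B / \<epsilon> \<le> l" by (auto simp: l_def)
  define g where "g x = inverse (l ^ n) * G (l *\<^sub>R x)" for x
  let ?s = "\<lambda>i x :: real ^ 'n. sin (l * x $ i) / l"
  have s: "smooth (?s i)" for i
    using smooth_mult [OF smooth_const [of "1 / l"] smooth_sin_coord [of l i]] by simp
  have g_eq: "g = (\<lambda>x. \<Sum>\<alpha>\<in>?A. c \<alpha> * (\<Prod>i\<in>UNIV. ?s i x ^ (\<alpha> $ i)))"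
  proof
    fix x
    have "inverse (l ^ n) * S \<alpha> (l *\<^sub>R x) = (\<Prod>i\<in>UNIV. ?s i x ^ (\<alpha> $ i))" if "mdeg \<alpha> = n" for \<alpha>
      using that by (simp add: S_def power_divide prod_dividef power_sum [symmetric] mdeg_def field_simps)
    then show "g x = (\<Sum>\<alpha>\<in>?A. c \<alpha> * (\<Prod>i\<in>UNIV. ?s i x ^ (\<alpha> $ i)))"
      unfolding g_def G_def sum_distrib_left
      by (intro sum.cong) (auto simp: mult.left_commute)
  qed
  let ?T = "\<chi> i. taylor (?s i)"
  have T: "order_ge 1 (?T $ i)" for i by (simp add: order_ge_def)
  have V: "order_ge 1 ((\<chi> i. (mvar i :: (real, 'n) mfps)) $ i)" for i
    by (auto simp: order_ge_def mcoeff_mvar axis_eq_0_iff_nat [symmetric])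
  have TV: "order_ge (Suc 1) (?T $ i - (\<chi> i. mvar i) $ i)" for i
    using taylor_sin_coord [of l i] l by (simp add: numeral_2_eq_2 One_nat_def)
  have mono: "smooth (\<lambda>x. c \<alpha> * (\<Prod>i\<in>UNIV. ?s i x ^ (\<alpha> $ i)))" for \<alpha>
    by (intro smooth_mult smooth_const smooth_prod smooth_power s)
  have "taylor (\<lambda>x. c \<alpha> * (\<Prod>i\<in>UNIV. ?s i x ^ (\<alpha> $ i))) = c \<alpha> *\<^sub>R mpow ?T \<alpha>" for \<alpha>
    using s by (simp add: taylor_cmult smooth_prod smooth_power taylor_prod taylor_power)
  then have taylor_g: "taylor g = (\<Sum>\<alpha>\<in>?A. c \<alpha> *\<^sub>R mpow ?T \<alpha>)"
    unfolding g_eq using taylor_sum [where A = ?A, OF mono] by simp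
  \<comment> \<open>\<open>sin (l * x $ i) / l\<close> agrees with the coordinate up to second
    order, so monomials in these sines agree with the pure ones through their lowest degree.\<close>
  have coeff: "mcoeff (mpow ?T \<alpha>) \<beta> = (if \<beta> = \<alpha> then 1 else 0)" if "mdeg \<beta> \<le> mdeg \<alpha>" for \<alpha> \<beta>
  proof -
    have "mcoeff (mpow ?T \<alpha> - mpow (\<chi> i. mvar i) \<alpha>) \<beta> = 0"
      using order_ge_mpow_perturb [OF V T TV, of \<alpha>] that by (simp add: order_ge_def)
    then have "mcoeff (mpow ?T \<alpha>) \<beta> = mcoeff (mpow (\<chi> i. mvar i) \<alpha>) \<beta>" by (simp only: mcoeff_diff right_minus_eq)
    then show ?thesis by (simp only: mpow_mvar mcoeff_Abs_mfps)
  qed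
  show ?thesis
  proof
    show "smooth g" unfolding g_eq using mono by (intro smooth_sum)
    show "order_ge n (taylor g)"
      unfolding order_ge_def taylor_g using coeff by (auto intro!: sum.neutral)
    show "mcoeff (taylor g) \<beta> = c \<beta>" if "mdeg \<beta> = n" for \<beta>
    proof -
      have "mcoeff (taylor g) \<beta> = (\<Sum>\<alpha>\<in>?A. if \<beta> = \<alpha> then c \<alpha> else 0)"
        unfolding taylor_g mcoeff_sum mcoeff_scaleR
        by (intro sum.cong refl) (use that in \<open>simp only: coeff mem_Collect_eq order_refl, auto\<close>)
      also have "\<dots> = c \<beta>" using that by (subst sum.delta') auto
      finally show ?thesis .
    qed
    show "\<bar>foldr partial_deriv js g x\<bar> \<le> \<epsilon>" if js: "length js < n" for js x
    proof -
      have "g = (\<lambda>x. inverse (l ^ n) * G (l *\<^sub>R x))" by (simp add: g_def fun_eq_iff)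
      then have "\<bar>foldr partial_deriv js g x\<bar> =
          inverse (l ^ n) * l ^ length js * \<bar>foldr partial_deriv js G (l *\<^sub>R x)\<bar>"
        using l by (simp add: foldr_partial_deriv_scale [OF G(1)] abs_mult)
      also have "\<dots> \<le> inverse l * B"
      proof (intro mult_mono B)
        have "l ^ length js * l \<le> l ^ n"
          using power_increasing [of "Suc (length js)" n l] js l by (simp add: mult.commute)
        then show "inverse (l ^ n) * l ^ length js \<le> inverse l"
          using l by (simp add: field_simps)
      qed (use js l in auto)
      also have "\<dots> \<le> \<epsilon>"
        using l assms by (simp add: field_simps)
      finally show ?thesis .
    qed
  qed
qed

lemma has_derivative_uniform_limit:
  fixes F :: "nat \<Rightarrow> real ^ 'n::finite \<Rightarrow> real"
  assumes F: "\<And>m. F m differentiable_on UNIV"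
    and lim: "\<And>x. (\<lambda>m. F m x) \<longlonglongrightarrow> L x"
    and ulim: "\<And>i. uniform_limit UNIV (\<lambda>m. partial_deriv i (F m)) (L' i) sequentially"
  shows "L differentiable_on UNIV" "partial_deriv i L = L' i"
proof -
  have "\<exists>g. \<forall>x\<in>UNIV. (\<lambda>m. F m x) \<longlonglongrightarrow> g x \<and>
      (g has_derivative (\<lambda>h. \<Sum>i\<in>UNIV. h $ i * L' i x)) (at x within UNIV)"
  proof (rule has_derivative_sequence [OF convex_UNIV])
    show "(F m has_derivative (\<lambda>h. \<Sum>i\<in>UNIV. h $ i * partial_deriv i (F m) x)) (at x within UNIV)" for m x
      using F by (intro has_derivative_partial_derivs) (auto simp: differentiable_on_def)
    show "(\<lambda>m. F m 0) \<longlonglongrightarrow> L 0" by (rule lim)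
    fix e :: real assume "e > 0"
    \<comment> \<open>The differential is a sum over \<open>CARD('n)\<close> directions, each of
      which receives an equal share of \<open>e\<close>.\<close>
    let ?e = "e / CARD('n)"
    have "?e > 0" using \<open>e > 0\<close> by simp
    then have "\<forall>\<^sub>F m in sequentially. \<forall>i. \<forall>x. \<bar>partial_deriv i (F m) x - L' i x\<bar> < ?e"
      using ulim by (subst eventually_all_finite) (auto simp: uniform_limit_iff dist_real_def)
    then show "\<forall>\<^sub>F m in sequentially. \<forall>x\<in>UNIV. \<forall>h.
        norm ((\<Sum>i\<in>UNIV. h $ i * partial_deriv i (F m) x) - (\<Sum>i\<in>UNIV. h $ i * L' i x)) \<le> e * norm h"
    proof eventually_elim
      case (elim m)
      show ?case
      proof (intro ballI allI)
        fix x h :: "real ^ 'n"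
        have "norm ((\<Sum>i\<in>UNIV. h $ i * partial_deriv i (F m) x) - (\<Sum>i\<in>UNIV. h $ i * L' i x)) =
            norm (\<Sum>i\<in>UNIV. h $ i * (partial_deriv i (F m) x - L' i x))"
          by (simp add: sum_subtractf algebra_simps)
        also have "\<dots> \<le> (\<Sum>i\<in>(UNIV :: 'n set). norm h * ?e)"
        proof (rule sum_norm_le)
          fix i
          show "norm (h $ i * (partial_deriv i (F m) x - L' i x)) \<le> norm h * ?e"
            unfolding real_norm_def abs_mult
            using elim component_le_norm_cart [of h i] by (intro mult_mono) (auto intro: less_imp_le)
        qed
        also have "\<dots> = e * norm h" by simp
        finally show "norm ((\<Sum>i\<in>UNIV. h $ i * partial_deriv i (F m) x) - (\<Sum>i\<in>UNIV. h $ i * L' i x)) \<le> e * norm h" .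
      qed
    qed
  qed auto
  then obtain g where g: "\<And>x. (\<lambda>m. F m x) \<longlonglongrightarrow> g x"
    "\<And>x. (g has_derivative (\<lambda>h. \<Sum>i\<in>UNIV. h $ i * L' i x)) (at x)" by auto
  have "g = L" using LIMSEQ_unique [OF g(1) lim] by auto
  then have L: "(L has_derivative (\<lambda>h. \<Sum>i\<in>UNIV. h $ i * L' i x)) (at x)" for x using g(2) by simp
  then show "L differentiable_on UNIV"
    by (auto simp: differentiable_on_def differentiable_def)
  show "partial_deriv i L = L' i"
    by (rule ext) (simp add: partial_deriv_eq [OF L] axis_def if_distrib [of "\<lambda>x. x * _"] cong: if_cong)
qed

lemma multi_deriv_foldr:
  obtains js where "\<And>f :: real ^ 'n::finite \<Rightarrow> real. multi_deriv \<alpha> f = foldr partial_deriv js f"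
proof -
  have "foldr (\<lambda>i. partial_deriv i ^^ (\<alpha> $ i)) ks f =
      foldr partial_deriv (concat (map (\<lambda>i. replicate (\<alpha> $ i) i) ks)) f" for ks and f :: "real ^ 'n \<Rightarrow> real"
    by (induction ks) auto
  with that show ?thesis unfolding multi_deriv_def by blast
qed

text \<open>The partial sums \<open>S n\<close> match \<open>c\<close> below degree
  \<open>n\<close>, and the correction added to \<open>S n\<close> moves derivatives of order less
  than \<open>n\<close> by at most (1/2)^n. Hence all iterated derivatives converge uniformly, to
  functions \<open>L js\<close> that are derivatives of one another, and each Taylor coefficient is
  eventually constant.\<close>

theorem borel_lemma:
  fixes c :: "(real, 'n::finite) mfps"
  obtains f where "smooth f" "taylor f = c"
proof -
  let ?P = "\<lambda>n S. smooth S \<and> order_ge n (taylor S - c)"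
  let ?Q = "\<lambda>n S S'. \<forall>js x. length js < n \<longrightarrow> \<bar>foldr partial_deriv js S' x - foldr partial_deriv js S x\<bar> \<le> (1/2) ^ n"
  have foldr_smooth: "smooth (foldr partial_deriv js f)" if "smooth f" for js and f :: "real ^ 'n \<Rightarrow> real"
    by (induction js) (use that in \<open>auto intro: smooth_partial_deriv\<close>)
  have foldr_add: "foldr partial_deriv js (\<lambda>x. f x + g x) = (\<lambda>x. foldr partial_deriv js f x + foldr partial_deriv js g x)"
    if "smooth f" "smooth g" for js and f g :: "real ^ 'n \<Rightarrow> real"
    by (induction js) (use that in \<open>simp_all add: partial_deriv_add smooth_differentiable_on foldr_smooth\<close>)
  have "\<exists>S. \<forall>n. ?P n (S n) \<and> ?Q n (S n) (S (Suc n))"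
  proof (rule dependent_nat_choice)
    show "\<exists>S. ?P 0 S" by (intro exI [of _ "\<lambda>x. 0"]) auto
    fix S n assume S: "?P n S"
    obtain g where g: "smooth g" "order_ge n (taylor g)"
      "\<And>\<beta>. mdeg \<beta> = n \<Longrightarrow> mcoeff (taylor g) \<beta> = mcoeff (c - taylor S) \<beta>"
      "\<And>js x. length js < n \<Longrightarrow> \<bar>foldr partial_deriv js g x\<bar> \<le> (1/2) ^ n"
      using taylor_correction [of "(1/2) ^ n" n "mcoeff (c - taylor S)"] by auto
    have "mcoeff (taylor S + taylor g - c) \<beta> = 0" if "mdeg \<beta> < Suc n" for \<beta>
      using S g(2) g(3) [of \<beta>] that by (cases "mdeg \<beta> = n") (auto simp: order_ge_def)
    then have "?P (Suc n) (\<lambda>x. S x + g x)"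
      using S g(1) by (auto simp: taylor_add order_ge_def)
    moreover have "?Q n S (\<lambda>x. S x + g x)"
      using S g by (simp add: foldr_add)
    ultimately show "\<exists>S'. ?P (Suc n) S' \<and> ?Q n S S'" by blast
  qed
  then obtain S where S: "\<And>n. smooth (S n)" "\<And>n. order_ge n (taylor (S n) - c)"
    and Q: "\<And>n. ?Q n (S n) (S (Suc n))" by blast
  have "\<exists>L. uniform_limit UNIV (\<lambda>n. foldr partial_deriv js (S n)) L sequentially" for js
  proof -
    let ?u = "\<lambda>n. foldr partial_deriv js (S n)"
    have "uniform_limit UNIV (\<lambda>n x. \<Sum>i<n. ?u (Suc i) x - ?u i x) (\<lambda>x. suminf (\<lambda>i. ?u (Suc i) x - ?u i x)) sequentially"
    \<comment> \<open>For a given \<open>js\<close> only the increments with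
      \<open>n > length js\<close> are controlled, hence the eventual form of the test.\<close>
    proof (rule Weierstrass_m_test_ev)
      show "summable (\<lambda>n. (1/2 :: real) ^ n)" by (rule summable_geometric) simp
      show "\<forall>\<^sub>F n in sequentially. \<forall>x\<in>UNIV. norm (?u (Suc n) x - ?u n x) \<le> (1/2) ^ n"
        using eventually_gt_at_top [of "length js"] by eventually_elim (use Q in auto)
    qed
    then have "uniform_limit UNIV (\<lambda>n x. (\<Sum>i<n. ?u (Suc i) x - ?u i x) + ?u 0 x)
        (\<lambda>x. suminf (\<lambda>i. ?u (Suc i) x - ?u i x) + ?u 0 x) sequentially"
      by (intro uniform_limit_add uniform_limit_const)
    moreover have "(\<Sum>i<n. ?u (Suc i) x - ?u i x) + ?u 0 x = ?u n x" for n x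
      by (subst sum_lessThan_telescope) simp
    ultimately show ?thesis by auto
  qed
  then obtain L where L: "\<And>js. uniform_limit UNIV (\<lambda>n. foldr partial_deriv js (S n)) (L js) sequentially"
    by metis
  have pointwise: "(\<lambda>n. foldr partial_deriv js (S n) x) \<longlonglongrightarrow> L js x" for js x
    using tendsto_uniform_limitI [OF L] by simp
  have step: "L js differentiable_on UNIV" "partial_deriv i (L js) = L (i # js)" for js i
    by (rule has_derivative_uniform_limit [where F = "\<lambda>n. foldr partial_deriv js (S n)" and L' = "\<lambda>i. L (i # js)"],
        use smooth_differentiable_on [OF foldr_smooth [OF S(1)]] pointwise L [of "_ # js"] in auto)+
  have foldr_L: "foldr partial_deriv js (L []) = L js" for js
    by (induction js) (auto simp: step)
  show ?thesis
  proof
    show "smooth (L [])" by (auto simp: smooth_def foldr_L step)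
    show "taylor (L []) = c"
    proof (rule mfps_eqI)
      fix \<alpha>
      obtain js where js: "\<And>f :: real ^ 'n \<Rightarrow> real. multi_deriv \<alpha> f = foldr partial_deriv js f"
        using multi_deriv_foldr by blast
      have "(\<lambda>n. mcoeff (taylor (S n)) \<alpha>) \<longlonglongrightarrow> mcoeff (taylor (L [])) \<alpha>"
        unfolding taylor_def mcoeff_Abs_mfps js foldr_L by (intro tendsto_intros pointwise) auto
      moreover have "\<forall>\<^sub>F n in sequentially. mcoeff (taylor (S n)) \<alpha> = mcoeff c \<alpha>"
        using eventually_gt_at_top [of "mdeg \<alpha>"]
        by eventually_elim (use S(2) in \<open>simp add: order_ge_def\<close>)
      ultimately show "mcoeff (taylor (L [])) \<alpha> = mcoeff c \<alpha>"
        by (metis LIMSEQ_unique tendsto_eventually)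
    qed
  qed
qed


section \<open>Complexification\<close>

definition cemb :: "(real, 'n::finite) mfps \<Rightarrow> (complex, 'n) mfps" where
  "cemb f = Abs_mfps (\<lambda>\<alpha>. of_real (mcoeff f \<alpha>))"

definition mRe :: "(complex, 'n::finite) mfps \<Rightarrow> (real, 'n) mfps" where
  "mRe f = Abs_mfps (\<lambda>\<alpha>. Re (mcoeff f \<alpha>))"

definition mIm :: "(complex, 'n::finite) mfps \<Rightarrow> (real, 'n) mfps" where
  "mIm f = Abs_mfps (\<lambda>\<alpha>. Im (mcoeff f \<alpha>))"

text \<open>The imaginary unit is a ring element, a constant series, because the scalars of
  \<open>*\<^sub>R\<close> are real only; this keeps the spans below real vector spaces.\<close>

definition iu :: "(complex, 'n::finite) mfps" where
  "iu = Abs_mfps (\<lambda>\<alpha>. if \<alpha> = 0 then \<i> else 0)"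

lemma mcoeff_cemb [simp]: "mcoeff (cemb f) \<alpha> = of_real (mcoeff f \<alpha>)"
  by (simp add: cemb_def)

lemma mcoeff_mRe [simp]: "mcoeff (mRe f) \<alpha> = Re (mcoeff f \<alpha>)"
  by (simp add: mRe_def)

lemma mcoeff_mIm [simp]: "mcoeff (mIm f) \<alpha> = Im (mcoeff f \<alpha>)"
  by (simp add: mIm_def)

lemma mcoeff_iu_mult [simp]: "mcoeff (iu * f) \<beta> = \<i> * mcoeff f \<beta>"
proof -
  have "mcoeff (iu * f) \<beta> = (\<Sum>\<alpha> | \<alpha> \<le> \<beta>. if \<alpha> = 0 then \<i> * mcoeff f (\<beta> - \<alpha>) else 0)"
    unfolding mcoeff_mult iu_def by (rule sum.cong) auto
  also have "\<dots> = \<i> * mcoeff f (\<beta> - 0)"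
    by (subst sum.delta [OF finite_le_multiindex]) (auto simp: less_eq_vec_def)
  also have "\<beta> - 0 = \<beta>" by (simp add: vec_eq_iff)
  finally show ?thesis .
qed

lemma iu_iu_mult [simp]: "iu * (iu * f) = - f"
  by (rule mfps_eqI) simp

lemma cemb_0 [simp]: "cemb 0 = 0" and cemb_1 [simp]: "cemb 1 = 1"
  and cemb_add: "cemb (f + g) = cemb f + cemb g"
  and cemb_diff: "cemb (f - g) = cemb f - cemb g"
  and cemb_uminus: "cemb (- f) = - cemb f"
  and cemb_mult: "cemb (f * g) = cemb f * cemb g"
  and cemb_mvar [simp]: "cemb (mvar i) = mvar i"
  by (rule mfps_eqI, simp add: mcoeff_one mcoeff_mult mcoeff_mvar)+

lemma cemb_scaleR: "cemb (r *\<^sub>R f) = r *\<^sub>R cemb f"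
  by (rule mfps_eqI) (simp add: scaleR_conv_of_real [where 'a = complex])

lemma cemb_inject [simp]: "cemb f = cemb g \<longleftrightarrow> f = g"
proof
  assume "cemb f = cemb g"
  then have "mcoeff (cemb f) \<alpha> = mcoeff (cemb g) \<alpha>" for \<alpha> by simp
  then show "f = g" by (intro mfps_eqI) simp
qed simp

lemma mfps_complex_eq: "f = cemb (mRe f) + iu * cemb (mIm f)"
  by (rule mfps_eqI) (simp add: complex_eq_iff)

lemma mfps_complex_eqI: "mRe f = mRe g \<Longrightarrow> mIm f = mIm g \<Longrightarrow> f = g"
  by (metis mfps_complex_eq)

lemma mRe_0 [simp]: "mRe 0 = 0" and mIm_0 [simp]: "mIm 0 = 0"
  and mRe_add: "mRe (f + g) = mRe f + mRe g" and mIm_add: "mIm (f + g) = mIm f + mIm g"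
  and mRe_diff: "mRe (f - g) = mRe f - mRe g" and mIm_diff: "mIm (f - g) = mIm f - mIm g"
  and mRe_uminus: "mRe (- f) = - mRe f" and mIm_uminus: "mIm (- f) = - mIm f"
  and mRe_scaleR: "mRe (r *\<^sub>R f) = r *\<^sub>R mRe f" and mIm_scaleR: "mIm (r *\<^sub>R f) = r *\<^sub>R mIm f"
  and mRe_cemb [simp]: "mRe (cemb h) = h" and mIm_cemb [simp]: "mIm (cemb h) = 0"
  and mRe_iu_mult [simp]: "mRe (iu * f) = - mIm f" and mIm_iu_mult [simp]: "mIm (iu * f) = mRe f"
  by (rule mfps_eqI, simp)+

lemma mRe_cemb_mult [simp]: "mRe (cemb h * f) = h * mRe f" and mIm_cemb_mult [simp]: "mIm (cemb h * f) = h * mIm f"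
  by (rule mfps_eqI, simp add: mcoeff_mult)+

lemma mRe_mult: "mRe (f * g) = mRe f * mRe g - mIm f * mIm g"
  and mIm_mult: "mIm (f * g) = mRe f * mIm g + mIm f * mRe g"
proof -
  have "f * g = (cemb (mRe f) + iu * cemb (mIm f)) * (cemb (mRe g) + iu * cemb (mIm g))"
    using mfps_complex_eq [of f] mfps_complex_eq [of g] by simp
  also have "\<dots> = cemb (mRe f * mRe g - mIm f * mIm g) + iu * cemb (mRe f * mIm g + mIm f * mRe g)"
    using iu_iu_mult [of "cemb (mIm f) * cemb (mIm g)"]
    by (simp add: cemb_mult cemb_add cemb_diff algebra_simps)
  finally have *: "f * g = cemb (mRe f * mRe g - mIm f * mIm g) + iu * cemb (mRe f * mIm g + mIm f * mRe g)" .
  show "mRe (f * g) = mRe f * mRe g - mIm f * mIm g" "mIm (f * g) = mRe f * mIm g + mIm f * mRe g"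
    unfolding * by (simp_all add: mRe_add mIm_add)
qed

lemma mRe_mvar [simp]: "mRe (mvar i) = mvar i" and mIm_mvar [simp]: "mIm (mvar i) = 0"
  by (metis cemb_mvar mRe_cemb mIm_cemb)+

lemma mRe_1 [simp]: "mRe 1 = 1" and mIm_1 [simp]: "mIm 1 = 0"
  by (metis cemb_1 mRe_cemb mIm_cemb)+

lemma mRe_iu [simp]: "mRe iu = 0" and mIm_iu [simp]: "mIm iu = 1"
  using mRe_iu_mult [of 1] mIm_iu_mult [of 1] by simp_all

lemma mfps_deriv_iu [simp]: "mfps_deriv j iu = 0"
proof -
  have "\<alpha> + axis j 1 \<noteq> 0" for \<alpha> :: "nat ^ 'a"
    by (metis mdeg_add mdeg_axis mdeg_0 add_is_0 zero_neq_one)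
  then have "mcoeff iu (\<alpha> + axis j 1) = 0" for \<alpha> :: "nat ^ 'a"
    by (simp add: iu_def)
  then show ?thesis by (intro mfps_eqI) (simp add: mcoeff_deriv)
qed

lemma mRe_deriv: "mRe (mfps_deriv j f) = mfps_deriv j (mRe f)"
  and mIm_deriv: "mIm (mfps_deriv j f) = mfps_deriv j (mIm f)"
  by (rule mfps_eqI, simp add: mcoeff_deriv)+

section \<open>Taylor series of complex-valued functions\<close>

definition csmooth :: "(real ^ 'n::finite \<Rightarrow> complex) \<Rightarrow> bool" where
  "csmooth f \<longleftrightarrow> smooth (\<lambda>x. Re (f x)) \<and> smooth (\<lambda>x. Im (f x))"

definition ctaylor :: "(real ^ 'n::finite \<Rightarrow> complex) \<Rightarrow> (complex, 'n) mfps" where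
  "ctaylor f = cemb (taylor (\<lambda>x. Re (f x))) + iu * cemb (taylor (\<lambda>x. Im (f x)))"

lemma mRe_ctaylor: "mRe (ctaylor f) = taylor (\<lambda>x. Re (f x))"
  and mIm_ctaylor: "mIm (ctaylor f) = taylor (\<lambda>x. Im (f x))"
  by (simp_all add: ctaylor_def mRe_add mIm_add)

lemma csmooth_add: "csmooth f \<Longrightarrow> csmooth g \<Longrightarrow> csmooth (\<lambda>x. f x + g x)"
  and csmooth_mult: "csmooth f \<Longrightarrow> csmooth g \<Longrightarrow> csmooth (\<lambda>x. f x * g x)"
  and csmooth_uminus: "csmooth f \<Longrightarrow> csmooth (\<lambda>x. - f x)"
  by (auto simp: csmooth_def)

lemma csmooth_const: "csmooth (\<lambda>x. c)"
  and csmooth_of_real: "smooth r \<Longrightarrow> csmooth (\<lambda>x. of_real (r x))"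
  and csmooth_cnj: "csmooth f \<Longrightarrow> csmooth (\<lambda>x. cnj (f x))"
  by (auto simp: csmooth_def)

lemma csmooth_power: "csmooth f \<Longrightarrow> csmooth (\<lambda>x. f x ^ n)"
  by (induction n) (auto intro: csmooth_const csmooth_mult)

lemmas csmooth_intros = csmooth_add csmooth_mult csmooth_uminus csmooth_const csmooth_of_real
  csmooth_cnj csmooth_power

lemma ctaylor_add: "csmooth f \<Longrightarrow> csmooth g \<Longrightarrow> ctaylor (\<lambda>x. f x + g x) = ctaylor f + ctaylor g"
  by (rule mfps_complex_eqI) (simp_all add: mRe_ctaylor mIm_ctaylor mRe_add mIm_add taylor_add csmooth_def)

lemma ctaylor_uminus: "csmooth f \<Longrightarrow> ctaylor (\<lambda>x. - f x) = - ctaylor f"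
  by (rule mfps_complex_eqI) (simp_all add: mRe_ctaylor mIm_ctaylor mRe_uminus mIm_uminus taylor_uminus csmooth_def)

lemma ctaylor_mult: "csmooth f \<Longrightarrow> csmooth g \<Longrightarrow> ctaylor (\<lambda>x. f x * g x) = ctaylor f * ctaylor g"
  by (rule mfps_complex_eqI)
    (simp_all add: mRe_ctaylor mIm_ctaylor mRe_mult mIm_mult taylor_add taylor_diff taylor_mult csmooth_def smooth_mult)

lemma ctaylor_of_real: "ctaylor (\<lambda>x. of_real (r x)) = cemb (taylor r)"
  by (simp add: ctaylor_def)

lemma ctaylor_cnj: "csmooth f \<Longrightarrow> ctaylor (\<lambda>x. cnj (f x)) = cemb (mRe (ctaylor f)) - iu * cemb (mIm (ctaylor f))"
  by (simp add: ctaylor_def csmooth_def taylor_uminus cemb_uminus mRe_add mIm_add)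

lemma ctaylor_ii: "ctaylor (\<lambda>x. \<i>) = iu"
  by (rule mfps_complex_eqI) (simp_all add: mRe_ctaylor mIm_ctaylor taylor_const)

lemma ctaylor_power: "csmooth f \<Longrightarrow> ctaylor (\<lambda>x. f x ^ n) = ctaylor f ^ n"
proof (induction n)
  case 0
  then show ?case using ctaylor_of_real [of "\<lambda>x. 1"] by (simp add: taylor_const)
qed (simp add: ctaylor_mult csmooth_power)

section \<open>The normal form as a formal vector field\<close>

lemma exhaust_6:
  fixes x :: 6
  shows "x = 1 \<or> x = 2 \<or> x = 3 \<or> x = 4 \<or> x = 5 \<or> x = 6"
proof (induct x)
  case (of_int z)
  then have "z = 0 \<or> z = 1 \<or> z = 2 \<or> z = 3 \<or> z = 4 \<or> z = 5" by fastforce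
  then show ?case by auto
qed

lemma forall_6: "(\<forall>i::6. P i) \<longleftrightarrow> P 1 \<and> P 2 \<and> P 3 \<and> P 4 \<and> P 5 \<and> P 6"
  by (metis exhaust_6)

lemma UNIV_6: "UNIV = {1, 2, 3, 4, 5, 6::6}"
  using exhaust_6 by auto

lemma sum_6: "sum f (UNIV::6 set) = f 1 + f 2 + f 3 + f 4 + f 5 + f 6"
  unfolding UNIV_6 by (simp add: ac_simps)

lemma prod_6: "prod f (UNIV::6 set) = f 1 * f 2 * f 3 * f 4 * f 5 * f 6"
  unfolding UNIV_6 by (simp add: ac_simps)

lemma vector_6 [simp]:
  "(vector [a, b, c, d, e, f] :: ('a::zero) ^ 6) $ 1 = a"
  "(vector [a, b, c, d, e, f] :: ('a::zero) ^ 6) $ 2 = b"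
  "(vector [a, b, c, d, e, f] :: ('a::zero) ^ 6) $ 3 = c"
  "(vector [a, b, c, d, e, f] :: ('a::zero) ^ 6) $ 4 = d"
  "(vector [a, b, c, d, e, f] :: ('a::zero) ^ 6) $ 5 = e"
  "(vector [a, b, c, d, e, f] :: ('a::zero) ^ 6) $ 6 = f"
  unfolding vector_def by simp_all

lemma vector_4 [simp]:
  "(vector [a, b, c, d] :: ('a::zero) ^ 4) $ 1 = a"
  "(vector [a, b, c, d] :: ('a::zero) ^ 4) $ 2 = b"
  "(vector [a, b, c, d] :: ('a::zero) ^ 4) $ 3 = c"
  "(vector [a, b, c, d] :: ('a::zero) ^ 4) $ 4 = d"
  unfolding vector_def by simp_all

lemma of_coords_nth [simp]:
  "of_coords a b z w $ 1 = a" "of_coords a b z w $ 2 = b"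
  "of_coords a b z w $ 3 = Re z" "of_coords a b z w $ 4 = Im z"
  "of_coords a b z w $ 5 = Re w" "of_coords a b z w $ 6 = Im w"
  by (simp_all add: of_coords_def)

section \<open>Complex coordinates and the generators of the normal form\<close>

definition zz1 :: "(complex, 6) mfps" where "zz1 = mvar 3 + iu * mvar 4"
definition zb1 :: "(complex, 6) mfps" where "zb1 = mvar 3 - iu * mvar 4"
definition zz2 :: "(complex, 6) mfps" where "zz2 = mvar 5 + iu * mvar 6"
definition zb2 :: "(complex, 6) mfps" where "zb2 = mvar 5 - iu * mvar 6"

lemma ctaylor_z1: "csmooth z1" "ctaylor z1 = zz1"
  and ctaylor_z2: "csmooth z2" "ctaylor z2 = zz2"
  unfolding z1_def z2_def
  by (auto simp: csmooth_def ctaylor_def taylor_coord zz1_def zz2_def)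

lemma ctaylor_cnj_z1: "ctaylor (\<lambda>x. cnj (z1 x)) = zb1"
  and ctaylor_cnj_z2: "ctaylor (\<lambda>x. cnj (z2 x)) = zb2"
  by (simp_all add: ctaylor_cnj ctaylor_z1 ctaylor_z2 zz1_def zz2_def zb1_def zb2_def mRe_add mIm_add)

text \<open>The resonant monomial: its real part \<open>resp\<close> is the fourth invariant, its
  imaginary part \<open>ress\<close> the factor \<open>J\<close> of the normal form.\<close>

definition resq :: "nat \<Rightarrow> nat \<Rightarrow> (complex, 6) mfps" where
  "resq n1 n2 = zz1 ^ n2 * zb2 ^ n1"

abbreviation resp :: "nat \<Rightarrow> nat \<Rightarrow> (real, 6) mfps" where
  "resp n1 n2 \<equiv> mRe (resq n1 n2)"

abbreviation ress :: "nat \<Rightarrow> nat \<Rightarrow> (real, 6) mfps" where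
  "ress n1 n2 \<equiv> mIm (resq n1 n2)"

definition formal_invs :: "nat \<Rightarrow> nat \<Rightarrow> (real, 6) mfps ^ 4" where
  "formal_invs n1 n2 = vector [mvar 1, mvar 3 ^ 2 + mvar 4 ^ 2, mvar 5 ^ 2 + mvar 6 ^ 2, resp n1 n2]"

definition real_coords ::
    "(real, 6) mfps \<Rightarrow> (real, 6) mfps \<Rightarrow> (complex, 6) mfps \<Rightarrow> (complex, 6) mfps \<Rightarrow> 6 formal_map" where
  "real_coords a b W V = vector [a, b, mRe W, mIm W, mRe V, mIm V]"

lemma real_coords_nth [simp]:
  "real_coords a b W V $ 1 = a" "real_coords a b W V $ 2 = b"
  "real_coords a b W V $ 3 = mRe W" "real_coords a b W V $ 4 = mIm W"
  "real_coords a b W V $ 5 = mRe V" "real_coords a b W V $ 6 = mIm V"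
  by (simp_all add: real_coords_def)

definition formal_lin :: "real \<Rightarrow> real \<Rightarrow> 6 formal_map" where
  "formal_lin \<omega>1 \<omega>2 = real_coords (mvar 2) 0 (- (\<omega>1 *\<^sub>R (iu * zz1))) (- (\<omega>2 *\<^sub>R (iu * zz2)))"

text \<open>The vector field multiplying \<open>f\<^sub>i(X)\<close> in the normal form.\<close>

definition nf_gen :: "nat \<Rightarrow> nat \<Rightarrow> nat \<Rightarrow> 6 formal_map" where
  "nf_gen n1 n2 i =
    (let s = ress n1 n2; S = cemb s;
         v = zb1 ^ (n2 - 1) * zz2 ^ n1; w = zz1 ^ n2 * zb2 ^ (n1 - 1)
     in [real_coords (mvar 1 * s) (mvar 2 * s) 0 0,
         real_coords 0 1 0 0,
         real_coords 0 0 (iu * zz1) 0,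
         real_coords 0 0 (iu * v) 0,
         real_coords 0 0 (zz1 * S) 0,
         real_coords 0 0 (v * S) 0,
         real_coords 0 0 0 (iu * zz2),
         real_coords 0 0 0 (iu * w),
         real_coords 0 0 0 (zz2 * S),
         real_coords 0 0 0 (w * S)] ! i)"

text \<open>The degree of homogeneity of \<open>nf_gen n1 n2 i\<close>. Added to the weight of a
  monomial in the invariants it tells in which degree of the field the corresponding coefficient of
  \<open>f\<^sub>i\<close> appears.\<close>

definition nf_shift :: "nat \<Rightarrow> nat \<Rightarrow> nat \<Rightarrow> nat" where
  "nf_shift n1 n2 i =
    (let N = n1 + n2 in [N + 1, 0, 1, N - 1, N + 1, 2 * N - 1, 1, N - 1, N + 1, 2 * N - 1] ! i)"

definition formal_nf :: "nat \<Rightarrow> nat \<Rightarrow> (nat \<Rightarrow> (real, 4) mfps) \<Rightarrow> 6 formal_map" where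
  "formal_nf n1 n2 g = (\<chi> j. \<Sum>i<10. mfps_compose (g i) (formal_invs n1 n2) * nf_gen n1 n2 i $ j)"

lemma sum_lessThan_10: "(\<Sum>i<10. f i) = f 0 + f 1 + f 2 + f 3 + f 4 + f 5 + f 6 + f 7 + f 8 + (f (9::nat) :: 'a::comm_monoid_add)"
  by (simp add: eval_nat_numeral One_nat_def ac_simps)

lemma nf_gen_simps:
  "nf_gen n1 n2 0 = real_coords (mvar 1 * ress n1 n2) (mvar 2 * ress n1 n2) 0 0"
  "nf_gen n1 n2 1 = real_coords 0 1 0 0"
  "nf_gen n1 n2 2 = real_coords 0 0 (iu * zz1) 0"
  "nf_gen n1 n2 3 = real_coords 0 0 (iu * (zb1 ^ (n2 - 1) * zz2 ^ n1)) 0"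
  "nf_gen n1 n2 4 = real_coords 0 0 (zz1 * cemb (ress n1 n2)) 0"
  "nf_gen n1 n2 5 = real_coords 0 0 (zb1 ^ (n2 - 1) * zz2 ^ n1 * cemb (ress n1 n2)) 0"
  "nf_gen n1 n2 6 = real_coords 0 0 0 (iu * zz2)"
  "nf_gen n1 n2 7 = real_coords 0 0 0 (iu * (zz1 ^ n2 * zb2 ^ (n1 - 1)))"
  "nf_gen n1 n2 8 = real_coords 0 0 0 (zz2 * cemb (ress n1 n2))"
  "nf_gen n1 n2 9 = real_coords 0 0 0 (zz1 ^ n2 * zb2 ^ (n1 - 1) * cemb (ress n1 n2))"
  by (simp_all add: nf_gen_def Let_def eval_nat_numeral One_nat_def)

lemma formal_nf_eq:
  fixes g n1 n2
  defines "G \<equiv> \<lambda>i. mfps_compose (g i) (formal_invs n1 n2)"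
  shows "formal_nf n1 n2 g = real_coords
    (mvar 1 * ress n1 n2 * G 0)
    (G 1 + mvar 2 * ress n1 n2 * G 0)
    (iu * zz1 * cemb (G 2) + iu * (zb1 ^ (n2 - 1) * zz2 ^ n1) * cemb (G 3)
      + zz1 * cemb (ress n1 n2) * cemb (G 4) + zb1 ^ (n2 - 1) * zz2 ^ n1 * cemb (ress n1 n2) * cemb (G 5))
    (iu * zz2 * cemb (G 6) + iu * (zz1 ^ n2 * zb2 ^ (n1 - 1)) * cemb (G 7)
      + zz2 * cemb (ress n1 n2) * cemb (G 8) + zz1 ^ n2 * zb2 ^ (n1 - 1) * cemb (ress n1 n2) * cemb (G 9))"
proof -
  have re: "mRe (W * cemb h) = h * mRe W" and im: "mIm (W * cemb h) = h * mIm W" for W :: "(complex, 6) mfps" and h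
    by (metis mRe_cemb_mult mIm_cemb_mult mult.commute)+
  show ?thesis
    unfolding vec_eq_iff forall_6 formal_nf_def vec_lambda_beta sum_lessThan_10 nf_gen_simps real_coords_nth
      mRe_add mIm_add re im mRe_0 mIm_0
    by (simp add: G_def mult.commute mult.left_commute re im)
qed

section \<open>Taylor series of the normal form\<close>

context
  fixes n1 n2 :: nat
  assumes n1: "n1 \<noteq> 0" and n2: "n2 \<noteq> 0"
begin

lemma taylor_resq:
  "csmooth (\<lambda>x. z1 x ^ n2 * cnj (z2 x) ^ n1)"
  "ctaylor (\<lambda>x. z1 x ^ n2 * cnj (z2 x) ^ n1) = resq n1 n2"
proof -
  show "csmooth (\<lambda>x. z1 x ^ n2 * cnj (z2 x) ^ n1)"
    by (intro csmooth_intros ctaylor_z1 ctaylor_z2)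
  show "ctaylor (\<lambda>x. z1 x ^ n2 * cnj (z2 x) ^ n1) = resq n1 n2"
    by (simp add: ctaylor_mult ctaylor_power csmooth_power csmooth_cnj ctaylor_z1 ctaylor_z2 ctaylor_cnj_z2 resq_def)
qed

lemma taylor_invariants:
  "smooth (\<lambda>x. invariants n1 n2 x $ j)"
  "taylor (\<lambda>x. invariants n1 n2 x $ j) = formal_invs n1 n2 $ j"
proof -
  have sq: "smooth (\<lambda>x :: real ^ 6. (x $ i)\<^sup>2 + (x $ k)\<^sup>2)"
    "taylor (\<lambda>x :: real ^ 6. (x $ i)\<^sup>2 + (x $ k)\<^sup>2) = mvar i ^ 2 + mvar k ^ 2" for i k
    by (auto simp: taylor_add smooth_power taylor_power taylor_coord)
  let ?P = "\<lambda>j. smooth (\<lambda>x. invariants n1 n2 x $ j) \<and>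
    taylor (\<lambda>x. invariants n1 n2 x $ j) = formal_invs n1 n2 $ j"
  have "?P 1" by (simp add: invariants_def formal_invs_def taylor_coord smooth_coord)
  moreover have "?P 2" "?P 3"
    using sq by (simp_all add: invariants_def formal_invs_def cmod_power2 z1_def z2_def)
  moreover have "?P 4"
    using taylor_resq mRe_ctaylor [of "\<lambda>x. z1 x ^ n2 * cnj (z2 x) ^ n1"]
    unfolding csmooth_def invariants_def formal_invs_def vector_4 by auto
  ultimately have "?P j" using exhaust_4 [of j] by blast
  then show "smooth (\<lambda>x. invariants n1 n2 x $ j)"
    "taylor (\<lambda>x. invariants n1 n2 x $ j) = formal_invs n1 n2 $ j" by auto
qed

lemma taylor_compose_invariants:
  assumes "smooth f"
  shows "smooth (\<lambda>x. f (invariants n1 n2 x))"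
    "taylor (\<lambda>x. f (invariants n1 n2 x)) = mfps_compose (taylor f) (formal_invs n1 n2)"
proof -
  \<comment> \<open>The exponents are positive, so the resonant monomial vanishes at 0 and the
    invariants can be substituted into a formal series.\<close>
  have "invariants n1 n2 0 = 0"
    using n1 n2 by (simp add: vec_eq_iff forall_4 invariants_def z1_def z2_def complex_eq_iff [of _ 0] Complex_eq_0)
  from taylor_compose [OF assms taylor_invariants(1) this]
  show "taylor (\<lambda>x. f (invariants n1 n2 x)) = mfps_compose (taylor f) (formal_invs n1 n2)"
    by (simp add: taylor_invariants(2))
  show "smooth (\<lambda>x. f (invariants n1 n2 x))"
    by (rule smooth_compose [OF assms taylor_invariants(1)])
qed

text \<open>Only the Taylor series of the \<open>f i\<close> enter, so the problem can be solved for
  formal coefficients and smooth functions chosen at the very end.\<close>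

lemma taylor_normal_form:
  assumes f: "\<And>i. i \<le> 9 \<Longrightarrow> smooth (f i)"
  shows "taylor_map (normal_form n1 n2 \<omega>1 \<omega>2 f) = formal_lin \<omega>1 \<omega>2 + formal_nf n1 n2 (\<lambda>i. taylor (f i))"
proof -
  let ?q = "\<lambda>x. z1 x ^ n2 * cnj (z2 x) ^ n1"
  define s where "s x = Im (?q x)" for x
  define g where "g i x = f i (invariants n1 n2 x)" for i x
  have s: "smooth s" "taylor s = ress n1 n2"
    using taylor_resq mIm_ctaylor [of ?q] unfolding csmooth_def s_def by auto
  have g: "smooth (g i)" "taylor (g i) = mfps_compose (taylor (f i)) (formal_invs n1 n2)" if "i \<le> 9" for i
    unfolding g_def by (rule taylor_compose_invariants [OF f [OF that]])+
  let ?W1 = "\<lambda>x. - \<i> * \<omega>1 * z1 x + \<i> * z1 x * g 2 x + \<i> * cnj (z1 x) ^ (n2 - 1) * z2 x ^ n1 * g 3 x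
         + z1 x * s x * g 4 x + cnj (z1 x) ^ (n2 - 1) * z2 x ^ n1 * s x * g 5 x"
  let ?W2 = "\<lambda>x. - \<i> * \<omega>2 * z2 x + \<i> * z2 x * g 6 x + \<i> * z1 x ^ n2 * cnj (z2 x) ^ (n1 - 1) * g 7 x
         + z2 x * s x * g 8 x + z1 x ^ n2 * cnj (z2 x) ^ (n1 - 1) * s x * g 9 x"
  have nf: "normal_form n1 n2 \<omega>1 \<omega>2 f = (\<lambda>x. of_coords (x $ 2 + x $ 1 * s x * g 0 x)
      (g 1 x + x $ 2 * s x * g 0 x) (?W1 x) (?W2 x))"
    unfolding normal_form_def Let_def s_def g_def ..
  have const: "cemb (of_real c) = of_real c" for c
    by (simp add: of_real_def cemb_scaleR)
  have g': "smooth (g 2)" "smooth (g 3)" "smooth (g 4)" "smooth (g 5)" "smooth (g 6)" "smooth (g 7)" "smooth (g 8)" "smooth (g 9)"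
    by (rule g(1), simp)+
  note cs = csmooth_intros ctaylor_z1(1) ctaylor_z2(1) s(1) g' smooth_const
  note ct = ctaylor_add ctaylor_mult ctaylor_uminus ctaylor_power ctaylor_of_real ctaylor_ii ctaylor_z1(2) ctaylor_z2(2)
    ctaylor_cnj_z1 ctaylor_cnj_z2 s(2) taylor_const
  have W1: "ctaylor ?W1 = - (\<omega>1 *\<^sub>R (iu * zz1)) + (iu * zz1 * cemb (taylor (g 2)) + iu * (zb1 ^ (n2 - 1) * zz2 ^ n1) * cemb (taylor (g 3))
      + zz1 * cemb (ress n1 n2) * cemb (taylor (g 4)) + zb1 ^ (n2 - 1) * zz2 ^ n1 * cemb (ress n1 n2) * cemb (taylor (g 5)))"
    by (simp only: cs ct const) (simp add: scaleR_conv_of_real mult_ac add_ac)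
  have W2: "ctaylor ?W2 = - (\<omega>2 *\<^sub>R (iu * zz2)) + (iu * zz2 * cemb (taylor (g 6)) + iu * (zz1 ^ n2 * zb2 ^ (n1 - 1)) * cemb (taylor (g 7))
      + zz2 * cemb (ress n1 n2) * cemb (taylor (g 8)) + zz1 ^ n2 * zb2 ^ (n1 - 1) * cemb (ress n1 n2) * cemb (taylor (g 9)))"
    by (simp only: cs ct const) (simp add: scaleR_conv_of_real mult_ac add_ac)
  have "taylor_map (normal_form n1 n2 \<omega>1 \<omega>2 f) =
      real_coords (taylor (\<lambda>x. x $ 2 + x $ 1 * s x * g 0 x)) (taylor (\<lambda>x. g 1 x + x $ 2 * s x * g 0 x))
        (ctaylor ?W1) (ctaylor ?W2)"
    unfolding vec_eq_iff forall_6 taylor_map_def vec_lambda_beta nf of_coords_nth real_coords_nth mRe_ctaylor mIm_ctaylor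
    by (intro conjI refl)
  also have "taylor (\<lambda>x. x $ 2 + x $ 1 * s x * g 0 x) = mvar 2 + mvar 1 * ress n1 n2 * taylor (g 0)"
    by (simp add: taylor_add taylor_mult taylor_coord smooth_mult s g(1))
  also have "taylor (\<lambda>x. g 1 x + x $ 2 * s x * g 0 x) = taylor (g 1) + mvar 2 * ress n1 n2 * taylor (g 0)"
    by (simp add: taylor_add taylor_mult taylor_coord smooth_mult s g(1))
  finally show ?thesis
    unfolding W1 W2 formal_nf_eq
    by (rule trans) (simp add: vec_eq_iff forall_6 formal_lin_def g(2) mRe_add mIm_add mRe_diff mIm_diff mRe_uminus mIm_uminus)
qed

end


section \<open>The homological equation\<close>

text \<open>The derivative (Df) L along the linear field. Polymorphic in the coefficients, so that
  it applies to a complex series as well as to its real and imaginary parts.\<close>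

definition lieD :: "real \<Rightarrow> real \<Rightarrow> ('a::{comm_ring_1, real_algebra_1}, 6) mfps \<Rightarrow> ('a, 6) mfps" where
  "lieD \<omega>1 \<omega>2 f = mfps_deriv 1 f * mvar 2
    + \<omega>1 *\<^sub>R (mfps_deriv 3 f * mvar 4 - mfps_deriv 4 f * mvar 3)
    + \<omega>2 *\<^sub>R (mfps_deriv 5 f * mvar 6 - mfps_deriv 6 f * mvar 5)"

definition iX2 :: "(complex, 6) mfps" where "iX2 = iu * mvar 2"

definition zmon :: "nat \<Rightarrow> nat \<Rightarrow> nat \<Rightarrow> nat \<Rightarrow> (complex, 6) mfps" where
  "zmon c d e f = zz1 ^ c * zb1 ^ d * zz2 ^ e * zb2 ^ f"

context
  fixes \<omega>1 \<omega>2 :: real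
begin

lemma lieD_add: "lieD \<omega>1 \<omega>2 (f + g) = lieD \<omega>1 \<omega>2 f + lieD \<omega>1 \<omega>2 g"
  by (simp add: lieD_def mfps_deriv_add algebra_simps)

lemma lieD_diff: "lieD \<omega>1 \<omega>2 (f - g) = lieD \<omega>1 \<omega>2 f - lieD \<omega>1 \<omega>2 g"
  by (simp add: lieD_def mfps_deriv_diff algebra_simps)

lemma lieD_0 [simp]: "lieD \<omega>1 \<omega>2 0 = 0"
  by (simp add: lieD_def)

lemma lieD_scaleR: "lieD \<omega>1 \<omega>2 (r *\<^sub>R f) = r *\<^sub>R lieD \<omega>1 \<omega>2 f"
  by (simp add: lieD_def mfps_deriv_scaleR algebra_simps)

lemma lieD_mult: "lieD \<omega>1 \<omega>2 (f * g) = lieD \<omega>1 \<omega>2 f * g + f * lieD \<omega>1 \<omega>2 g"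
  by (simp add: lieD_def mfps_deriv_mult algebra_simps)

lemma lieD_iu [simp]: "lieD \<omega>1 \<omega>2 iu = 0"
  by (simp add: lieD_def)

lemma mRe_lieD: "mRe (lieD \<omega>1 \<omega>2 f) = lieD \<omega>1 \<omega>2 (mRe f)" and mIm_lieD: "mIm (lieD \<omega>1 \<omega>2 f) = lieD \<omega>1 \<omega>2 (mIm f)"
  by (simp_all add: lieD_def mRe_add mRe_diff mRe_scaleR mRe_mult mRe_deriv
      mIm_add mIm_diff mIm_scaleR mIm_mult mIm_deriv)

text \<open>In the variables \<open>x\<^sub>1, i x\<^sub>2, z\<^sub>1, cnj z\<^sub>1, z\<^sub>2, cnj z\<^sub>2\<close> the derivation \<open>i lieD\<close> and the
  reversing symmetry both become real.\<close>

definition ilieD :: "(complex, 6) mfps \<Rightarrow> (complex, 6) mfps" where "ilieD f = iu * lieD \<omega>1 \<omega>2 f"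

lemma ilieD_add: "ilieD (f + g) = ilieD f + ilieD g"
  and ilieD_diff: "ilieD (f - g) = ilieD f - ilieD g"
  and ilieD_scaleR: "ilieD (r *\<^sub>R f) = r *\<^sub>R ilieD f"
  and ilieD_mult: "ilieD (f * g) = ilieD f * g + f * ilieD g"
  and ilieD_0 [simp]: "ilieD 0 = 0"
  by (simp_all add: ilieD_def lieD_add lieD_diff lieD_scaleR lieD_mult algebra_simps)

lemma ilieD_ilieD: "ilieD (ilieD f) = - lieD \<omega>1 \<omega>2 (lieD \<omega>1 \<omega>2 f)"
  by (simp add: ilieD_def lieD_mult)

lemma ilieD_1 [simp]: "ilieD 1 = 0"
  using ilieD_mult [of 1 1] by simp

lemma ilieD_vars:
  "ilieD (mvar 1) = iX2" "ilieD iX2 = 0"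
  "ilieD zz1 = \<omega>1 *\<^sub>R zz1" "ilieD zb1 = - \<omega>1 *\<^sub>R zb1" "ilieD zz2 = \<omega>2 *\<^sub>R zz2" "ilieD zb2 = - \<omega>2 *\<^sub>R zb2"
  by (simp_all add: ilieD_def lieD_def mfps_deriv_mvar mfps_deriv_add mfps_deriv_diff mfps_deriv_mult
      iX2_def zz1_def zb1_def zz2_def zb2_def algebra_simps)

lemma ilieD_eigen_mult: "ilieD f = \<nu> *\<^sub>R f \<Longrightarrow> ilieD g = \<mu> *\<^sub>R g \<Longrightarrow> ilieD (f * g) = (\<nu> + \<mu>) *\<^sub>R (f * g)"
  by (simp add: ilieD_mult scaleR_left_distrib)

lemma ilieD_eigen_power: "ilieD f = \<nu> *\<^sub>R f \<Longrightarrow> ilieD (f ^ n) = (real n * \<nu>) *\<^sub>R f ^ n"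
  by (induction n) (simp_all add: ilieD_mult algebra_simps)

definition freq :: "nat \<Rightarrow> nat \<Rightarrow> nat \<Rightarrow> nat \<Rightarrow> real" where
  "freq c d e f = \<omega>1 * (real c - real d) + \<omega>2 * (real e - real f)"

lemma ilieD_zmon: "ilieD (zmon c d e f) = freq c d e f *\<^sub>R zmon c d e f"
proof -
  have "ilieD (zmon c d e f) =
      (real c * \<omega>1 + real d * (- \<omega>1) + real e * \<omega>2 + real f * (- \<omega>2)) *\<^sub>R zmon c d e f"
    unfolding zmon_def by (intro ilieD_eigen_mult ilieD_eigen_power ilieD_vars)
  then show ?thesis by (simp add: freq_def algebra_simps)
qed

lemma ilieD_x_power: "ilieD (mvar 1 ^ a) = real a *\<^sub>R (mvar 1 ^ (a - 1) * iX2)"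
proof (induction a)
  case (Suc a)
  have "mvar 1 * (real a *\<^sub>R (mvar 1 ^ (a - 1) * iX2)) = real a *\<^sub>R (mvar 1 ^ a * iX2)"
    by (cases a) (simp_all add: mult.assoc)
  then show ?case by (simp add: ilieD_mult ilieD_vars Suc scaleR_left_distrib mult.commute)
qed simp

text \<open>For \<open>a = 0\<close> the exponent \<open>a - 1\<close> is truncated, but the factor
  \<open>real a\<close> vanishes. Otherwise the nilpotent part strictly lowers the exponent of
  \<open>mvar 1\<close>, which makes the operator triangular.\<close>

lemma ilieD_monomial:
  assumes "ilieD Z = \<mu> *\<^sub>R Z"
  shows "ilieD (mvar 1 ^ a * iX2 ^ b * Z) =
    real a *\<^sub>R (mvar 1 ^ (a - 1) * iX2 ^ (b + 1) * Z) + \<mu> *\<^sub>R (mvar 1 ^ a * iX2 ^ b * Z)"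
proof -
  have "ilieD (iX2 ^ b) = 0"
    using ilieD_eigen_power [of iX2 0 b] by (simp add: ilieD_vars)
  then show ?thesis
    by (simp add: ilieD_mult ilieD_x_power assms power_add mult_ac add_ac)
qed

text \<open>For an eigenvector \<open>Z\<close> of \<open>ilieD\<close> this space is invariant, and
  \<open>ilieD\<close> acts on it as a scalar plus a locally nilpotent operator.\<close>

definition zspan :: "(complex, 6) mfps \<Rightarrow> (complex, 6) mfps set" where
  "zspan Z = span (range (\<lambda>(a, b). mvar 1 ^ a * iX2 ^ b * Z))"

lemma zspan_base: "mvar 1 ^ a * iX2 ^ b * Z \<in> zspan Z"
  unfolding zspan_def by (intro span_base) (auto intro: range_eqI [of _ _ "(a, b)"])

lemma ilieD_shift_surj_monomial:
  assumes "ilieD Z = \<mu> *\<^sub>R Z" "\<mu> \<noteq> \<kappa>"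
  shows "\<exists>\<xi>\<in>zspan Z. ilieD \<xi> - \<kappa> *\<^sub>R \<xi> = mvar 1 ^ a * iX2 ^ b * Z"
proof (induction a arbitrary: b)
  case 0
  let ?m = "mvar 1 ^ 0 * iX2 ^ b * Z"
  let ?c = "1 / (\<mu> - \<kappa>)"
  have "ilieD ?m = \<mu> *\<^sub>R ?m"
    unfolding ilieD_monomial [OF assms(1)] by simp
  then have "ilieD (?c *\<^sub>R ?m) - \<kappa> *\<^sub>R (?c *\<^sub>R ?m) = (?c * \<mu> - \<kappa> * ?c) *\<^sub>R ?m"
    by (simp only: ilieD_scaleR scaleR_left_diff_distrib scaleR_scaleR)
  also have "?c * \<mu> - \<kappa> * ?c = 1"
    using assms(2) by (simp flip: diff_divide_distrib)
  finally have "ilieD (?c *\<^sub>R ?m) - \<kappa> *\<^sub>R (?c *\<^sub>R ?m) = ?m" by (simp only: scaleR_one)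
  moreover have "?c *\<^sub>R ?m \<in> zspan Z"
    using zspan_base [of 0 b Z] unfolding zspan_def by (rule span_scale)
  ultimately show ?case by blast
next
  case (Suc a)
  let ?m = "mvar 1 ^ Suc a * iX2 ^ b * Z"
  obtain \<zeta> where \<zeta>: "\<zeta> \<in> zspan Z" "ilieD \<zeta> - \<kappa> *\<^sub>R \<zeta> = mvar 1 ^ a * iX2 ^ (b + 1) * Z"
    using Suc by blast
  \<comment> \<open>The shifted operator sends \<open>?m\<close> to
    \<open>(\<mu> - \<kappa>) *\<^sub>R ?m\<close> plus \<open>Suc a\<close> times a monomial with
    lower exponent of \<open>mvar 1\<close>, whose preimage is \<zeta>; subtracting
    \<open>real (Suc a) *\<^sub>R \<zeta>\<close> cancels the second part.\<close>
  let ?\<xi> = "(1 / (\<mu> - \<kappa>)) *\<^sub>R (?m - real (Suc a) *\<^sub>R \<zeta>)"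
  have "ilieD ?\<xi> - \<kappa> *\<^sub>R ?\<xi> = (1 / (\<mu> - \<kappa>)) *\<^sub>R (ilieD ?m - \<kappa> *\<^sub>R ?m - real (Suc a) *\<^sub>R (ilieD \<zeta> - \<kappa> *\<^sub>R \<zeta>))"
    by (simp only: ilieD_scaleR ilieD_diff scaleR_right_diff_distrib scaleR_scaleR mult.commute mult.left_commute)
      (simp only: algebra_simps)
  also have "ilieD ?m - \<kappa> *\<^sub>R ?m = real (Suc a) *\<^sub>R (mvar 1 ^ a * iX2 ^ (b + 1) * Z) + (\<mu> - \<kappa>) *\<^sub>R ?m"
    unfolding ilieD_monomial [OF assms(1)] by (simp add: algebra_simps)
  also have "(1 / (\<mu> - \<kappa>)) *\<^sub>R (real (Suc a) *\<^sub>R (mvar 1 ^ a * iX2 ^ (b + 1) * Z) + (\<mu> - \<kappa>) *\<^sub>R ?m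
      - real (Suc a) *\<^sub>R (ilieD \<zeta> - \<kappa> *\<^sub>R \<zeta>)) = ?m"
    using assms(2) unfolding \<zeta>(2) by simp
  finally have "ilieD ?\<xi> - \<kappa> *\<^sub>R ?\<xi> = ?m" .
  moreover have "?\<xi> \<in> zspan Z"
    using \<zeta>(1) zspan_base [of "Suc a" b Z] unfolding zspan_def by (intro span_scale span_diff)
  ultimately show ?case by blast
qed

text \<open>Solvability modulo \<open>T\<close> is a linear condition on the right-hand side, so it
  need only be checked on spanning monomials.\<close>

lemma subspace_image_shift:
  fixes L :: "(complex, 6) mfps \<Rightarrow> (complex, 6) mfps"
  assumes S: "subspace S" and T: "subspace T" and L: "\<And>f g. L (f + g) = L f + L g" "\<And>r f. L (r *\<^sub>R f) = r *\<^sub>R L f"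
  shows "subspace {\<zeta>. \<exists>\<xi>\<in>S. \<zeta> - L \<xi> \<in> T}"
proof (rule subspaceI)
  have "L 0 = 0" using L(2) [of 0 0] by simp
  then show "0 \<in> {\<zeta>. \<exists>\<xi>\<in>S. \<zeta> - L \<xi> \<in> T}"
    using subspace_0 [OF S] subspace_0 [OF T] by (auto intro!: bexI [of _ 0])
next
  fix x y assume "x \<in> {\<zeta>. \<exists>\<xi>\<in>S. \<zeta> - L \<xi> \<in> T}" "y \<in> {\<zeta>. \<exists>\<xi>\<in>S. \<zeta> - L \<xi> \<in> T}"
  then obtain \<xi> \<eta> where *: "\<xi> \<in> S" "\<eta> \<in> S" "x - L \<xi> \<in> T" "y - L \<eta> \<in> T" by auto
  have "x + y - L (\<xi> + \<eta>) = (x - L \<xi>) + (y - L \<eta>)" by (simp add: L)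
  with * show "x + y \<in> {\<zeta>. \<exists>\<xi>\<in>S. \<zeta> - L \<xi> \<in> T}"
    using subspace_add [OF S] subspace_add [OF T] by (metis (mono_tags, lifting) mem_Collect_eq)
next
  fix c x assume "x \<in> {\<zeta>. \<exists>\<xi>\<in>S. \<zeta> - L \<xi> \<in> T}"
  then obtain \<xi> where *: "\<xi> \<in> S" "x - L \<xi> \<in> T" by auto
  have "c *\<^sub>R x - L (c *\<^sub>R \<xi>) = c *\<^sub>R (x - L \<xi>)" by (simp add: L scaleR_right_diff_distrib)
  with * show "c *\<^sub>R x \<in> {\<zeta>. \<exists>\<xi>\<in>S. \<zeta> - L \<xi> \<in> T}"
    using subspace_scale [OF S] subspace_scale [OF T] by (metis (mono_tags, lifting) mem_Collect_eq)
qed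

text \<open>Keeping the preimage inside \<open>zspan Z\<close> permits a second inversion, as the
  second-order equation demands.\<close>

lemma ilieD_surj_zspan:
  assumes "ilieD Z = \<mu> *\<^sub>R Z" "\<mu> \<noteq> 0" "\<zeta> \<in> zspan Z"
  shows "\<exists>\<xi>\<in>zspan Z. ilieD \<xi> = \<zeta>"
proof -
  have "\<exists>\<xi>\<in>zspan Z. mvar 1 ^ a * iX2 ^ b * Z = ilieD \<xi>" for a b
    using ilieD_shift_surj_monomial [OF assms(1,2), of a b] by (simp add: eq_commute)
  then have "range (\<lambda>(a, b). mvar 1 ^ a * iX2 ^ b * Z) \<subseteq> {\<zeta>. \<exists>\<xi>\<in>zspan Z. \<zeta> - ilieD \<xi> \<in> {0}}"
    by auto
  moreover have "subspace {\<zeta>. \<exists>\<xi>\<in>zspan Z. \<zeta> - ilieD \<xi> \<in> {0}}"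
    by (intro subspace_image_shift) (auto simp: zspan_def ilieD_add ilieD_scaleR)
  ultimately have "zspan Z \<subseteq> {\<zeta>. \<exists>\<xi>\<in>zspan Z. \<zeta> - ilieD \<xi> \<in> {0}}"
    unfolding zspan_def by (rule span_minimal)
  with assms(3) show ?thesis by auto
qed

end

text \<open>Polynomials with real coefficients in the adapted variables. This is the complex form of
  reversibility: solving inside this real span automatically yields changes of coordinates that
  commute with \<phi>.\<close>

definition revspan :: "(complex, 6) mfps set" where
  "revspan = span (range (\<lambda>(a, b, c, d, e, f). mvar 1 ^ a * iX2 ^ b * zmon c d e f))"

lemma revspan_base: "mvar 1 ^ a * iX2 ^ b * zmon c d e f \<in> revspan"
  unfolding revspan_def by (intro span_base) (auto intro: range_eqI [of _ _ "(a, b, c, d, e, f)"])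

lemma subspace_revspan: "subspace revspan"
  by (simp add: revspan_def)

lemma zspan_subset_revspan: "zspan (zmon c d e f) \<subseteq> revspan"
  unfolding zspan_def
  by (rule span_minimal [OF _ subspace_revspan]) (auto intro: revspan_base)

text \<open>The shift \<kappa> is the contribution of \<open>L \<xi>\<close> in a z-component, where
  L multiplies by -i times the frequency. Only resonant monomials free of \<open>iX2\<close> are
  obstructions.\<close>

lemma homological_first_order:
  fixes \<omega>1 \<omega>2 \<kappa> :: real
  assumes T: "subspace T"
    and res: "\<And>a c d e f. freq \<omega>1 \<omega>2 c d e f = \<kappa> \<Longrightarrow> mvar 1 ^ a * zmon c d e f \<in> T"
    and \<zeta>: "\<zeta> \<in> revspan"
  shows "\<exists>\<xi>\<in>revspan. \<zeta> - (ilieD \<omega>1 \<omega>2 \<xi> - \<kappa> *\<^sub>R \<xi>) \<in> T"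
proof -
  let ?E = "ilieD \<omega>1 \<omega>2"
  let ?L = "\<lambda>\<xi>. ?E \<xi> - \<kappa> *\<^sub>R \<xi>"
  let ?W = "{\<zeta>. \<exists>\<xi>\<in>revspan. \<zeta> - ?L \<xi> \<in> T}"
  have "mvar 1 ^ a * iX2 ^ b * zmon c d e f \<in> ?W" for a b c d e f
  proof (cases "freq \<omega>1 \<omega>2 c d e f = \<kappa>")
    case False
    from ilieD_shift_surj_monomial [OF ilieD_zmon this, of a b]
    obtain \<xi> where "\<xi> \<in> zspan (zmon c d e f)" "?L \<xi> = mvar 1 ^ a * iX2 ^ b * zmon c d e f" by blast
    then show ?thesis
      using subsetD [OF zspan_subset_revspan, of \<xi>] subspace_0 [OF T] by (auto intro!: bexI [of _ \<xi>])
  next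
    case True
    show ?thesis
    proof (cases b)
      case 0
      then show ?thesis
        using res [OF True] subspace_0 [OF subspace_revspan] by (auto intro!: bexI [of _ 0])
    next
      case (Suc b')
      \<comment> \<open>At resonance the scalar part cancels; what remains turns one
        \<open>mvar 1\<close> into \<open>iX2\<close>, with factor \<open>a + 1\<close>.\<close>
      let ?\<xi> = "(1 / real (a + 1)) *\<^sub>R (mvar 1 ^ (a + 1) * iX2 ^ b' * zmon c d e f)"
      have "?L ?\<xi> = mvar 1 ^ a * iX2 ^ b * zmon c d e f"
        unfolding ilieD_scaleR ilieD_monomial [OF ilieD_zmon] True
        by (simp add: Suc scaleR_right_distrib power_add mult_ac del: of_nat_add of_nat_Suc)
      moreover have "?\<xi> \<in> revspan"
        by (intro subspace_scale [OF subspace_revspan] revspan_base)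
      ultimately show ?thesis
        using subspace_0 [OF T] by (auto intro!: bexI [of _ ?\<xi>])
    qed
  qed
  moreover have "subspace ?W"
    by (intro subspace_image_shift subspace_revspan T) (simp_all add: ilieD_add ilieD_scaleR algebra_simps)
  ultimately have "revspan \<subseteq> ?W"
    unfolding revspan_def by (intro span_minimal) auto
  with \<zeta> show ?thesis by auto
qed

text \<open>Two applications of the nilpotent part produce two factors \<open>iX2\<close>. Resonant
  monomials with \<open>b \<ge> 2\<close> are therefore images, while \<open>b = 0\<close> and
  \<open>b = 1\<close> are both left over; hence two assumptions on \<open>T\<close>.\<close>

lemma homological_second_order:
  fixes \<omega>1 \<omega>2 :: real
  assumes T: "subspace T"
    and res: "\<And>a c d e f. freq \<omega>1 \<omega>2 c d e f = 0 \<Longrightarrow> mvar 1 ^ a * zmon c d e f \<in> T"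
    and res': "\<And>a c d e f. freq \<omega>1 \<omega>2 c d e f = 0 \<Longrightarrow> mvar 1 ^ a * iX2 * zmon c d e f \<in> T"
    and \<zeta>: "\<zeta> \<in> revspan"
  shows "\<exists>\<xi>\<in>revspan. \<zeta> - ilieD \<omega>1 \<omega>2 (ilieD \<omega>1 \<omega>2 \<xi>) \<in> T"
proof -
  let ?E = "ilieD \<omega>1 \<omega>2"
  let ?W = "{\<zeta>. \<exists>\<xi>\<in>revspan. \<zeta> - ?E (?E \<xi>) \<in> T}"
  have "mvar 1 ^ a * iX2 ^ b * zmon c d e f \<in> ?W" for a b c d e f
  proof (cases "freq \<omega>1 \<omega>2 c d e f = 0")
    case False
    from ilieD_surj_zspan [OF ilieD_zmon this zspan_base]
    obtain \<xi> where "\<xi> \<in> zspan (zmon c d e f)" "?E \<xi> = mvar 1 ^ a * iX2 ^ b * zmon c d e f" by blast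
    with ilieD_surj_zspan [OF ilieD_zmon False, of \<xi>]
    obtain \<xi>' where "\<xi>' \<in> zspan (zmon c d e f)" "?E (?E \<xi>') = mvar 1 ^ a * iX2 ^ b * zmon c d e f" by auto
    then show ?thesis
      using subsetD [OF zspan_subset_revspan, of \<xi>'] subspace_0 [OF T] by (auto intro!: bexI [of _ \<xi>'])
  next
    case True
    consider "b = 0" | "b = 1" | b' where "b = b' + 2"
      by (metis One_nat_def add_2_eq_Suc' not0_implies_Suc)
    then show ?thesis
    proof cases
      case 1
      then show ?thesis
        using res [OF True] subspace_0 [OF subspace_revspan] by (auto intro!: bexI [of _ 0])
    next
      case 2
      then show ?thesis
        using res' [OF True] subspace_0 [OF subspace_revspan] by (auto intro!: bexI [of _ 0])
    next
      case 3
      let ?m = "\<lambda>a b. mvar 1 ^ a * iX2 ^ b * zmon c d e f"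
      \<comment> \<open>The divisor is what two derivatives of \<open>mvar 1 ^ (a + 2)\<close>
        produce.\<close>
      let ?\<xi> = "(1 / (real (a + 2) * real (a + 1))) *\<^sub>R ?m (a + 2) b'"
      have ilieD: "?E (?m (Suc a) b) = real (Suc a) *\<^sub>R ?m a (Suc b)" for a b
        using ilieD_monomial [OF ilieD_zmon [of \<omega>1 \<omega>2 c d e f], of "Suc a" b] unfolding True by (simp add: Suc_eq_plus1 [symmetric] del: Suc_eq_plus1)
      have "?E (?E (?m (Suc (Suc a)) b')) = (real (a + 2) * real (a + 1)) *\<^sub>R ?m a (Suc (Suc b'))"
        by (simp only: ilieD ilieD_scaleR scaleR_scaleR) simp
      then have "?E (?E ?\<xi>) = ?m a b"
        by (simp add: ilieD_scaleR 3 del: of_nat_add of_nat_Suc)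
      moreover have "?\<xi> \<in> revspan"
        by (intro subspace_scale [OF subspace_revspan] revspan_base)
      ultimately show ?thesis
        using subspace_0 [OF T] by (auto intro!: bexI [of _ ?\<xi>])
    qed
  qed
  moreover have "subspace ?W"
    by (intro subspace_image_shift subspace_revspan T) (simp_all add: ilieD_add ilieD_scaleR)
  ultimately have "revspan \<subseteq> ?W"
    unfolding revspan_def by (intro span_minimal) auto
  with \<zeta> show ?thesis by auto
qed

subsection \<open>Resonant monomials\<close>

text \<open>Coprimality makes (n2, -n1) a generator of the lattice of solutions. With a common
  divisor g > 1 the shorter vector (n2/g, -n1/g) would also solve the equation, and a smaller
  resonant monomial would appear.\<close>

lemma resonant_exponents:
  fixes n1 n2 :: nat and x y :: int
  assumes "coprime n1 n2" "n1 \<noteq> 0" "n2 \<noteq> 0" "int n1 * x + int n2 * y = 0"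
  obtains t where "x = int n2 * t" "y = - int n1 * t"
proof -
  have "int n2 dvd int n1 * x"
    using assms(4) by (metis dvd_add_left_iff dvd_triv_left dvd_0_right)
  then have "int n2 dvd x"
    using assms(1) by (metis coprime_commute coprime_dvd_mult_right_iff coprime_int_iff)
  then obtain t where t: "x = int n2 * t" by (auto simp: dvd_def)
  with assms(4) have "int n2 * (int n1 * t + y) = 0" by (simp add: algebra_simps)
  then have "y = - int n1 * t" using assms(3) by simp
  with t that show ?thesis by blast
qed

text \<open>Once all pairs \<open>z * zb\<close> and \<open>w * wb\<close> are split off, the sign
  of the lattice parameter decides whether powers of the resonant monomial or of its conjugate
  remain.\<close>

lemma resonant_monomial_invariant:
  fixes z zb w wb :: "'a::comm_monoid_mult"
  assumes n: "coprime n1 n2" "n1 \<noteq> 0" "n2 \<noteq> 0"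
    and res: "int n1 * (int c - int d) + int n2 * (int e - int f) = 0"
  obtains i j t where
    "z ^ c * zb ^ d * w ^ e * wb ^ f = (z * zb) ^ i * (w * wb) ^ j * (z ^ n2 * wb ^ n1) ^ t \<or>
     z ^ c * zb ^ d * w ^ e * wb ^ f = (z * zb) ^ i * (w * wb) ^ j * (zb ^ n2 * w ^ n1) ^ t"
proof -
  obtain t where t: "int c - int d = int n2 * t" "int e - int f = - int n1 * t"
    using resonant_exponents [OF n res] .
  show ?thesis
  proof (cases "t \<ge> 0")
    case True
    then obtain s where "t = int s" using nonneg_int_cases by blast
    with t have "int c = int (d + n2 * s)" "int f = int (e + n1 * s)" by simp_all
    then have "c = d + n2 * s" "f = e + n1 * s" by (simp_all only: of_nat_eq_iff)
    then have "z ^ c * zb ^ d * w ^ e * wb ^ f = (z * zb) ^ d * (w * wb) ^ e * (z ^ n2 * wb ^ n1) ^ s"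
      by (simp add: power_add power_mult power_mult_distrib mult_ac)
    then show ?thesis using that by blast
  next
    case False
    then obtain s where "- t = int s" by (metis nonneg_int_cases neg_0_le_iff_le linear)
    then have "t = - int s" by simp
    with t have "int d = int (c + n2 * s)" "int e = int (f + n1 * s)" by simp_all
    then have "d = c + n2 * s" "e = f + n1 * s" by (simp_all only: of_nat_eq_iff)
    then have "z ^ c * zb ^ d * w ^ e * wb ^ f = (z * zb) ^ c * (w * wb) ^ f * (zb ^ n2 * w ^ n1) ^ s"
      by (simp add: power_add power_mult power_mult_distrib mult_ac)
    then show ?thesis using that by blast
  qed
qed

text \<open>The frequency is that of one \<open>z\<close>. Either this \<open>z\<close> factors out,
  or else \<open>zb ^ (n2 - 1) * w ^ n1\<close> does, formally the conjugate resonant monomial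
  divided by \<open>zb\<close>. The abstract monoid allows the two pairs of variables to be
  interchanged.\<close>

lemma resonant_monomial_equivariant:
  fixes z zb w wb :: "'a::comm_monoid_mult"
  assumes n: "coprime n1 n2" "n1 \<noteq> 0" "n2 \<noteq> 0"
    and res: "int n1 * (int c - int d - 1) + int n2 * (int e - int f) = 0"
  obtains i j t where
    "z ^ c * zb ^ d * w ^ e * wb ^ f = z * ((z * zb) ^ i * (w * wb) ^ j * (z ^ n2 * wb ^ n1) ^ t) \<or>
     z ^ c * zb ^ d * w ^ e * wb ^ f =
      zb ^ (n2 - 1) * w ^ n1 * ((z * zb) ^ i * (w * wb) ^ j * (zb ^ n2 * w ^ n1) ^ t)"
proof -
  obtain t where t: "int c - int d - 1 = int n2 * t" "int e - int f = - int n1 * t"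
    using resonant_exponents [OF n res] .
  show ?thesis
  proof (cases "t \<ge> 0")
    case True
    then obtain s where "t = int s" using nonneg_int_cases by blast
    with t have "int c = int (Suc (d + n2 * s))" "int f = int (e + n1 * s)" by simp_all
    then have "c = Suc (d + n2 * s)" "f = e + n1 * s" by (simp_all only: of_nat_eq_iff)
    then have "z ^ c * zb ^ d * w ^ e * wb ^ f = z * ((z * zb) ^ d * (w * wb) ^ e * (z ^ n2 * wb ^ n1) ^ s)"
      by (simp add: power_add power_mult power_mult_distrib mult_ac)
    then show ?thesis using that by blast
  next
    case False
    \<comment> \<open>One unit of \<open>- t\<close> is spent on the generator
      \<open>zb ^ (n2 - 1) * w ^ n1\<close>, which leaves \<open>- t - 1\<close> powers of the
      conjugate resonant monomial.\<close>
    then have "0 \<le> - t - 1" by simp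
    then obtain s where "- t - 1 = int s" using nonneg_int_cases by blast
    then have "t = - int s - 1" by simp
    with t have "int d = int (c + (n2 - 1) + n2 * s)" "int e = int (f + n1 + n1 * s)"
      using n(3) by (simp_all add: algebra_simps of_nat_diff)
    then have "d = c + (n2 - 1) + n2 * s" "e = f + n1 + n1 * s" by (simp_all only: of_nat_eq_iff)
    then have "z ^ c * zb ^ d * w ^ e * wb ^ f =
        zb ^ (n2 - 1) * w ^ n1 * ((z * zb) ^ c * (w * wb) ^ f * (zb ^ n2 * w ^ n1) ^ s)"
      by (simp add: power_add power_mult power_mult_distrib mult_ac)
    then show ?thesis using that by blast
  qed
qed

text \<open>Conjugation acts on coefficients only; as the six variables are real, it exchanges
  \<open>zz1\<close> with \<open>zb1\<close> and \<open>zz2\<close> with \<open>zb2\<close>.\<close>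

definition mcnj :: "(complex, 'n::finite) mfps \<Rightarrow> (complex, 'n) mfps" where
  "mcnj f = cemb (mRe f) - iu * cemb (mIm f)"

lemma mRe_mcnj [simp]: "mRe (mcnj f) = mRe f" and mIm_mcnj [simp]: "mIm (mcnj f) = - mIm f"
  by (simp_all add: mcnj_def mRe_diff mIm_diff)

lemma mcnj_mult: "mcnj (f * g) = mcnj f * mcnj g"
  by (rule mfps_complex_eqI) (simp_all add: mRe_mult mIm_mult)

lemma mcnj_power: "mcnj (f ^ n) = mcnj f ^ n"
proof (induction n)
  case 0
  show ?case by (rule mfps_complex_eqI) simp_all
qed (simp add: mcnj_mult)

lemma mcnj_vars: "mcnj zz1 = zb1" "mcnj zb1 = zz1" "mcnj zz2 = zb2" "mcnj zb2 = zz2"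
  by (rule mfps_complex_eqI,
      simp_all add: zz1_def zb1_def zz2_def zb2_def mRe_add mIm_add mRe_diff mIm_diff)+

lemma resq_cnj: "zb1 ^ n2 * zz2 ^ n1 = cemb (resp n1 n2) - iu * cemb (ress n1 n2)"
proof -
  have "zb1 ^ n2 * zz2 ^ n1 = mcnj (resq n1 n2)"
    by (simp add: resq_def mcnj_mult mcnj_power mcnj_vars)
  then show ?thesis by (simp add: mcnj_def)
qed

lemma zz_zb:
  "zz1 * zb1 = cemb (mvar 3 ^ 2 + mvar 4 ^ 2)" "zz2 * zb2 = cemb (mvar 5 ^ 2 + mvar 6 ^ 2)"
  by (rule mfps_complex_eqI,
      simp_all add: zz1_def zb1_def zz2_def zb2_def mRe_mult mIm_mult mRe_add mIm_add mRe_diff mIm_diff power2_eq_square algebra_simps)+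

section \<open>Modules of invariant and equivariant series\<close>

context
  fixes n1 n2 :: nat
begin

definition invalg :: "(complex, 6) mfps set" where
  "invalg = range (\<lambda>f. cemb (mfps_compose f (formal_invs n1 n2)))"

text \<open>The real and imaginary parts of the resonant monomial enter separately, and
  \<open>iu\<close> gives the odd series \<open>ress\<close> the right reality. Degree one in
  \<open>ress\<close> suffices, since its square lies in \<open>invalg\<close>.\<close>

definition invmod :: "(complex, 6) mfps set" where
  "invmod = {A + iu * cemb (ress n1 n2) * B | A B. A \<in> invalg \<and> B \<in> invalg}"

text \<open>Two generators over \<open>invmod\<close>, each with two real coefficient series from
  \<open>invalg\<close>, account for the four functions in each z-equation of the normal
  form.\<close>

definition eqvmod :: "(complex, 6) mfps \<Rightarrow> (complex, 6) mfps \<Rightarrow> (complex, 6) mfps set" where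
  "eqvmod z v = {z * A + v * B | A B. A \<in> invmod \<and> B \<in> invmod}"

context
  assumes n1: "n1 \<noteq> 0" and n2: "n2 \<noteq> 0"
begin

lemma order_ge_vars: "order_ge 1 zz1" "order_ge 1 zb1" "order_ge 1 zz2" "order_ge 1 zb2"
  by (auto simp: order_ge_def zz1_def zb1_def zz2_def zb2_def mcoeff_mvar axis_eq_0_iff_nat [symmetric])

lemma order_ge_formal_invs: "order_ge 1 (formal_invs n1 n2 $ j)"
proof -
  have "order_ge (n2 * 1 + n1 * 1) (resq n1 n2)"
    unfolding resq_def by (intro order_ge_mult order_ge_power order_ge_vars)
  then have "order_ge 1 (resq n1 n2)" using n1 by (rule_tac order_ge_mono) auto
  then have "order_ge 1 (resp n1 n2)" by (simp add: order_ge_def)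
  moreover have "order_ge 1 (mvar i ^ 2 + mvar k ^ 2)" for i k :: 6
    unfolding power2_eq_square
    by (intro order_ge_add order_ge_mult' [OF order_ge_mvar order_ge_mvar]) auto
  ultimately show ?thesis
    using exhaust_4 [of j] order_ge_mvar by (auto simp: formal_invs_def)
qed

lemma invalg_add: "A \<in> invalg \<Longrightarrow> B \<in> invalg \<Longrightarrow> A + B \<in> invalg"
  unfolding invalg_def by (auto simp: mfps_compose_add cemb_add intro: range_eqI [of _ _ "f + g" for f g])

lemma invalg_mult: "A \<in> invalg \<Longrightarrow> B \<in> invalg \<Longrightarrow> A * B \<in> invalg"
  unfolding invalg_def
  by (auto simp: mfps_compose_mult [OF order_ge_formal_invs] cemb_mult intro: range_eqI [of _ _ "f * g" for f g])

lemma invalg_scaleR: "A \<in> invalg \<Longrightarrow> r *\<^sub>R A \<in> invalg"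
  unfolding invalg_def
  by (auto simp: mfps_compose_scaleR cemb_scaleR intro: range_eqI [of _ _ "r *\<^sub>R f" for f])

lemma invalg_uminus: "A \<in> invalg \<Longrightarrow> - A \<in> invalg"
  using invalg_scaleR [of A "-1"] by simp

lemma invalg_diff: "A \<in> invalg \<Longrightarrow> B \<in> invalg \<Longrightarrow> A - B \<in> invalg"
  using invalg_add [OF _ invalg_uminus, of A B] by simp

lemma invalg_0: "0 \<in> invalg"
  unfolding invalg_def by (rule range_eqI [of _ _ 0]) simp

lemma invalg_1: "1 \<in> invalg"
  unfolding invalg_def
  using mfps_compose_mpow [OF order_ge_formal_invs, of 0] by (intro range_eqI [of _ _ 1]) simp

lemma invalg_power: "A \<in> invalg \<Longrightarrow> A ^ k \<in> invalg"
  by (induction k) (auto intro: invalg_1 invalg_mult)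

lemma invalg_gen: "cemb (formal_invs n1 n2 $ j) \<in> invalg"
  unfolding invalg_def using mfps_compose_mvar [OF order_ge_formal_invs, of j]
  by (intro range_eqI [of _ _ "mvar j"]) simp

lemma invalg_gens: "mvar 1 \<in> invalg" "zz1 * zb1 \<in> invalg" "zz2 * zb2 \<in> invalg" "cemb (resp n1 n2) \<in> invalg"
  using invalg_gen [of 1] invalg_gen [of 2] invalg_gen [of 3] invalg_gen [of 4]
  by (simp_all add: formal_invs_def zz_zb)

text \<open>The squared modulus of the resonant monomial is \<open>resp\<close> squared plus
  \<open>ress\<close> squared, and it is also a product of powers of the two squared moduli. Hence
  \<open>ress\<close> squared is a polynomial in the invariants.\<close>

lemma invalg_ress: "cemb (ress n1 n2) * cemb (ress n1 n2) \<in> invalg"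
proof -
  let ?p = "cemb (resp n1 n2)" and ?s = "cemb (ress n1 n2)"
  have "(zz1 * zb1) ^ n2 * (zz2 * zb2) ^ n1 = resq n1 n2 * (zb1 ^ n2 * zz2 ^ n1)"
    by (simp add: resq_def power_mult_distrib mult_ac)
  also have "\<dots> = (?p + iu * ?s) * (?p - iu * ?s)"
    unfolding resq_cnj using mfps_complex_eq [of "resq n1 n2"] by simp
  also have "\<dots> = ?p * ?p + ?s * ?s"
    using iu_iu_mult [of "?s * ?s"] by (simp add: algebra_simps)
  finally have "?s * ?s = (zz1 * zb1) ^ n2 * (zz2 * zb2) ^ n1 - ?p * ?p" by simp
  then show ?thesis by (simp add: invalg_diff invalg_mult invalg_power invalg_gens)
qed

lemma invmodI: "A \<in> invalg \<Longrightarrow> B \<in> invalg \<Longrightarrow> A + iu * cemb (ress n1 n2) * B \<in> invmod"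
  unfolding invmod_def by blast

lemma invalg_subset_invmod: "A \<in> invalg \<Longrightarrow> A \<in> invmod"
  using invmodI [OF _ invalg_0, of A] by simp

lemma invmod_add:
  assumes "U \<in> invmod" "V \<in> invmod" shows "U + V \<in> invmod"
proof -
  obtain A B C F where AB: "A \<in> invalg" "B \<in> invalg" "C \<in> invalg" "F \<in> invalg"
    and eq: "U = A + iu * cemb (ress n1 n2) * B" "V = C + iu * cemb (ress n1 n2) * F"
    using assms unfolding invmod_def by blast
  have "U + V = (A + C) + iu * cemb (ress n1 n2) * (B + F)" by (simp add: eq algebra_simps)
  with AB show ?thesis by (simp add: invmodI invalg_add)
qed

lemma invmod_scaleR:
  assumes "U \<in> invmod" shows "r *\<^sub>R U \<in> invmod"
proof -
  obtain A B where AB: "A \<in> invalg" "B \<in> invalg" and eq: "U = A + iu * cemb (ress n1 n2) * B"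
    using assms unfolding invmod_def by blast
  have U: "r *\<^sub>R U = r *\<^sub>R A + iu * cemb (ress n1 n2) * (r *\<^sub>R B)" by (simp add: eq algebra_simps)
  show ?thesis unfolding U by (intro invmodI invalg_scaleR AB)
qed

lemma invmod_mult:
  assumes "U \<in> invmod" "V \<in> invmod" shows "U * V \<in> invmod"
proof -
  let ?s = "cemb (ress n1 n2)"
  obtain A B C F where AB: "A \<in> invalg" "B \<in> invalg" "C \<in> invalg" "F \<in> invalg"
    and eq: "U = A + iu * ?s * B" "V = C + iu * ?s * F"
    using assms unfolding invmod_def by blast
  have "U * V = (A * C - ?s * ?s * (B * F)) + iu * ?s * (A * F + B * C)"
    using iu_iu_mult [of "?s * ?s * (B * F)"] by (simp add: eq algebra_simps)
  moreover have "A * C - ?s * ?s * (B * F) \<in> invalg" "A * F + B * C \<in> invalg"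
    using AB by (simp_all add: invalg_diff invalg_add invalg_mult invalg_ress)
  ultimately show ?thesis by (simp add: invmodI)
qed

lemma invmod_power: "U \<in> invmod \<Longrightarrow> U ^ k \<in> invmod"
  by (induction k) (auto intro: invalg_subset_invmod invalg_1 invmod_mult)

lemma invmod_resq: "zz1 ^ n2 * zb2 ^ n1 \<in> invmod" "zb1 ^ n2 * zz2 ^ n1 \<in> invmod"
proof -
  have "resq n1 n2 = cemb (resp n1 n2) + iu * cemb (ress n1 n2) * 1"
    using mfps_complex_eq [of "resq n1 n2"] by simp
  then show "zz1 ^ n2 * zb2 ^ n1 \<in> invmod"
    unfolding resq_def [symmetric] by (metis invmodI invalg_gens(4) invalg_1)
  have "zb1 ^ n2 * zz2 ^ n1 = cemb (resp n1 n2) + iu * cemb (ress n1 n2) * (- 1)"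
    by (simp add: resq_cnj)
  then show "zb1 ^ n2 * zz2 ^ n1 \<in> invmod"
    by (metis invmodI invalg_gens(4) invalg_1 invalg_uminus)
qed

lemma invmod_products:
  "(zz1 * zb1) ^ i * (zz2 * zb2) ^ j * (zz1 ^ n2 * zb2 ^ n1) ^ t \<in> invmod"
  "(zz1 * zb1) ^ i * (zz2 * zb2) ^ j * (zb1 ^ n2 * zz2 ^ n1) ^ t \<in> invmod"
  using invalg_gens(2,3) invmod_resq
  by (auto intro!: invmod_mult [OF invmod_mult] invmod_power invalg_subset_invmod [OF invalg_gens(2)]
      invalg_subset_invmod [OF invalg_gens(3)] simp del: power_mult_distrib)

lemma invmod_x_mult: "U \<in> invmod \<Longrightarrow> mvar 1 ^ a * U \<in> invmod"
  by (rule invmod_mult [OF invmod_power [OF invalg_subset_invmod [OF invalg_gens(1)]]])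

lemma invmod_0: "0 \<in> invmod"
  by (simp add: invalg_subset_invmod invalg_0)

lemma eqvmodI1: "A \<in> invmod \<Longrightarrow> z * A \<in> eqvmod z v"
  unfolding eqvmod_def using invmod_0 by force

lemma eqvmodI2: "B \<in> invmod \<Longrightarrow> v * B \<in> eqvmod z v"
  unfolding eqvmod_def using invmod_0 by force

lemma subspace_eqvmod: "subspace (eqvmod z v)"
proof (rule subspaceI)
  show "0 \<in> eqvmod z v" using eqvmodI1 [OF invmod_0] by simp
next
  fix x y assume "x \<in> eqvmod z v" "y \<in> eqvmod z v"
  then obtain A B C F where AB: "A \<in> invmod" "B \<in> invmod" "C \<in> invmod" "F \<in> invmod"
    and eq: "x = z * A + v * B" "y = z * C + v * F"
    unfolding eqvmod_def by blast
  have "x + y = z * (A + C) + v * (B + F)" by (simp add: eq algebra_simps)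
  with AB show "x + y \<in> eqvmod z v" unfolding eqvmod_def by (blast intro: invmod_add)
next
  fix c x assume "x \<in> eqvmod z v"
  then obtain A B where AB: "A \<in> invmod" "B \<in> invmod" and eq: "x = z * A + v * B"
    unfolding eqvmod_def by blast
  have "c *\<^sub>R x = z * (c *\<^sub>R A) + v * (c *\<^sub>R B)" by (simp add: eq algebra_simps)
  with AB show "c *\<^sub>R x \<in> eqvmod z v" unfolding eqvmod_def by (blast intro: invmod_scaleR)
qed

context
  fixes \<omega>1 \<omega>2 :: real
  assumes cop: "coprime n1 n2" and om: "\<omega>1 \<noteq> 0" "\<omega>2 \<noteq> 0" and rel: "real n1 * \<omega>2 - real n2 * \<omega>1 = 0"
begin

text \<open>The vector (\<omega>1, \<omega>2) is proportional to (n1, n2), so a relation with real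
  frequencies becomes one with integer coefficients, to which divisibility applies.\<close>

lemma frequency_integral:
  assumes "\<omega>1 * x + \<omega>2 * y = 0"
  shows "real n1 * x + real n2 * y = 0"
proof -
  have "\<omega>1 * (real n1 * x + real n2 * y) = real n1 * (\<omega>1 * x + \<omega>2 * y) - (real n1 * \<omega>2 - real n2 * \<omega>1) * y"
    by (simp add: algebra_simps)
  then show ?thesis using om assms rel by simp
qed

lemma resonant_0:
  assumes "freq \<omega>1 \<omega>2 c d e f = 0"
  shows "zmon c d e f \<in> invmod"
proof -
  have "real n1 * (real c - real d) + real n2 * (real e - real f) = 0"
    using assms by (intro frequency_integral) (simp add: freq_def)
  then have "real_of_int (int n1 * (int c - int d) + int n2 * (int e - int f)) = 0" by simp
  then have "int n1 * (int c - int d) + int n2 * (int e - int f) = 0" by linarith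
  from resonant_monomial_invariant [OF cop n1 n2 this, of zz1 zb1 zz2 zb2] show ?thesis
    unfolding zmon_def using invmod_products by metis
qed

lemma resonant_1:
  assumes "freq \<omega>1 \<omega>2 c d e f = \<omega>1"
  shows "zmon c d e f \<in> eqvmod zz1 (zb1 ^ (n2 - 1) * zz2 ^ n1)"
proof -
  have "real n1 * (real c - real d - 1) + real n2 * (real e - real f) = 0"
    using assms by (intro frequency_integral) (simp add: freq_def algebra_simps)
  then have "real_of_int (int n1 * (int c - int d - 1) + int n2 * (int e - int f)) = 0" by simp
  then have "int n1 * (int c - int d - 1) + int n2 * (int e - int f) = 0" by linarith
  from resonant_monomial_equivariant [OF cop n1 n2 this, of zz1 zb1 zz2 zb2] show ?thesis
    unfolding zmon_def using invmod_products eqvmodI1 eqvmodI2 by metis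
qed

lemma resonant_2:
  assumes "freq \<omega>1 \<omega>2 c d e f = \<omega>2"
  shows "zmon c d e f \<in> eqvmod zz2 (zz1 ^ n2 * zb2 ^ (n1 - 1))"
proof -
  have cop': "coprime n2 n1" using cop by (simp add: coprime_commute)
  have "real n1 * (real c - real d) + real n2 * (real e - real f - 1) = 0"
    using assms by (intro frequency_integral) (simp add: freq_def algebra_simps)
  then have "real_of_int (int n2 * (int e - int f - 1) + int n1 * (int c - int d)) = 0" by simp
  then have "int n2 * (int e - int f - 1) + int n1 * (int c - int d) = 0" by linarith
  \<comment> \<open>The equivariant case with the two pairs of variables, and \<open>n1\<close> and
    \<open>n2\<close>, interchanged.\<close>
  then obtain i j t where
    "zz2 ^ e * zb2 ^ f * zz1 ^ c * zb1 ^ d = zz2 * ((zz2 * zb2) ^ i * (zz1 * zb1) ^ j * (zz2 ^ n1 * zb1 ^ n2) ^ t) \<or>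
     zz2 ^ e * zb2 ^ f * zz1 ^ c * zb1 ^ d =
      zb2 ^ (n1 - 1) * zz1 ^ n2 * ((zz2 * zb2) ^ i * (zz1 * zb1) ^ j * (zb2 ^ n1 * zz1 ^ n2) ^ t)"
    by (rule resonant_monomial_equivariant [OF cop' n2 n1, of _ _ _ _ zz2 zb2 zz1 zb1])
  then have "zmon c d e f = zz2 * ((zz1 * zb1) ^ j * (zz2 * zb2) ^ i * (zb1 ^ n2 * zz2 ^ n1) ^ t) \<or>
      zmon c d e f = zz1 ^ n2 * zb2 ^ (n1 - 1) * ((zz1 * zb1) ^ j * (zz2 * zb2) ^ i * (zz1 ^ n2 * zb2 ^ n1) ^ t)"
    by (simp only: zmon_def mult.commute mult.left_commute mult.assoc)
  then show ?thesis
    using invmod_products eqvmodI1 eqvmodI2 by metis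
qed

end

end

end


subsection \<open>Degree and parity\<close>

definition hpart :: "nat \<Rightarrow> ('a::comm_ring_1, 'n::finite) mfps \<Rightarrow> ('a, 'n) mfps" where
  "hpart k f = Abs_mfps (\<lambda>\<beta>. if mdeg \<beta> = k then mcoeff f \<beta> else 0)"

lemma mcoeff_hpart: "mcoeff (hpart k f) \<beta> = (if mdeg \<beta> = k then mcoeff f \<beta> else 0)"
  by (simp add: hpart_def)

lemma hpart_0 [simp]: "hpart k 0 = 0"
  and hpart_add: "hpart k (f + g) = hpart k f + hpart k g"
  and hpart_diff: "hpart k (f - g) = hpart k f - hpart k g"
  and hpart_uminus: "hpart k (- f) = - hpart k f"
  by (rule mfps_eqI, simp add: mcoeff_hpart)+

lemma hpart_scaleR:
  "hpart k (r *\<^sub>R f :: ('a::{comm_ring_1, real_algebra_1}, 'n::finite) mfps) = r *\<^sub>R hpart k f"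
  by (rule mfps_eqI) (simp add: mcoeff_hpart)

lemma hpart_sum: "hpart k (\<Sum>a\<in>A. f a) = (\<Sum>a\<in>A. hpart k (f a))"
  by (induction A rule: infinite_finite_induct) (auto simp: hpart_add)

lemma graded_hpart_self [simp]: "graded mdeg k (hpart k f)"
  by (simp add: graded_def mcoeff_hpart)

lemma graded_hpart: "graded d c f \<Longrightarrow> graded d c (hpart k f)"
  by (auto simp: graded_def mcoeff_hpart)

lemma hpart_graded: "graded mdeg k f \<Longrightarrow> hpart k f = f"
  by (rule mfps_eqI) (auto simp: graded_def mcoeff_hpart)

lemma mcoeff_mult_mvar_if:
  "mcoeff (f * mvar i) \<beta> = (if \<beta> $ i = 0 then 0 else mcoeff f (\<beta> - axis i 1))"
proof (cases "\<beta> $ i = 0")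
  case True
  have "mcoeff f \<gamma> * mcoeff (mvar i) (\<beta> - \<gamma>) = 0" for \<gamma>
  proof -
    have "\<beta> - \<gamma> \<noteq> axis i 1" using True by (auto simp: vec_eq_iff axis_def)
    then show ?thesis by (simp add: mcoeff_mvar)
  qed
  then show ?thesis using True by (simp add: mcoeff_mult)
next
  case False
  then have "\<beta> = (\<beta> - axis i 1) + axis i 1" by (auto simp: vec_eq_iff axis_def)
  then show ?thesis using False mcoeff_mult_mvar [of f i "\<beta> - axis i 1"] by simp
qed

text \<open>Differentiating in one variable and multiplying by another preserves degree.
  Consequently the derivation along a linear field commutes with homogeneous parts.\<close>

lemma hpart_deriv_mvar: "hpart k (mfps_deriv j f * mvar i) = mfps_deriv j (hpart k f) * mvar i"
proof (rule mfps_eqI)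
  fix \<beta> :: "nat ^ 'b"
  show "mcoeff (hpart k (mfps_deriv j f * mvar i)) \<beta> = mcoeff (mfps_deriv j (hpart k f) * mvar i) \<beta>"
  proof (cases "\<beta> $ i = 0")
    case False
    then have "\<beta> = (\<beta> - axis i 1) + axis i 1" by (auto simp: vec_eq_iff axis_def)
    then have "mdeg \<beta> = mdeg ((\<beta> - axis i 1) + axis i 1)" by simp
    then have "mdeg (\<beta> - axis i 1 + axis j 1) = mdeg \<beta>" by simp
    then show ?thesis
      using False by (simp add: mcoeff_hpart mcoeff_mult_mvar_if mcoeff_deriv del: mdeg_add)
  qed (simp add: mcoeff_hpart mcoeff_mult_mvar_if)
qed

lemma hpart_lieD: "hpart k (lieD \<omega>1 \<omega>2 f) = lieD \<omega>1 \<omega>2 (hpart k f)"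
  by (simp add: lieD_def hpart_add hpart_diff hpart_scaleR hpart_deriv_mvar)

section \<open>Parity under the reversing symmetry\<close>

lemma bit_add_cancel: "b + b = 0" "b + 1 + 1 = b" "b + (b + c) = c" for b c :: bit
  by (cases b; cases c; simp)+

text \<open>Counts modulo 2 the variables that \<phi> negates; values in \<open>bit\<close> make it
  an additive grading. A map commuting with \<phi> has parity \<open>parity (axis j 1)\<close> in
  component \<open>j\<close>, a reversible field that parity plus 1.\<close>

definition parity :: "nat ^ 6 \<Rightarrow> bit" where
  "parity \<beta> = of_nat (\<beta> $ 2 + \<beta> $ 4 + \<beta> $ 6)"

lemma parity_0 [simp]: "parity 0 = 0"
  by (simp add: parity_def)

lemma parity_add: "parity (\<alpha> + \<beta>) = parity \<alpha> + parity \<beta>"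
  by (simp only: parity_def vector_add_component of_nat_add add_ac)

lemma parity_axis [simp]:
  "parity (axis 1 1) = 0" "parity (axis 2 1) = 1" "parity (axis 3 1) = 0"
  "parity (axis 4 1) = 1" "parity (axis 5 1) = 0" "parity (axis 6 1) = 1"
  by (simp_all add: parity_def axis_def)

lemmas graded_parity_mult = graded_mult [where d = parity, OF _ _ parity_add]

lemma graded_parity_mvar:
  "graded parity 0 (mvar 1)" "graded parity 1 (mvar 2)" "graded parity 0 (mvar 3)"
  "graded parity 1 (mvar 4)" "graded parity 0 (mvar 5)" "graded parity 1 (mvar 6)"
  by (metis graded_mvar parity_axis)+

lemma graded_parity_deriv:
  assumes "graded parity p f"
  shows "graded parity (p + parity (axis j 1)) (mfps_deriv j f)"
  unfolding graded_def
proof (intro allI impI)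
  fix \<beta> assume "mcoeff (mfps_deriv j f) \<beta> \<noteq> 0"
  then have "mcoeff f (\<beta> + axis j 1) \<noteq> 0" by (auto simp: mcoeff_deriv)
  then have "p = parity \<beta> + parity (axis j 1)"
    using assms by (auto simp: graded_def parity_add)
  then show "parity \<beta> = p + parity (axis j 1)"
    by (simp only: add.assoc bit_add_cancel add_0_right)
qed

text \<open>With \<open>p = 0\<close> this is the rule W(\<phi> x) = conj W(x) of a z-component
  commuting with \<phi>; with \<open>p = 1\<close> it is W(\<phi> x) = - conj W(x), that of a
  reversible field.\<close>

definition revc :: "bit \<Rightarrow> (complex, 6) mfps \<Rightarrow> bool" where
  "revc p W \<longleftrightarrow> graded parity p (mRe W) \<and> graded parity (p + 1) (mIm W)"

lemma revc_0 [simp]: "revc p 0"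
  by (simp add: revc_def)

lemma revc_add: "revc p U \<Longrightarrow> revc p V \<Longrightarrow> revc p (U + V)"
  and revc_uminus: "revc p U \<Longrightarrow> revc p (- U)"
  and revc_scaleR: "revc p U \<Longrightarrow> revc p (r *\<^sub>R U)"
  by (auto simp: revc_def mRe_add mIm_add mRe_diff mIm_diff mRe_uminus mIm_uminus mRe_scaleR mIm_scaleR
      graded_add graded_diff graded_uminus graded_scaleR)

lemma revc_mult:
  assumes "revc p U" "revc q V"
  shows "revc (p + q) (U * V)"
proof -
  have "(p + 1) + (q + 1) = p + q" "p + (q + 1) = p + q + 1" "(p + 1) + q = p + q + 1"
    by (cases p; cases q; simp)+
  with graded_parity_mult [of "p + 1" "mIm U" "q + 1" "mIm V"] graded_parity_mult [of p "mRe U" "q + 1" "mIm V"]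
    graded_parity_mult [of "p + 1" "mIm U" q "mRe V"] graded_parity_mult [of p "mRe U" q "mRe V"] assms
  show ?thesis
    by (simp only: revc_def mRe_mult mIm_mult graded_diff graded_add)
qed

lemma revc_1: "revc 0 1"
  by (simp add: revc_def graded_one)

lemma revc_power: "revc 0 U \<Longrightarrow> revc 0 (U ^ n)"
  using revc_mult [of 0 _ 0] by (induction n) (auto simp: revc_1)

lemma revc_cemb: "graded parity p f \<Longrightarrow> revc p (cemb f)"
  by (simp add: revc_def)

lemma revc_iu: "revc 1 iu"
  by (simp add: revc_def graded_one)

lemma revc_vars: "revc 0 (mvar 1)" "revc 0 iX2" "revc 0 zz1" "revc 0 zb1" "revc 0 zz2" "revc 0 zb2"
  by (simp_all add: graded_parity_mvar revc_def iX2_def zz1_def zb1_def zz2_def zb2_def mRe_add mIm_add mRe_diff mIm_diff graded_uminus)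

lemma revc_revspan:
  assumes "W \<in> revspan" shows "revc 0 W"
proof -
  have "subspace {W. revc 0 W}"
    by (rule subspaceI) (auto intro: revc_add revc_scaleR)
  moreover have "revc 0 (mvar 1 ^ a * iX2 ^ b * zmon c d e f)" for a b c d e f
    using revc_mult [of 0 _ 0] unfolding zmon_def by (simp add: revc_power revc_vars)
  ultimately have "revspan \<subseteq> {W. revc 0 W}"
    unfolding revspan_def by (intro span_minimal) auto
  with assms show ?thesis by auto
qed

text \<open>Closure is extended from generators to their span in one factor at a time.\<close>

lemma revspan_mult:
  assumes "U \<in> revspan" "V \<in> revspan" shows "U * V \<in> revspan"
proof -
  let ?g = "\<lambda>(a, b, c, d, e, f). mvar 1 ^ a * iX2 ^ b * zmon c d e f"
  have gen: "?g s * ?g t \<in> revspan" for s t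
  proof -
    obtain a b c d e f where s: "s = (a, b, c, d, e, f)" by (cases s) auto
    obtain a' b' c' d' e' f' where t: "t = (a', b', c', d', e', f')" by (cases t) auto
    have "?g s * ?g t = mvar 1 ^ (a + a') * iX2 ^ (b + b') * zmon (c + c') (d + d') (e + e') (f + f')"
      by (simp add: s t zmon_def power_add mult_ac)
    then show ?thesis by (simp add: revspan_base)
  qed
  have sub: "subspace {V. W * V \<in> revspan}" for W
    by (rule subspaceI)
      (auto simp: distrib_left subspace_0 [OF subspace_revspan] subspace_add [OF subspace_revspan]
        subspace_scale [OF subspace_revspan])
  have gs: "revspan \<subseteq> {V. ?g s * V \<in> revspan}" for s
    by (subst revspan_def, rule span_minimal [OF image_subsetI sub]) (simp only: mem_Collect_eq gen)
  have "revspan \<subseteq> {U. V * U \<in> revspan}" if V: "V \<in> revspan" for V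
  proof (subst revspan_def, rule span_minimal [OF image_subsetI sub])
    fix s
    have "?g s * V \<in> revspan" using gs [of s] V by blast
    then show "?g s \<in> {U. V * U \<in> revspan}" by (simp only: mem_Collect_eq mult.commute [of V])
  qed
  with assms show ?thesis by (auto simp: mult.commute)
qed

lemma revspan_1: "1 \<in> revspan"
  using revspan_base [of 0 0 0 0 0 0] by (simp add: zmon_def)

lemma revspan_power: "U \<in> revspan \<Longrightarrow> U ^ n \<in> revspan"
  by (induction n) (auto intro: revspan_1 revspan_mult)

lemma revspan_vars: "mvar 1 \<in> revspan" "iX2 \<in> revspan" "mvar 3 \<in> revspan" "iu * mvar 4 \<in> revspan"
  "mvar 5 \<in> revspan" "iu * mvar 6 \<in> revspan"
proof -
  show "mvar 1 \<in> revspan" using revspan_base [of 1 0 0 0 0 0] by (simp add: zmon_def)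
  show "iX2 \<in> revspan" using revspan_base [of 0 1 0 0 0 0] by (simp add: zmon_def)
  have z: "zz1 \<in> revspan" "zb1 \<in> revspan" "zz2 \<in> revspan" "zb2 \<in> revspan"
    using revspan_base [of 0 0 1 0 0 0] revspan_base [of 0 0 0 1 0 0]
      revspan_base [of 0 0 0 0 1 0] revspan_base [of 0 0 0 0 0 1] by (simp_all add: zmon_def)
  have half: "(1 / 2) *\<^sub>R (U + V) \<in> revspan" "(1 / 2) *\<^sub>R (U - V) \<in> revspan" if "U \<in> revspan" "V \<in> revspan" for U V
    using that by (auto intro!: subspace_scale [OF subspace_revspan] subspace_add [OF subspace_revspan] subspace_diff [OF subspace_revspan])
  have "mvar 3 = (1 / 2) *\<^sub>R (zz1 + zb1)" "iu * mvar 4 = (1 / 2) *\<^sub>R (zz1 - zb1)"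
    "mvar 5 = (1 / 2) *\<^sub>R (zz2 + zb2)" "iu * mvar 6 = (1 / 2) *\<^sub>R (zz2 - zb2)"
    by (rule mfps_eqI, simp add: zz1_def zb1_def zz2_def zb2_def scaleR_conv_of_real [where 'a = complex])+
  then show "mvar 3 \<in> revspan" "iu * mvar 4 \<in> revspan" "mvar 5 \<in> revspan" "iu * mvar 6 \<in> revspan"
    using half z by metis+
qed

text \<open>Attaching i to each variable that \<phi> negates, the parity condition says exactly that
  all coefficients become real. Homogeneity makes the sum of monomials finite, as membership in a
  span requires.\<close>

lemma revspan_of_revc:
  assumes rev: "revc 0 W" and hom: "graded mdeg k W"
  shows "W \<in> revspan"
proof -
  let ?n = "\<lambda>\<beta> :: nat ^ 6. \<beta> $ 2 + \<beta> $ 4 + \<beta> $ 6"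
  let ?m = "\<lambda>\<beta>. iu ^ ?n \<beta> * mpow (\<chi> i. mvar i) \<beta>"
  have mono: "?m \<beta> \<in> revspan" for \<beta>
  proof -
    have "?m \<beta> = mvar 1 ^ (\<beta> $ 1) * iX2 ^ (\<beta> $ 2) * mvar 3 ^ (\<beta> $ 3) * (iu * mvar 4) ^ (\<beta> $ 4) *
        mvar 5 ^ (\<beta> $ 5) * (iu * mvar 6) ^ (\<beta> $ 6)"
      by (simp add: prod_6 iX2_def power_add power_mult_distrib mult_ac)
    then show ?thesis by (simp add: revspan_mult revspan_power revspan_vars)
  qed
  have pow: "mcoeff (iu ^ n * f) \<gamma> = \<i> ^ n * mcoeff f \<gamma>" for n \<gamma> and f :: "(complex, 6) mfps"
    by (induction n) (auto simp: mult.assoc)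
  have "\<exists>r. mcoeff W \<beta> = of_real r * \<i> ^ ?n \<beta>" for \<beta>
  proof (cases "even (?n \<beta>)")
    case True
    then obtain m where m: "?n \<beta> = 2 * m" by (elim evenE)
    have "parity \<beta> = 0" unfolding parity_def m by simp
    then have "Im (mcoeff W \<beta>) = 0"
      using rev by (auto simp: revc_def graded_def)
    then have "mcoeff W \<beta> = of_real (Re (mcoeff W \<beta>) * (-1) ^ m) * \<i> ^ ?n \<beta>"
      by (simp add: m power_mult complex_eq_iff flip: power_mult_distrib)
    then show ?thesis by blast
  next
    case False
    then obtain m where m: "?n \<beta> = 2 * m + 1" by (elim oddE)
    have "parity \<beta> = 1" unfolding parity_def m by simp
    then have "Re (mcoeff W \<beta>) = 0"
      using rev by (auto simp: revc_def graded_def)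
    moreover have "\<i> ^ ?n \<beta> = (-1) ^ m * \<i>" by (simp add: m power_mult power_add)
    ultimately have "mcoeff W \<beta> = of_real (Im (mcoeff W \<beta>) * (-1) ^ m) * \<i> ^ ?n \<beta>"
      by (simp add: complex_eq_iff flip: power_mult_distrib)
    then show ?thesis by blast
  qed
  then obtain r where r: "\<And>\<beta>. mcoeff W \<beta> = of_real (r \<beta>) * \<i> ^ ?n \<beta>" by metis
  have "W = (\<Sum>\<beta> | mdeg \<beta> = k. r \<beta> *\<^sub>R ?m \<beta>)"
  proof (rule mfps_eqI)
    fix \<gamma>
    have "mcoeff (\<Sum>\<beta> | mdeg \<beta> = k. r \<beta> *\<^sub>R ?m \<beta>) \<gamma> = (\<Sum>\<beta> | mdeg \<beta> = k. if \<gamma> = \<beta> then mcoeff W \<gamma> else 0)"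
      unfolding mcoeff_sum mcoeff_scaleR pow mpow_mvar mcoeff_Abs_mfps
      by (rule sum.cong) (auto simp: r scaleR_conv_of_real)
    also have "\<dots> = mcoeff W \<gamma>"
      using hom by (subst sum.delta') (auto simp: graded_def)
    finally show "mcoeff W \<gamma> = mcoeff (\<Sum>\<beta> | mdeg \<beta> = k. r \<beta> *\<^sub>R ?m \<beta>) \<gamma>" by simp
  qed
  moreover have "(\<Sum>\<beta> | mdeg \<beta> = k. r \<beta> *\<^sub>R ?m \<beta>) \<in> revspan"
    by (intro subspace_sum [OF subspace_revspan] subspace_scale [OF subspace_revspan] mono)
  ultimately show ?thesis by simp
qed

text \<open>The degree, in the six original variables, of a monomial in the four invariants, whose
  own degrees are 1, 2, 2 and \<open>n1 + n2\<close>.\<close>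

definition nf_weight :: "nat \<Rightarrow> nat \<Rightarrow> nat ^ 4 \<Rightarrow> nat" where
  "nf_weight n1 n2 \<alpha> = (\<Sum>i\<in>UNIV. \<alpha> $ i * (vector [1, 2, 2, n1 + n2] :: nat ^ 4) $ i)"

section \<open>Homogeneity of the invariants and generators\<close>

lemmas graded_mdeg_mult = graded_mult [where d = mdeg, OF _ _ mdeg_add]

lemma graded_mdeg_power: "graded mdeg a f \<Longrightarrow> graded mdeg (n * a) (f ^ n)"
  using graded_power [of mdeg a f n] by simp

lemma graded_cemb: "graded d c f \<Longrightarrow> graded d c (cemb f)"
  and graded_mRe: "graded d c W \<Longrightarrow> graded d c (mRe W)"
  and graded_mIm: "graded d c W \<Longrightarrow> graded d c (mIm W)"
  and graded_iu: "graded d c W \<Longrightarrow> graded d c (iu * W)"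
  by (auto simp: graded_def) (metis zero_complex.simps)+

lemma graded_mdeg_mvar: "graded mdeg 1 (mvar i)"
  using graded_mvar [of mdeg i] by simp

lemma graded_mdeg_vars: "graded mdeg 1 zz1" "graded mdeg 1 zb1" "graded mdeg 1 zz2" "graded mdeg 1 zb2"
  unfolding zz1_def zb1_def zz2_def zb2_def
  by (intro graded_add graded_diff graded_iu graded_mdeg_mvar)+

lemma graded_mdeg_resq: "graded mdeg (n1 + n2) (resq n1 n2)"
  using graded_mdeg_mult [OF graded_mdeg_power [OF graded_mdeg_vars(1)] graded_mdeg_power [OF graded_mdeg_vars(4)], of n2 n1]
  by (simp add: resq_def add.commute)

lemma graded_mdeg_formal_invs: "graded mdeg ((vector [1, 2, 2, n1 + n2] :: nat ^ 4) $ i) (formal_invs n1 n2 $ i)"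
proof -
  have "graded mdeg 2 (mvar i ^ 2 + mvar k ^ 2)" for i k :: 6
    using graded_mdeg_power [OF graded_mdeg_mvar, of 2] by (intro graded_add) auto
  then show ?thesis
    using exhaust_4 [of i] graded_mdeg_mvar graded_mRe [OF graded_mdeg_resq]
    by (auto simp: formal_invs_def)
qed

lemma less_10_cases:
  assumes "i < (10::nat)"
  obtains "i = 0" | "i = 1" | "i = 2" | "i = 3" | "i = 4" | "i = 5" | "i = 6" | "i = 7" | "i = 8" | "i = 9"
proof -
  have "i = 0 \<or> i = 1 \<or> i = 2 \<or> i = 3 \<or> i = 4 \<or> i = 5 \<or> i = 6 \<or> i = 7 \<or> i = 8 \<or> i = 9"
    using assms by presburger
  with that show ?thesis by metis
qed

lemma nf_shift_simps:
  "nf_shift n1 n2 0 = n1 + n2 + 1" "nf_shift n1 n2 1 = 0" "nf_shift n1 n2 2 = 1"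
  "nf_shift n1 n2 3 = n1 + n2 - 1" "nf_shift n1 n2 4 = n1 + n2 + 1" "nf_shift n1 n2 5 = 2 * (n1 + n2) - 1"
  "nf_shift n1 n2 6 = 1" "nf_shift n1 n2 7 = n1 + n2 - 1" "nf_shift n1 n2 8 = n1 + n2 + 1"
  "nf_shift n1 n2 9 = 2 * (n1 + n2) - 1"
  by (simp_all add: nf_shift_def Let_def eval_nat_numeral One_nat_def)

lemma graded_real_coords:
  assumes "graded d c a" "graded d c b" "graded d c W" "graded d c V"
  shows "graded d c (real_coords a b W V $ j)"
  using exhaust_6 [of j] assms by (auto simp: graded_mRe graded_mIm)

lemma revc_real_coords:
  assumes "graded parity p a" "graded parity (p + 1) b" "revc p W" "revc p V"
  shows "graded parity (parity (axis j 1) + p) (real_coords a b W V $ j)"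
  using exhaust_6 [of j] assms by (auto simp: revc_def add.commute simp del: add_bit_eq_xor)

text \<open>The matrix L applied to a vector of series: the second term of the homological
  operator.\<close>

definition linop :: "real \<Rightarrow> real \<Rightarrow> 6 formal_map \<Rightarrow> 6 formal_map" where
  "linop \<omega>1 \<omega>2 \<xi> = vector [\<xi> $ 2, 0, \<omega>1 *\<^sub>R \<xi> $ 4, - (\<omega>1 *\<^sub>R \<xi> $ 3), \<omega>2 *\<^sub>R \<xi> $ 6, - (\<omega>2 *\<^sub>R \<xi> $ 5)]"

context
  fixes n1 n2 :: nat
begin

definition nf_cut :: "nat \<Rightarrow> (nat \<Rightarrow> (real, 4) mfps) \<Rightarrow> nat \<Rightarrow> (real, 4) mfps" where
  "nf_cut k g i = Abs_mfps (\<lambda>\<alpha>. if nf_weight n1 n2 \<alpha> + nf_shift n1 n2 i = k then mcoeff (g i) \<alpha> else 0)"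

context
  assumes n1: "n1 \<noteq> 0" and n2: "n2 \<noteq> 0"
begin

lemma graded_mdeg_nf_gen:
  assumes "i < 10"
  shows "graded mdeg (nf_shift n1 n2 i) (nf_gen n1 n2 i $ j)"
proof -
  let ?v = "zb1 ^ (n2 - 1) * zz2 ^ n1" and ?w = "zz1 ^ n2 * zb2 ^ (n1 - 1)"
  have s: "graded mdeg (n1 + n2) (ress n1 n2)" "graded mdeg (n1 + n2) (cemb (ress n1 n2))"
    using graded_mdeg_resq by (auto intro: graded_cemb graded_mIm)
  have v: "graded mdeg (n1 + n2 - 1) ?v" "graded mdeg (n1 + n2 - 1) ?w"
    using graded_mdeg_mult [OF graded_mdeg_power [OF graded_mdeg_vars(2)] graded_mdeg_power [OF graded_mdeg_vars(3)], of "n2 - 1" n1]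
      graded_mdeg_mult [OF graded_mdeg_power [OF graded_mdeg_vars(1)] graded_mdeg_power [OF graded_mdeg_vars(4)], of n2 "n1 - 1"]
      n1 n2 by (simp_all add: add.commute)
  have "n1 + n2 - 1 + (n1 + n2) = 2 * (n1 + n2) - 1" using n1 by simp
  then have vs: "graded mdeg (2 * (n1 + n2) - 1) (?v * cemb (ress n1 n2))" "graded mdeg (2 * (n1 + n2) - 1) (?w * cemb (ress n1 n2))"
    using graded_mdeg_mult [OF v(1) s(2)] graded_mdeg_mult [OF v(2) s(2)] by (simp_all only:)
  have zs: "graded mdeg (n1 + n2 + 1) (zz1 * cemb (ress n1 n2))" "graded mdeg (n1 + n2 + 1) (zz2 * cemb (ress n1 n2))"
    using graded_mdeg_mult [OF graded_mdeg_vars(1) s(2)] graded_mdeg_mult [OF graded_mdeg_vars(3) s(2)]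
    by (simp_all add: add.commute)
  have xs: "graded mdeg (n1 + n2 + 1) (mvar k * ress n1 n2)" for k
    using graded_mdeg_mult [OF graded_mdeg_mvar s(1), of k] by (simp add: add.commute)
  have 1: "graded mdeg 0 (1 :: (real, 6) mfps)" by (simp add: graded_one)
  from assms show ?thesis
    by (cases rule: less_10_cases; simp only: nf_gen_simps nf_shift_simps)
      (intro graded_real_coords graded_0 xs 1 graded_iu graded_mdeg_vars v vs zs)+
qed

lemma revc_resq: "revc 0 (resq n1 n2)"
  unfolding resq_def using revc_mult [of 0 _ 0] by (simp add: revc_power revc_vars)

lemma graded_parity_invs: "graded parity 0 (formal_invs n1 n2 $ i)"
proof -
  have "graded parity 0 (mvar i ^ 2 + mvar k ^ 2)" for i k :: 6
  proof -
    have "graded parity 0 (mvar i * mvar i)" for i :: 6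
      using graded_parity_mult [OF graded_mvar graded_mvar, of i i] by (simp only: bit_add_cancel)
    then show ?thesis unfolding power2_eq_square by (intro graded_add)
  qed
  then show ?thesis
    using exhaust_4 [of i] graded_parity_mvar(1) revc_resq
    by (auto simp: formal_invs_def revc_def)
qed

lemma graded_parity_compose_invs: "graded parity 0 (mfps_compose f (formal_invs n1 n2))"
  by (rule graded_compose [where a = "\<lambda>_. 0", OF graded_parity_invs parity_0 parity_add]) (simp add: graded_def)

lemma graded_parity_ress: "graded parity 1 (ress n1 n2)"
  using revc_resq by (simp add: revc_def)

lemma graded_parity_nf_gen:
  assumes "i < 10"
  shows "graded parity (parity (axis j 1) + 1) (nf_gen n1 n2 i $ j)"
proof -
  let ?v = "zb1 ^ (n2 - 1) * zz2 ^ n1" and ?w = "zz1 ^ n2 * zb2 ^ (n1 - 1)"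
  have mult0: "revc p U \<Longrightarrow> revc 0 V \<Longrightarrow> revc p (U * V)" for p U V
    using revc_mult [of p U 0 V] by (simp only: add_0_right)
  have mult1: "revc 0 U \<Longrightarrow> revc 1 V \<Longrightarrow> revc 1 (U * V)" for U V
    using revc_mult [of 0 U 1 V] by (simp only: add_0_left)
  have v: "revc 0 ?v" "revc 0 ?w"
    by (intro mult0 revc_power revc_vars)+
  have s: "revc 1 (cemb (ress n1 n2))"
    by (intro revc_cemb graded_parity_ress)
  have xs: "graded parity 1 (mvar 1 * ress n1 n2)" "graded parity (1 + 1) (mvar 2 * ress n1 n2)"
    using graded_parity_mult [OF graded_parity_mvar(1) graded_parity_ress]
      graded_parity_mult [OF graded_parity_mvar(2) graded_parity_ress] by (simp_all only: add_0_left)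
  have 1: "graded parity (1 + 1) (1 :: (real, 6) mfps)"
    by (simp only: bit_add_cancel) (simp add: graded_one)
  from assms show ?thesis
    by (cases rule: less_10_cases; simp only: nf_gen_simps)
      (intro revc_real_coords graded_0 revc_0 xs 1 mult0 [OF revc_iu] mult1 [OF _ s] v revc_vars)+
qed

lemma mcoeff_compose_nf_gen:
  assumes "i < 10"
  shows "mcoeff (mfps_compose f (formal_invs n1 n2) * nf_gen n1 n2 i $ j) \<beta> =
    (\<Sum>\<alpha> | mdeg \<alpha> \<le> mdeg \<beta>. (if nf_weight n1 n2 \<alpha> + nf_shift n1 n2 i = mdeg \<beta> then mcoeff f \<alpha> else 0) *
      mcoeff (mpow (formal_invs n1 n2) \<alpha> * nf_gen n1 n2 i $ j) \<beta>)"
proof -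
  have "graded mdeg (nf_weight n1 n2 \<alpha> + nf_shift n1 n2 i) (mpow (formal_invs n1 n2) \<alpha> * nf_gen n1 n2 i $ j)" for \<alpha>
  proof (rule graded_mdeg_mult [OF _ graded_mdeg_nf_gen [OF assms]])
    show "graded mdeg (nf_weight n1 n2 \<alpha>) (mpow (formal_invs n1 n2) \<alpha>)"
      using graded_mpow [where d = mdeg and a = "\<lambda>i. (vector [1, 2, 2, n1 + n2] :: nat ^ 4) $ i" and G = "formal_invs n1 n2" and \<alpha> = \<alpha>]
        graded_mdeg_formal_invs by (simp add: nf_weight_def)
  qed
  then show ?thesis
    unfolding mcoeff_compose_mult [OF order_ge_formal_invs [OF n1 n2] order_refl]
    by (intro sum.cong) (auto simp: graded_def, metis)
qed

text \<open>Invariants and generators are homogeneous, so degree \<open>k\<close> of the field sees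
  only coefficients of weight plus shift \<open>k\<close>. This permits truncating a solution, and
  later splicing the solutions of all degrees into one family.\<close>

lemma hpart_formal_nf: "hpart k (formal_nf n1 n2 g $ j) = formal_nf n1 n2 (nf_cut k g) $ j"
proof -
  have "hpart k (mfps_compose (g i) (formal_invs n1 n2) * nf_gen n1 n2 i $ j) =
      mfps_compose (nf_cut k g i) (formal_invs n1 n2) * nf_gen n1 n2 i $ j" if "i < 10" for i
    by (rule mfps_eqI) (auto simp: mcoeff_hpart mcoeff_compose_nf_gen [OF that] nf_cut_def intro!: sum.cong sum.neutral)
  then show ?thesis by (simp add: formal_nf_def hpart_sum)
qed

lemma formal_nf_parity: "graded parity (parity (axis j 1) + 1) (formal_nf n1 n2 g $ j)"
  unfolding formal_nf_def vec_lambda_beta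
  using graded_parity_mult [OF graded_parity_compose_invs graded_parity_nf_gen]
  by (intro graded_sum) (simp only: add_0_left lessThan_iff)

subsection \<open>Solution of the homological equation\<close>

context
  fixes \<omega>1 \<omega>2 :: real
  assumes cop: "coprime n1 n2" and om: "\<omega>1 \<noteq> 0" "\<omega>2 \<noteq> 0" and rel: "real n1 * \<omega>2 - real n2 * \<omega>1 = 0"
begin

abbreviation "cinv f \<equiv> mfps_compose f (formal_invs n1 n2)"

lemma cinv_uminus: "cinv (- f) = - cinv f"
  using mfps_compose_diff [of 0 f] by simp

text \<open>Multiplication by -i moves the reversible residual into \<open>revspan\<close>, where
  the first-order result applies. The two \<open>invmod\<close> coefficients then split into the
  four series of the z-equation.\<close>

lemma homological_z:
  assumes W: "revc 1 W" "graded mdeg k W"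
    and res: "\<And>c d e f. freq \<omega>1 \<omega>2 c d e f = \<kappa> \<Longrightarrow> zmon c d e f \<in> eqvmod n1 n2 z v"
  obtains \<xi> a b c d where "revc 0 \<xi>"
    "W + (iu * z * cemb (cinv a) + iu * v * cemb (cinv b)
      + z * cemb (ress n1 n2) * cemb (cinv c) + v * cemb (ress n1 n2) * cemb (cinv d))
      + lieD \<omega>1 \<omega>2 \<xi> + \<kappa> *\<^sub>R (iu * \<xi>) = 0"
proof -
  let ?s = "cemb (ress n1 n2)"
  \<comment> \<open>A factor \<open>iu\<close> exchanges the two parities.\<close>
  have "revc (1 + 1) (iu * W)" by (rule revc_mult [OF revc_iu W(1)])
  then have "revc 0 (- (iu * W))" by (simp only: bit_add_cancel revc_uminus)
  moreover have "graded mdeg k (- (iu * W))" by (intro graded_uminus graded_iu W)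
  ultimately have \<zeta>: "- (iu * W) \<in> revspan" by (rule revspan_of_revc)
  have "mvar 1 ^ a * U \<in> eqvmod n1 n2 z v" if U: "U \<in> eqvmod n1 n2 z v" for a U
  proof -
    obtain A B where AB: "A \<in> invmod n1 n2" "B \<in> invmod n1 n2" and eq: "U = z * A + v * B"
      using U unfolding eqvmod_def by blast
    have "mvar 1 ^ a * U = z * (mvar 1 ^ a * A) + v * (mvar 1 ^ a * B)" by (simp add: eq algebra_simps)
    with AB show ?thesis unfolding eqvmod_def by (blast intro: invmod_x_mult [OF n1 n2])
  qed
  with res have "\<exists>\<xi>\<in>revspan. - (iu * W) - (ilieD \<omega>1 \<omega>2 \<xi> - \<kappa> *\<^sub>R \<xi>) \<in> eqvmod n1 n2 z v"
    by (intro homological_first_order subspace_eqvmod [OF n1 n2] \<zeta>) blast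
  then obtain \<xi> A B where \<xi>: "\<xi> \<in> revspan" and AB: "A \<in> invmod n1 n2" "B \<in> invmod n1 n2"
    and eq: "- (iu * W) - (ilieD \<omega>1 \<omega>2 \<xi> - \<kappa> *\<^sub>R \<xi>) = z * A + v * B"
    unfolding eqvmod_def by blast
  obtain a c where A: "A = cemb (cinv a) + iu * ?s * cemb (cinv c)"
    using AB(1) unfolding invmod_def invalg_def by blast
  obtain b d where B: "B = cemb (cinv b) + iu * ?s * cemb (cinv d)"
    using AB(2) unfolding invmod_def invalg_def by blast
  have "iu * (- (iu * W) - (ilieD \<omega>1 \<omega>2 \<xi> - \<kappa> *\<^sub>R \<xi>)) = W + lieD \<omega>1 \<omega>2 \<xi> + \<kappa> *\<^sub>R (iu * \<xi>)"
    by (simp add: ilieD_def right_diff_distrib)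
  then have "W + lieD \<omega>1 \<omega>2 \<xi> + \<kappa> *\<^sub>R (iu * \<xi>) = iu * (z * A + v * B)"
    unfolding eq by simp
  also have "\<dots> = iu * z * cemb (cinv a) + iu * v * cemb (cinv b)
      - z * ?s * cemb (cinv c) - v * ?s * cemb (cinv d)"
    using iu_iu_mult [of "z * ?s * cemb (cinv c)"] iu_iu_mult [of "v * ?s * cemb (cinv d)"]
    by (simp add: A B algebra_simps)
  \<comment> \<open>Terms with \<open>ress\<close> already changed sign through the product of two
    factors \<open>iu\<close>; moving everything to the left therefore negates only \<open>a\<close>
    and \<open>b\<close>.\<close>
  finally have "W + (iu * z * cemb (cinv (- a)) + iu * v * cemb (cinv (- b))
      + z * ?s * cemb (cinv c) + v * ?s * cemb (cinv d)) + lieD \<omega>1 \<omega>2 \<xi> + \<kappa> *\<^sub>R (iu * \<xi>) = 0"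
    by (simp add: cinv_uminus cemb_uminus algebra_simps)
  with that revc_revspan [OF \<xi>] show ?thesis by blast
qed

lemma lieD_parity: "graded parity p f \<Longrightarrow> graded parity (p + 1) (lieD \<omega>1 \<omega>2 f)"
proof -
  assume f: "graded parity p f"
  have "graded parity (p + 1) (mfps_deriv j f * mvar i)" if "parity (axis j 1) + parity (axis i 1) = 1" for i j
    using graded_parity_mult [OF graded_parity_deriv [OF f] graded_mvar, of j i] that by (simp only: add.assoc)
  then show ?thesis
    unfolding lieD_def by (intro graded_add graded_diff graded_scaleR) simp_all
qed

lemma graded_mdeg_lieD: "graded mdeg k f \<Longrightarrow> graded mdeg k (lieD \<omega>1 \<omega>2 f)"
  by (metis hpart_graded hpart_lieD graded_hpart_self)

text \<open>The frequency of the resonant monomial is n2 \<omega>1 - n1 \<omega>2, zero by the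
  relation between the frequencies: it is a first integral of the linear flow.\<close>

lemma lieD_resonance: "lieD \<omega>1 \<omega>2 (resq n1 n2) = 0"
proof -
  have "ilieD \<omega>1 \<omega>2 (resq n1 n2) = freq \<omega>1 \<omega>2 n2 0 0 n1 *\<^sub>R resq n1 n2"
    using ilieD_zmon [of \<omega>1 \<omega>2 n2 0 0 n1] by (simp add: zmon_def resq_def)
  also have "freq \<omega>1 \<omega>2 n2 0 0 n1 = 0" using rel by (simp add: freq_def mult.commute)
  finally have "iu * (iu * lieD \<omega>1 \<omega>2 (resq n1 n2)) = 0" by (simp add: ilieD_def del: iu_iu_mult)
  then show ?thesis by simp
qed

text \<open>Of the four invariants only the first, \<open>mvar 1\<close>, is not a first integral of
  the linear flow.\<close>

lemma lieD_cinv: "lieD \<omega>1 \<omega>2 (cinv f) = mvar 2 * cinv (mfps_deriv 1 f)"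
proof -
  let ?X = "formal_invs n1 n2"
  have "lieD \<omega>1 \<omega>2 (?X $ i) = (if i = 1 then mvar 2 else 0)" for i
  proof -
    have "lieD \<omega>1 \<omega>2 (resp n1 n2) = 0"
      using lieD_resonance by (simp flip: mRe_lieD)
    moreover have "lieD \<omega>1 \<omega>2 (mvar 3 ^ 2 + mvar 4 ^ 2 :: (real, 6) mfps) = 0"
      "lieD \<omega>1 \<omega>2 (mvar 5 ^ 2 + mvar 6 ^ 2 :: (real, 6) mfps) = 0"
      by (simp_all add: lieD_def power2_eq_square mfps_deriv_add mfps_deriv_mult mfps_deriv_mvar)
    moreover have "lieD \<omega>1 \<omega>2 (mvar 1 :: (real, 6) mfps) = mvar 2"
      by (simp add: lieD_def mfps_deriv_mvar)
    ultimately show ?thesis using exhaust_4 [of i] by (auto simp: formal_invs_def)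
  qed
  moreover have "lieD \<omega>1 \<omega>2 (cinv f) = (\<Sum>i\<in>UNIV. cinv (mfps_deriv i f) * lieD \<omega>1 \<omega>2 (?X $ i))"
    unfolding lieD_def mfps_deriv_compose [OF order_ge_formal_invs [OF n1 n2]]
    by (simp add: sum_4 algebra_simps)
  ultimately show ?thesis by (simp add: sum_4 mult.commute)
qed

text \<open>Eliminating \<open>\<xi>2\<close> leaves an equation in the second power of the
  derivation for \<open>\<xi>1\<close>, with right-hand side \<open>R2 + ?D R1\<close>. Its resonant
  remainder is \<open>cinv a - mvar 2 * ress n1 n2 * cinv d\<close>: the first term goes into
  \<open>f1\<close>, the second into \<open>f0\<close>.\<close>

lemma homological_x:
  assumes R1: "graded parity 1 R1" "graded mdeg k R1" and R2: "graded parity 0 R2" "graded mdeg k R2"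
  obtains \<xi>1 \<xi>2 f0 f1 where "graded parity 0 \<xi>1" "graded parity 1 \<xi>2"
    "R1 + mvar 1 * ress n1 n2 * cinv f0 + lieD \<omega>1 \<omega>2 \<xi>1 - \<xi>2 = 0"
    "R2 + (cinv f1 + mvar 2 * ress n1 n2 * cinv f0) + lieD \<omega>1 \<omega>2 \<xi>2 = 0"
proof -
  let ?s = "ress n1 n2" and ?D = "lieD \<omega>1 \<omega>2"
  define R where "R = R2 + ?D R1"
  have "graded parity (1 + 1) (?D R1)" by (rule lieD_parity [OF R1(1)])
  then have "graded parity 0 (?D R1)" by (simp only: bit_add_cancel)
  then have "graded parity 0 R"
    unfolding R_def by (rule graded_add [OF R2(1)])
  moreover have "graded mdeg k R"
    unfolding R_def by (rule graded_add [OF R2(2) graded_mdeg_lieD [OF R1(2)]])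
  ultimately have "cemb R \<in> revspan"
    by (intro revspan_of_revc [OF revc_cemb graded_cemb])
  moreover have "mvar 1 ^ a * zmon c d e f \<in> eqvmod n1 n2 1 iX2" "mvar 1 ^ a * iX2 * zmon c d e f \<in> eqvmod n1 n2 1 iX2"
    if "freq \<omega>1 \<omega>2 c d e f = 0" for a c d e f
  proof -
    have "mvar 1 ^ a * zmon c d e f \<in> invmod n1 n2"
      by (intro invmod_x_mult [OF n1 n2] resonant_0 [OF n1 n2 cop om rel that])
    from eqvmodI1 [OF n1 n2 this, of 1 iX2] eqvmodI2 [OF n1 n2 this, of iX2 1]
    show "mvar 1 ^ a * zmon c d e f \<in> eqvmod n1 n2 1 iX2" "mvar 1 ^ a * iX2 * zmon c d e f \<in> eqvmod n1 n2 1 iX2"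
      by (simp_all add: mult_ac)
  qed
  ultimately have "\<exists>\<xi>\<in>revspan. cemb R - ilieD \<omega>1 \<omega>2 (ilieD \<omega>1 \<omega>2 \<xi>) \<in> eqvmod n1 n2 1 iX2"
    by (intro homological_second_order subspace_eqvmod [OF n1 n2])
  then obtain \<xi> A B where \<xi>: "\<xi> \<in> revspan" and AB: "A \<in> invmod n1 n2" "B \<in> invmod n1 n2"
    and eq: "cemb R + ?D (?D \<xi>) = A + iX2 * B"
    unfolding eqvmod_def by (auto simp: ilieD_ilieD)
  obtain a c where A: "A = cemb (cinv a) + iu * cemb ?s * cemb (cinv c)"
    using AB(1) unfolding invmod_def invalg_def by blast
  obtain b d where B: "B = cemb (cinv b) + iu * cemb ?s * cemb (cinv d)"
    using AB(2) unfolding invmod_def invalg_def by blast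
  define \<xi>1 where "\<xi>1 = mRe \<xi>"
  \<comment> \<open>Taking real parts discards \<open>b\<close> and \<open>c\<close>, whose terms
    are purely imaginary; in the term of \<open>d\<close> the two factors \<open>iu\<close> multiply
    to -1.\<close>
  have "mRe (cemb R + ?D (?D \<xi>)) = mRe (A + iX2 * B)" by (simp only: eq)
  then have re: "R + ?D (?D \<xi>1) = cinv a - mvar 2 * ?s * cinv d"
    by (simp add: mRe_add mIm_add mRe_mult mIm_mult mRe_lieD \<xi>1_def A B iX2_def)
  \<comment> \<open>\<open>f0\<close> contributes once directly in the second component and once
    through the derivative of its term in the first, giving 2 f0 + x1 df0/dx1. This operator
    multiplies the coefficient at \<alpha> by \<open>\<alpha> $ 1 + 2\<close>, which is never
    0.\<close>
  define f0 where "f0 = Abs_mfps (\<lambda>\<alpha>. mcoeff d \<alpha> / (real (\<alpha> $ 1) + 2))"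
  have f0: "2 *\<^sub>R f0 + mfps_deriv 1 f0 * mvar 1 = d"
  proof (rule mfps_eqI)
    fix \<alpha>
    have "mcoeff (mfps_deriv 1 f0 * mvar 1) \<alpha> = real (\<alpha> $ 1) * mcoeff f0 \<alpha>"
    proof (cases "\<alpha> $ 1 = 0")
      case False
      then have "\<alpha> - axis 1 1 + axis 1 1 = \<alpha>" by (auto simp: vec_eq_iff axis_def)
      with False show ?thesis by (simp add: mcoeff_mult_mvar_if mcoeff_deriv)
    qed (simp add: mcoeff_mult_mvar_if)
    moreover have "2 * (x / (real n + 2)) + real n * (x / (real n + 2)) = x" for x n
    proof -
      have "real n + 2 \<noteq> 0" by linarith
      then have "(real n + 2) * (x / (real n + 2)) = x" by simp
      then show ?thesis by (simp only: distrib_right add.commute)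
    qed
    ultimately show "mcoeff (2 *\<^sub>R f0 + mfps_deriv 1 f0 * mvar 1) \<alpha> = mcoeff d \<alpha>"
      by (simp add: f0_def)
  qed
  have X1: "cinv (mvar 1) = mvar 1"
    using mfps_compose_mvar [OF order_ge_formal_invs [OF n1 n2], of 1] by (simp add: formal_invs_def)
  have "cinv d = 2 *\<^sub>R cinv f0 + cinv (mfps_deriv 1 f0) * mvar 1"
    by (subst f0 [symmetric])
      (simp only: mfps_compose_add mfps_compose_scaleR mfps_compose_mult [OF order_ge_formal_invs [OF n1 n2]] X1)
  moreover have "?D (mvar 1 * ?s * cinv f0) = mvar 2 * ?s * cinv f0 + mvar 1 * ?s * (mvar 2 * cinv (mfps_deriv 1 f0))"
  proof -
    have "?D ?s = 0" using lieD_resonance by (simp flip: mIm_lieD)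
    moreover have "?D (mvar 1 :: (real, 6) mfps) = mvar 2" by (simp add: lieD_def mfps_deriv_mvar)
    ultimately show ?thesis by (simp add: lieD_mult lieD_cinv)
  qed
  ultimately have key: "?D (mvar 1 * ?s * cinv f0) + mvar 2 * ?s * cinv f0 = mvar 2 * ?s * cinv d"
    by (simp add: algebra_simps scaleR_2)
  \<comment> \<open>Forced by the first equation, which contains \<open>\<xi>2\<close>
    undifferentiated.\<close>
  define \<xi>2 where "\<xi>2 = R1 + mvar 1 * ?s * cinv f0 + ?D \<xi>1"
  have "graded parity 0 \<xi>1" using revc_revspan [OF \<xi>] by (simp add: revc_def \<xi>1_def)
  moreover have "graded parity 1 \<xi>2"
  proof -
    have "graded parity 1 (mvar 1 * ?s * cinv f0)"
      using graded_parity_mult [OF graded_parity_mult [OF graded_parity_mvar(1) graded_parity_ress] graded_parity_compose_invs]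
      by (simp only: add_0_left add_0_right)
    moreover have "graded parity 1 (?D \<xi>1)"
      using lieD_parity [OF \<open>graded parity 0 \<xi>1\<close>] by (simp only: add_0_left)
    ultimately show ?thesis unfolding \<xi>2_def by (intro graded_add R1)
  qed
  moreover have "R1 + mvar 1 * ?s * cinv f0 + ?D \<xi>1 - \<xi>2 = 0" by (simp add: \<xi>2_def)
  moreover have "R2 + (cinv (- a) + mvar 2 * ?s * cinv f0) + ?D \<xi>2 = 0"
  proof -
    have "R2 + (cinv (- a) + mvar 2 * ?s * cinv f0) + ?D \<xi>2 =
        (R + ?D (?D \<xi>1)) - cinv a + (?D (mvar 1 * ?s * cinv f0) + mvar 2 * ?s * cinv f0)"
      by (simp add: \<xi>2_def R_def lieD_add cinv_uminus)
    also have "\<dots> = 0" by (simp only: re key) simp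
    finally show ?thesis .
  qed
  ultimately show ?thesis using that by blast
qed

text \<open>The support condition on \<open>g\<close> is exported because the coefficient series of
  different degrees must be combined later without overlap.\<close>

theorem homological_equation:
  assumes hom: "\<And>j. graded mdeg k (R $ j)" and par: "\<And>j. graded parity (parity (axis j 1) + 1) (R $ j)"
  obtains \<xi> g where "\<And>j. graded mdeg k (\<xi> $ j)" "\<And>j. graded parity (parity (axis j 1)) (\<xi> $ j)"
    "\<And>i \<alpha>. mcoeff (g i) \<alpha> \<noteq> 0 \<Longrightarrow> nf_weight n1 n2 \<alpha> + nf_shift n1 n2 i = k"
    "\<And>j. R $ j + formal_nf n1 n2 g $ j + lieD \<omega>1 \<omega>2 (\<xi> $ j) - linop \<omega>1 \<omega>2 \<xi> $ j = 0"
    "\<And>j. graded mdeg k (formal_nf n1 n2 g $ j)"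
proof -
  let ?W1 = "cemb (R $ 3) + iu * cemb (R $ 4)" and ?W2 = "cemb (R $ 5) + iu * cemb (R $ 6)"
  have p: "graded parity 1 (R $ 1)" "graded parity 0 (R $ 2)" "graded parity 1 (R $ 3)" "graded parity 0 (R $ 4)"
    "graded parity 1 (R $ 5)" "graded parity 0 (R $ 6)"
    using par [of 1] par [of 2] par [of 3] par [of 4] par [of 5] par [of 6] by simp_all
  have W: "revc 1 ?W1" "graded mdeg k ?W1" "revc 1 ?W2" "graded mdeg k ?W2"
    using p hom by (auto simp: revc_def mRe_add mIm_add intro!: graded_add graded_cemb graded_iu)
  obtain \<Xi>1 a b c d where \<Xi>1: "revc 0 \<Xi>1"
    "?W1 + (iu * zz1 * cemb (cinv a) + iu * (zb1 ^ (n2 - 1) * zz2 ^ n1) * cemb (cinv b)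
      + zz1 * cemb (ress n1 n2) * cemb (cinv c) + zb1 ^ (n2 - 1) * zz2 ^ n1 * cemb (ress n1 n2) * cemb (cinv d))
      + lieD \<omega>1 \<omega>2 \<Xi>1 + \<omega>1 *\<^sub>R (iu * \<Xi>1) = 0"
    using homological_z [OF W(1,2) resonant_1 [OF n1 n2 cop om rel]] by metis
  obtain \<Xi>2 a' b' c' d' where \<Xi>2: "revc 0 \<Xi>2"
    "?W2 + (iu * zz2 * cemb (cinv a') + iu * (zz1 ^ n2 * zb2 ^ (n1 - 1)) * cemb (cinv b')
      + zz2 * cemb (ress n1 n2) * cemb (cinv c') + zz1 ^ n2 * zb2 ^ (n1 - 1) * cemb (ress n1 n2) * cemb (cinv d'))
      + lieD \<omega>1 \<omega>2 \<Xi>2 + \<omega>2 *\<^sub>R (iu * \<Xi>2) = 0"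
    using homological_z [OF W(3,4) resonant_2 [OF n1 n2 cop om rel]] by metis
  obtain \<xi>1 \<xi>2 f0 f1 where x: "graded parity 0 \<xi>1" "graded parity 1 \<xi>2"
    "R $ 1 + mvar 1 * ress n1 n2 * cinv f0 + lieD \<omega>1 \<omega>2 \<xi>1 - \<xi>2 = 0"
    "R $ 2 + (cinv f1 + mvar 2 * ress n1 n2 * cinv f0) + lieD \<omega>1 \<omega>2 \<xi>2 = 0"
    using homological_x [OF p(1) hom p(2) hom] by metis
  define g where "g i = [f0, f1, a, b, c, d, a', b', c', d'] ! i" for i
  have g: "g 0 = f0" "g 1 = f1" "g 2 = a" "g 3 = b" "g 4 = c" "g 5 = d" "g 6 = a'" "g 7 = b'" "g 8 = c'" "g 9 = d'"
    by (simp_all add: g_def eval_nat_numeral One_nat_def)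
  define \<xi> where "\<xi> = real_coords \<xi>1 \<xi>2 \<Xi>1 \<Xi>2"
  have z: "mRe (W + N + lieD \<omega>1 \<omega>2 \<Xi> + \<omega> *\<^sub>R (iu * \<Xi>)) = mRe W + mRe N + lieD \<omega>1 \<omega>2 (mRe \<Xi>) - \<omega> *\<^sub>R mIm \<Xi>"
    "mIm (W + N + lieD \<omega>1 \<omega>2 \<Xi> + \<omega> *\<^sub>R (iu * \<Xi>)) = mIm W + mIm N + lieD \<omega>1 \<omega>2 (mIm \<Xi>) + \<omega> *\<^sub>R mRe \<Xi>" for W N \<Xi> \<omega>
    by (simp_all add: mRe_add mIm_add mRe_scaleR mIm_scaleR mRe_lieD mIm_lieD)
  have w: "mRe ?W1 = R $ 3" "mIm ?W1 = R $ 4" "mRe ?W2 = R $ 5" "mIm ?W2 = R $ 6"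
    by (simp_all add: mRe_add mIm_add)
  have full: "R $ j + formal_nf n1 n2 g $ j + lieD \<omega>1 \<omega>2 (\<xi> $ j) - linop \<omega>1 \<omega>2 \<xi> $ j = 0" for j
  proof -
    have "\<forall>j. R $ j + formal_nf n1 n2 g $ j + lieD \<omega>1 \<omega>2 (\<xi> $ j) - linop \<omega>1 \<omega>2 \<xi> $ j = 0"
      unfolding forall_6 formal_nf_eq \<xi>_def linop_def real_coords_nth vector_6 g
      using x(3,4) arg_cong [OF \<Xi>1(2), of mRe] arg_cong [OF \<Xi>1(2), of mIm]
        arg_cong [OF \<Xi>2(2), of mRe] arg_cong [OF \<Xi>2(2), of mIm]
      unfolding z w mRe_0 mIm_0 by simp
    then show ?thesis by blast
  qed
  have "graded parity (parity (axis j 1) + 0) (\<xi> $ j)" for j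
    unfolding \<xi>_def by (rule revc_real_coords) (use x \<Xi>1 \<Xi>2 in \<open>simp_all only: add_0_left\<close>)
  then have par_\<xi>: "graded parity (parity (axis j 1)) (\<xi> $ j)" for j by (simp only: add_0_right)
  have lin: "hpart k (linop \<omega>1 \<omega>2 \<xi> $ j) = linop \<omega>1 \<omega>2 (\<chi> j. hpart k (\<xi> $ j)) $ j" for j
    using exhaust_6 [of j] by (auto simp: linop_def hpart_scaleR hpart_uminus)
  show ?thesis
  \<comment> \<open>The solution found so far may have parts of other degrees. As \<open>R\<close>
    is homogeneous and all operators respect the grading, the parts of degree \<open>k\<close> alone
    solve the equation.\<close>
  proof (rule that [of "\<chi> j. hpart k (\<xi> $ j)" "nf_cut k g"])
    fix j
    show "graded mdeg k ((\<chi> j. hpart k (\<xi> $ j)) $ j)" by simp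
    show "graded parity (parity (axis j 1)) ((\<chi> j. hpart k (\<xi> $ j)) $ j)"
      by (simp add: graded_hpart par_\<xi>)
    show "graded mdeg k (formal_nf n1 n2 (nf_cut k g) $ j)"
      by (metis hpart_formal_nf graded_hpart_self)
    have "hpart k (R $ j + formal_nf n1 n2 g $ j + lieD \<omega>1 \<omega>2 (\<xi> $ j) - linop \<omega>1 \<omega>2 \<xi> $ j) = 0"
      by (simp only: full hpart_0)
    then show "R $ j + formal_nf n1 n2 (nf_cut k g) $ j + lieD \<omega>1 \<omega>2 ((\<chi> j. hpart k (\<xi> $ j)) $ j)
        - linop \<omega>1 \<omega>2 (\<chi> j. hpart k (\<xi> $ j)) $ j = 0"
      by (simp only: hpart_add hpart_diff hpart_formal_nf hpart_lieD lin hpart_graded [OF hom] vec_lambda_beta)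
  next
    fix i \<alpha> assume "mcoeff (nf_cut k g i) \<alpha> \<noteq> 0"
    then show "nf_weight n1 n2 \<alpha> + nf_shift n1 n2 i = k"
      by (auto simp: nf_cut_def split: if_splits)
  qed
qed

end

end

end


section \<open>The system and the changes of coordinates\<close>

definition phi_sign :: "6 \<Rightarrow> real" where
  "phi_sign j = (if parity (axis j 1) = 0 then 1 else - 1)"

lemma phi_nth: "\<phi> x $ j = phi_sign j * x $ j"
  using exhaust_6 [of j] by (auto simp: \<phi>_def phi_sign_def z1_def z2_def)

lemma prod_phi_sign: "(\<Prod>i\<in>UNIV. phi_sign i ^ (\<alpha> $ i)) = (if parity \<alpha> = 0 then 1 else - 1)"
proof -
  let ?n = "\<alpha> $ 2 + \<alpha> $ 4 + \<alpha> $ 6"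
  have "(\<Prod>i\<in>UNIV. phi_sign i ^ (\<alpha> $ i)) = (- 1) ^ ?n"
    by (simp add: prod_6 phi_sign_def power_add)
  moreover have "parity \<alpha> = 0 \<longleftrightarrow> even ?n"
  proof (cases "even ?n")
    case True
    then obtain m where "?n = 2 * m" by (elim evenE)
    with True show ?thesis by (simp add: parity_def)
  next
    case False
    then obtain m where "?n = 2 * m + 1" by (elim oddE)
    with False show ?thesis by (simp add: parity_def)
  qed
  ultimately show ?thesis by simp
qed

text \<open>Substituting the diagonal map \<phi> multiplies the coefficient at \<alpha> by the sign
  given by \<open>parity \<alpha>\<close>; comparison with the factor \<open>c\<close> gives the
  relation.\<close>

lemma taylor_reversible:
  assumes f: "smooth f" and rev: "\<And>x. f (\<phi> x) = c * f x"
  shows "mcoeff (taylor f) \<alpha> * (if parity \<alpha> = 0 then 1 else - 1) = c * mcoeff (taylor f) \<alpha>"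
proof -
  have lin: "smooth (\<lambda>x. \<phi> x $ j)" "taylor (\<lambda>x. \<phi> x $ j) = phi_sign j *\<^sub>R mvar j" for j
    by (auto simp: phi_nth taylor_cmult taylor_coord)
  let ?G = "\<chi> j. phi_sign j *\<^sub>R (mvar j :: (real, 6) mfps)"
  have G: "order_ge 1 (?G $ j)" for j
  proof -
    have "order_ge 1 (mvar j :: (real, 6) mfps)" by (rule order_ge_mvar)
    then show ?thesis by (simp add: order_ge_def)
  qed
  have "\<phi> 0 = 0" by (simp add: vec_eq_iff phi_nth)
  from taylor_compose [OF f lin(1) this]
  have eq: "mfps_compose (taylor f) ?G = c *\<^sub>R taylor f"
    using f by (simp add: lin(2) rev taylor_cmult)
  have "mpow ?G \<beta> = (\<Prod>i\<in>UNIV. phi_sign i ^ (\<beta> $ i)) *\<^sub>R mpow (\<chi> i. mvar i) \<beta>" for \<beta>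
    by (simp add: prod.distrib scaleR_conv_of_real power_mult_distrib)
  then have mpow: "mpow ?G \<beta> = (if parity \<beta> = 0 then 1 else - 1) *\<^sub>R mpow (\<chi> i. mvar i) \<beta>" for \<beta>
    by (simp only: prod_phi_sign)
  have "mcoeff (mfps_compose (taylor f) ?G) \<alpha> =
      (\<Sum>\<beta> | mdeg \<beta> \<le> mdeg \<alpha>. if \<alpha> = \<beta> then mcoeff (taylor f) \<alpha> * (if parity \<alpha> = 0 then 1 else - 1) else 0)"
    unfolding mcoeff_compose [OF G order_refl] mpow mcoeff_scaleR mpow_mvar mcoeff_Abs_mfps
    by (rule sum.cong) auto
  also have "\<dots> = mcoeff (taylor f) \<alpha> * (if parity \<alpha> = 0 then 1 else - 1)"
    by (subst sum.delta') auto
  finally show ?thesis by (simp only: eq mcoeff_scaleR real_scaleR_def)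
qed

lemma taylor_system:
  assumes h: "smooth h" "h 0 = 0" "(h has_derivative (\<lambda>_. 0)) (at 0)"
    and rev: "reversible_equivariant \<phi> (\<lambda>x. Lmat \<omega>1 \<omega>2 *v x + h x)"
  defines "F \<equiv> taylor_map (\<lambda>x. Lmat \<omega>1 \<omega>2 *v x + h x)"
  shows "order_ge 2 (F $ j - formal_lin \<omega>1 \<omega>2 $ j)" "graded parity (parity (axis j 1) + 1) (F $ j)"
proof -
  have hj: "smooth (\<lambda>x. h x $ j)" by (rule smooth_component [OF h(1)])
  have L: "(Lmat \<omega>1 \<omega>2 *v x) $ 1 = x $ 2" "(Lmat \<omega>1 \<omega>2 *v x) $ 2 = 0"
    "(Lmat \<omega>1 \<omega>2 *v x) $ 3 = \<omega>1 * x $ 4" "(Lmat \<omega>1 \<omega>2 *v x) $ 4 = - \<omega>1 * x $ 3"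
    "(Lmat \<omega>1 \<omega>2 *v x) $ 5 = \<omega>2 * x $ 6" "(Lmat \<omega>1 \<omega>2 *v x) $ 6 = - \<omega>2 * x $ 5" for x
    by (simp_all add: matrix_vector_mult_def sum_6 Lmat_def)
  have "\<forall>j. smooth (\<lambda>x. (Lmat \<omega>1 \<omega>2 *v x) $ j) \<and> taylor (\<lambda>x. (Lmat \<omega>1 \<omega>2 *v x) $ j) = formal_lin \<omega>1 \<omega>2 $ j"
    unfolding forall_6 L
    by (auto simp: formal_lin_def taylor_coord taylor_cmult taylor_uminus smooth_mult zz1_def zz2_def
        mRe_add mIm_add mRe_diff mIm_diff mRe_uminus mIm_uminus mRe_scaleR mIm_scaleR)
  then have lin: "smooth (\<lambda>x. (Lmat \<omega>1 \<omega>2 *v x) $ j)" "taylor (\<lambda>x. (Lmat \<omega>1 \<omega>2 *v x) $ j) = formal_lin \<omega>1 \<omega>2 $ j" for j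
    by auto
  have Fj: "smooth (\<lambda>x. (Lmat \<omega>1 \<omega>2 *v x + h x) $ j)" "F $ j = formal_lin \<omega>1 \<omega>2 $ j + taylor (\<lambda>x. h x $ j)"
    using lin hj by (simp_all add: F_def taylor_map_def taylor_add smooth_add)
  have "((\<lambda>x. h x $ j) has_derivative (\<lambda>_. 0)) (at 0)"
    using bounded_linear.has_derivative [OF bounded_linear_vec_nth h(3), of j] by simp
  from partial_deriv_eq [OF this] have "partial_deriv i (\<lambda>x. h x $ j) 0 = 0" for i .
  then have "order_ge 2 (taylor (\<lambda>x. h x $ j))"
    unfolding order_ge_2_iff by (simp add: mcoeff_taylor_axis [OF hj] h(2))
  then show "order_ge 2 (F $ j - formal_lin \<omega>1 \<omega>2 $ j)" by (simp add: Fj)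
  \<comment> \<open>Since \<phi> is diagonal, reversibility is a sign rule for each component
    separately.\<close>
  let ?f = "\<lambda>x. (Lmat \<omega>1 \<omega>2 *v x + h x) $ j"
  have "?f (\<phi> x) = - phi_sign j * ?f x" for x
  proof -
    have "Lmat \<omega>1 \<omega>2 *v \<phi> x + h (\<phi> x) = - \<phi> (Lmat \<omega>1 \<omega>2 *v x + h x)"
      using rev unfolding reversible_equivariant_def by blast
    then show ?thesis by (simp only: phi_nth vector_uminus_component minus_mult_left)
  qed
  note taylor_reversible [OF Fj(1), of "- phi_sign j", OF this]
  moreover have "taylor ?f = F $ j" by (simp add: F_def taylor_map_def)
  ultimately have *: "mcoeff (F $ j) \<alpha> * (if parity \<alpha> = 0 then 1 else - 1) = - phi_sign j * mcoeff (F $ j) \<alpha>" for \<alpha>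
    by simp
  show "graded parity (parity (axis j 1) + 1) (F $ j)"
    unfolding graded_def
  proof (intro allI impI)
    fix \<alpha> assume nz: "mcoeff (F $ j) \<alpha> \<noteq> 0"
    have "(if parity \<alpha> = 0 then 1 else - 1) * mcoeff (F $ j) \<alpha> = - phi_sign j * mcoeff (F $ j) \<alpha>"
      using * [of \<alpha>] by (simp only: mult.commute)
    then have "(if parity \<alpha> = 0 then 1 else - 1) = - phi_sign j"
      by (simp only: mult_right_cancel [OF nz])
    then show "parity \<alpha> = parity (axis j 1) + 1"
      by (cases "parity \<alpha>"; cases "parity (axis j 1)") (auto simp: phi_sign_def)
  qed
qed

text \<open>\<open>formally_conjugate\<close> asks for genuine polynomial maps commuting with
  \<phi>. Homogeneity makes the series a polynomial, and its parity becomes equivariance.\<close>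

lemma homogeneous_change:
  fixes \<Xi> :: "6 formal_map"
  assumes hom: "\<And>j. graded mdeg k (\<Xi> $ j)" and par: "\<And>j. graded parity (parity (axis j 1)) (\<Xi> $ j)"
  obtains p where "homogeneous_polymap k p" "\<And>x. p (\<phi> x) = \<phi> (p x)"
    "taylor_map (\<lambda>x. x + p x) = (\<chi> j. mvar j + \<Xi> $ j)"
proof -
  define c where "c \<alpha> = (\<chi> j. mcoeff (\<Xi> $ j) \<alpha>)" for \<alpha>
  define p where "p x = (\<Sum>\<alpha> | mdeg \<alpha> = k. (\<Prod>i\<in>UNIV. x $ i ^ (\<alpha> $ i)) *\<^sub>R c \<alpha>)" for x :: "real ^ 6"
  have pj: "p x $ j = (\<Sum>\<alpha> | mdeg \<alpha> = k. mcoeff (\<Xi> $ j) \<alpha> * (\<Prod>i\<in>UNIV. x $ i ^ (\<alpha> $ i)))" for x j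
    by (simp add: p_def c_def mult.commute)
  show ?thesis
  proof
    show "homogeneous_polymap k p"
      unfolding homogeneous_polymap_def p_def by blast
    show "p (\<phi> x) = \<phi> (p x)" for x
    proof -
      have key: "mcoeff (\<Xi> $ j) \<alpha> * (\<Prod>i\<in>UNIV. (phi_sign i * x $ i) ^ (\<alpha> $ i)) =
          phi_sign j * (mcoeff (\<Xi> $ j) \<alpha> * (\<Prod>i\<in>UNIV. x $ i ^ (\<alpha> $ i)))" for j \<alpha>
      proof (cases "mcoeff (\<Xi> $ j) \<alpha> = 0")
        case False
        then have "parity \<alpha> = parity (axis j 1)" using par by (auto simp: graded_def)
        then have "(\<Prod>i\<in>UNIV. phi_sign i ^ (\<alpha> $ i)) = phi_sign j" unfolding prod_phi_sign by (simp add: phi_sign_def)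
        then show ?thesis by (simp add: power_mult_distrib prod.distrib)
      qed simp
      show ?thesis
        by (simp only: vec_eq_iff phi_nth pj sum_distrib_left key) simp
    qed
    have mono: "smooth (\<lambda>x :: real ^ 6. \<Prod>i\<in>UNIV. x $ i ^ (\<alpha> $ i))"
      "taylor (\<lambda>x :: real ^ 6. \<Prod>i\<in>UNIV. x $ i ^ (\<alpha> $ i)) = mpow (\<chi> i. mvar i) \<alpha>" for \<alpha>
      by (auto simp: taylor_prod taylor_power taylor_coord smooth_power)
    have s: "smooth (\<lambda>x :: real ^ 6. mcoeff (\<Xi> $ j) \<alpha> * (\<Prod>i\<in>UNIV. x $ i ^ (\<alpha> $ i)))" for j \<alpha>
      by (rule smooth_mult [OF smooth_const mono(1)])
    have "taylor (\<lambda>x. p x $ j) = \<Xi> $ j" for j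
    proof -
      have "taylor (\<lambda>x. p x $ j) = (\<Sum>\<alpha> | mdeg \<alpha> = k. mcoeff (\<Xi> $ j) \<alpha> *\<^sub>R mpow (\<chi> i. mvar i) \<alpha>)"
        unfolding pj taylor_sum [OF s] taylor_cmult [OF mono(1)] mono(2) ..
      also have "\<dots> = \<Xi> $ j"
      proof (rule mfps_eqI)
        fix \<beta>
        have "mcoeff (\<Sum>\<alpha> | mdeg \<alpha> = k. mcoeff (\<Xi> $ j) \<alpha> *\<^sub>R mpow (\<chi> i. mvar i) \<alpha>) \<beta> =
            (\<Sum>\<alpha> | mdeg \<alpha> = k. if \<beta> = \<alpha> then mcoeff (\<Xi> $ j) \<alpha> else 0)"
          unfolding mcoeff_sum mcoeff_scaleR mpow_mvar mcoeff_Abs_mfps by (rule sum.cong) auto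
        also have "\<dots> = mcoeff (\<Xi> $ j) \<beta>"
          using hom [of j] by (subst sum.delta') (auto simp: graded_def)
        finally show "mcoeff (\<Sum>\<alpha> | mdeg \<alpha> = k. mcoeff (\<Xi> $ j) \<alpha> *\<^sub>R mpow (\<chi> i. mvar i) \<alpha>) \<beta> = mcoeff (\<Xi> $ j) \<beta>" .
      qed
      finally show ?thesis .
    qed
    moreover have "smooth (\<lambda>x. p x $ j)" for j
      unfolding pj by (rule smooth_sum [OF s])
    ultimately show "taylor_map (\<lambda>x. x + p x) = (\<chi> j. mvar j + \<Xi> $ j)"
      by (simp add: vec_eq_iff taylor_map_def taylor_add taylor_coord)
  qed
qed

section \<open>Normalisation degree by degree\<close>

lemma mfps_compose_id: "mfps_compose f (\<chi> i. mvar i) = f"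
proof (rule mfps_eqI)
  fix \<beta> :: "nat ^ 'b"
  have "mcoeff (mfps_compose f (\<chi> i. mvar i)) \<beta> = (\<Sum>\<alpha> | mdeg \<alpha> \<le> mdeg \<beta>. if \<beta> = \<alpha> then mcoeff f \<alpha> else 0)"
    unfolding mfps_compose_def mcoeff_Abs_mfps mpow_mvar by (rule sum.cong) auto
  then show "mcoeff (mfps_compose f (\<chi> i. mvar i)) \<beta> = mcoeff f \<beta>"
    by (subst (asm) sum.delta') auto
qed

text \<open>Each variable is replaced by a series of its own parity, so every monomial keeps its
  parity.\<close>

lemma graded_parity_compose:
  assumes "graded parity p f" and G: "\<And>j. graded parity (parity (axis j 1)) (G $ j)"
  shows "graded parity p (mfps_compose f G)"
proof (rule graded_compose [where a = "\<lambda>j. parity (axis j 1)", OF G parity_0 parity_add])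
  have "(\<Sum>i\<in>UNIV. of_nat (\<alpha> $ i) * parity (axis i 1)) = parity \<alpha>" for \<alpha> :: "nat ^ 6"
    unfolding sum_6 parity_axis by (simp only: parity_def of_nat_add mult_1_right mult_zero_right add_0_left add_0_right)
  then show "graded (\<lambda>\<alpha>. \<Sum>i\<in>UNIV. of_nat (\<alpha> $ i) * parity (axis i 1)) p f"
    using assms(1) by (simp only: graded_def)
qed

lemma linop_compose:
  assumes G: "\<And>i. order_ge 1 (G $ i)"
  shows "mfps_compose (formal_lin \<omega>1 \<omega>2 $ j) G = linop \<omega>1 \<omega>2 G $ j"
proof -
  have u: "mfps_compose (- f) G = - mfps_compose f G" for f
    using mfps_compose_diff [of 0 f] by simp
  have "\<forall>j. mfps_compose (formal_lin \<omega>1 \<omega>2 $ j) G = linop \<omega>1 \<omega>2 G $ j"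
    unfolding forall_6 formal_lin_def linop_def real_coords_nth vector_6
    by (simp add: mRe_uminus mIm_uminus mRe_scaleR mIm_scaleR zz1_def zz2_def mRe_add mIm_add
        mRe_diff mIm_diff u mfps_compose_scaleR mfps_compose_mvar [OF G])
  then show ?thesis by blast
qed

lemma linop_add: "linop \<omega>1 \<omega>2 (G + H) $ j = linop \<omega>1 \<omega>2 G $ j + linop \<omega>1 \<omega>2 H $ j"
  using exhaust_6 [of j] by (auto simp: linop_def algebra_simps)

lemma order_ge_linop: "(\<And>i. order_ge k (G $ i)) \<Longrightarrow> order_ge k (linop \<omega>1 \<omega>2 G $ j)"
  using exhaust_6 [of j] by (auto simp: linop_def order_ge_def)

lemma order_ge_lin: "order_ge 1 (formal_lin \<omega>1 \<omega>2 $ j)"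
  using linop_compose [of "\<chi> i. mvar i" \<omega>1 \<omega>2 j] order_ge_linop [of 1 "\<chi> i. mvar i" \<omega>1 \<omega>2 j]
  by (simp add: mfps_compose_id order_ge_mvar)

lemma lieD_formal_lin: "(\<Sum>l\<in>UNIV. mfps_deriv l f * formal_lin \<omega>1 \<omega>2 $ l) = lieD \<omega>1 \<omega>2 f"
  by (simp add: sum_6 formal_lin_def lieD_def zz1_def zz2_def mRe_add mIm_add mRe_diff mIm_diff mRe_uminus mIm_uminus
      mRe_scaleR mIm_scaleR algebra_simps)

lemma order_ge_from_diff:
  "order_ge k (f - g) \<Longrightarrow> order_ge l g \<Longrightarrow> m \<le> k \<Longrightarrow> m \<le> l \<Longrightarrow> order_ge m f"
  by (auto simp: order_ge_def)

lemma graded_order_ge: "graded mdeg k f \<Longrightarrow> order_ge k f"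
  by (auto simp: graded_def order_ge_def)

lemma order_ge_diff_hpart: "order_ge k f \<Longrightarrow> order_ge (Suc k) (f - hpart k f)"
  by (auto simp: order_ge_def mcoeff_hpart)

lemma order_ge_deriv': "order_ge k f \<Longrightarrow> order_ge (k - 1) (mfps_deriv j f)"
  by (cases k) (auto intro: order_ge_deriv)

lemma sum_delta_mult: "(\<Sum>l\<in>UNIV. mfps_deriv l (mvar j) * f l) = f j"
proof -
  have "(\<Sum>l\<in>UNIV. mfps_deriv l (mvar j) * f l) = (\<Sum>l\<in>UNIV. if j = l then f l else 0)"
    by (rule sum.cong) (auto simp: mfps_deriv_mvar)
  then show ?thesis by simp
qed

text \<open>The defect of the conjugacy equation; its order of vanishing measures the degree through
  which \<Phi> conjugates \<open>F\<close> to \<open>Y\<close>.\<close>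

definition residual :: "6 formal_map \<Rightarrow> 6 formal_map \<Rightarrow> 6 formal_map \<Rightarrow> 6 formal_map" where
  "residual F \<Phi> Y = formal_jacobian_apply \<Phi> Y - formal_comp F \<Phi>"

lemma residual_nth:
  "residual F \<Phi> Y $ j = (\<Sum>l\<in>UNIV. mfps_deriv l (\<Phi> $ j) * Y $ l) - mfps_compose (F $ j) \<Phi>"
  by (simp add: residual_def formal_jacobian_apply_def formal_comp_def)

context
  fixes \<omega>1 \<omega>2 :: real and F :: "6 formal_map"
  assumes F: "\<And>j. order_ge 2 (F $ j - formal_lin \<omega>1 \<omega>2 $ j)"
begin

text \<open>Modulo order \<open>k + 1\<close> the residual changes by \<eta> + (D\<xi>) L - L \<xi>.
  Every other term gains a degree, because \<Phi> minus the identity and the nonlinear parts of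
  \<open>Y\<close> and \<open>F\<close> have order 2. Composition on the right matches
  \<open>formal_changes\<close>.\<close>

lemma residual_step:
  assumes k: "k \<ge> 2"
    and \<Phi>: "\<And>j. order_ge 2 (\<Phi> $ j - mvar j)" and Y: "\<And>j. order_ge 2 (Y $ j - formal_lin \<omega>1 \<omega>2 $ j)"
    and \<xi>: "\<And>j. order_ge k (\<xi> $ j)" and \<eta>: "\<And>j. order_ge k (\<eta> $ j)"
    and \<Phi>': "\<Phi>' = formal_comp \<Phi> (\<chi> j. mvar j + \<xi> $ j)"
  shows "order_ge (Suc k) (\<Phi>' $ j - \<Phi> $ j - \<xi> $ j)"
    and "order_ge (Suc k) (residual F \<Phi>' (Y + \<eta>) $ j -
      (residual F \<Phi> Y $ j + \<eta> $ j + lieD \<omega>1 \<omega>2 (\<xi> $ j) - linop \<omega>1 \<omega>2 \<xi> $ j))"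
proof -
  let ?id = "\<chi> j. (mvar j :: (real, 6) mfps)" and ?G = "\<chi> j. mvar j + \<xi> $ j"
  have id: "order_ge 1 (?id $ j)" for j by (simp add: order_ge_mvar)
  have G: "order_ge 1 (?G $ j)" for j
    using order_ge_add [OF order_ge_mvar order_ge_mono [OF \<xi>]] k by simp
  have Gid: "order_ge (Suc (k - 1)) (?G $ j - ?id $ j)" for j
    using \<xi> k by simp
  have change: "order_ge (Suc k) (\<Phi>' $ j - \<Phi> $ j - \<xi> $ j)" for j
  proof -
    have "\<Phi>' $ j = mfps_compose (\<Phi> $ j - mvar j) ?G + mfps_compose (mvar j) ?G"
      by (simp add: \<Phi>' formal_comp_def flip: mfps_compose_add)
    then have "\<Phi>' $ j - \<Phi> $ j - \<xi> $ j = mfps_compose (\<Phi> $ j - mvar j) ?G - mfps_compose (\<Phi> $ j - mvar j) ?id"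
      by (simp add: mfps_compose_mvar [OF G] mfps_compose_id)
    \<comment> \<open>The inner perturbation has order \<open>k = Suc (k - 1)\<close> and the outer
      series order 2, and \<open>(k - 1) + 2 = k + 1\<close>.\<close>
    also have "order_ge (Suc k) \<dots>"
      by (rule order_ge_compose_perturb [OF id G Gid \<Phi>]) (use k in simp)
    finally show ?thesis .
  qed
  then show "order_ge (Suc k) (\<Phi>' $ j - \<Phi> $ j - \<xi> $ j)" .
  define \<rho> where "\<rho> = \<Phi>' - \<Phi> - \<xi>"
  have \<rho>: "order_ge (Suc k) (\<rho> $ j)" for j using change by (simp add: \<rho>_def)
  have \<Phi>'_eq: "\<Phi>' = \<Phi> + \<xi> + \<rho>" by (simp add: \<rho>_def)
  have \<Phi>1: "order_ge 1 (\<Phi> $ j)" for j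
    by (rule order_ge_from_diff [OF \<Phi> order_ge_mvar]) auto
  have diff: "order_ge k (\<Phi>' $ j - \<Phi> $ j)" for j
    by (rule order_ge_from_diff [OF change \<xi>]) auto
  have \<Phi>'1: "order_ge 1 (\<Phi>' $ j)" for j
    by (rule order_ge_from_diff [OF diff \<Phi>1]) (use k in auto)
  have linop_\<Phi>': "linop \<omega>1 \<omega>2 \<Phi>' $ j = linop \<omega>1 \<omega>2 \<Phi> $ j + linop \<omega>1 \<omega>2 \<xi> $ j + linop \<omega>1 \<omega>2 \<rho> $ j"
    by (simp only: \<Phi>'_eq linop_add)
  let ?N = "F $ j - formal_lin \<omega>1 \<omega>2 $ j"
  have "mfps_compose (F $ j) \<Phi>' - mfps_compose (F $ j) \<Phi> - linop \<omega>1 \<omega>2 \<xi> $ j =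
      (mfps_compose ?N \<Phi>' - mfps_compose ?N \<Phi>) + linop \<omega>1 \<omega>2 \<rho> $ j"
    by (simp add: mfps_compose_diff linop_compose [OF \<Phi>1] linop_compose [OF \<Phi>'1] linop_\<Phi>')
  moreover have "order_ge (Suc k) (mfps_compose ?N \<Phi>' - mfps_compose ?N \<Phi>)"
    by (rule order_ge_compose_perturb [OF \<Phi>1 \<Phi>'1 _ F, of "k - 1"]) (use diff k in auto)
  ultimately have comp: "order_ge (Suc k) (mfps_compose (F $ j) \<Phi>' - mfps_compose (F $ j) \<Phi> - linop \<omega>1 \<omega>2 \<xi> $ j)"
    by (simp only: order_ge_add order_ge_linop [OF \<rho>])
  have "order_ge 1 (Y $ l)" for l
    by (rule order_ge_from_diff [OF Y order_ge_lin]) auto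
  then have Y1: "order_ge 1 (Y $ l + \<eta> $ l)" for l
    using order_ge_mono [OF \<eta>] k by (intro order_ge_add) auto
  \<comment> \<open>Cross terms of the expanded Jacobian product, with orders at least 1 + k, (k -
    1) + 2, (k - 1) + k and k + 1; the third reaches k + 1 because k is at least 2.\<close>
  define T where "T l = mfps_deriv l (\<Phi> $ j - mvar j) * \<eta> $ l + mfps_deriv l (\<xi> $ j) * (Y $ l - formal_lin \<omega>1 \<omega>2 $ l)
    + mfps_deriv l (\<xi> $ j) * \<eta> $ l + mfps_deriv l (\<rho> $ j) * (Y $ l + \<eta> $ l)" for l
  have T: "order_ge (Suc k) (T l)" for l
    unfolding T_def
    by (intro order_ge_add order_ge_mult' [OF order_ge_deriv' [OF \<Phi>] \<eta>] order_ge_mult' [OF order_ge_deriv' [OF \<xi>] Y]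
        order_ge_mult' [OF order_ge_deriv' [OF \<xi>] \<eta>] order_ge_mult' [OF order_ge_deriv' [OF \<rho>] Y1]) (use k in auto)
  have "mfps_deriv l (\<Phi>' $ j) * (Y + \<eta>) $ l = mfps_deriv l (\<Phi> $ j) * Y $ l + mfps_deriv l (mvar j) * \<eta> $ l
      + mfps_deriv l (\<xi> $ j) * formal_lin \<omega>1 \<omega>2 $ l + T l" for l
    by (simp add: \<Phi>'_eq T_def mfps_deriv_add mfps_deriv_diff algebra_simps)
  then have "(\<Sum>l\<in>UNIV. mfps_deriv l (\<Phi>' $ j) * (Y + \<eta>) $ l) =
      (\<Sum>l\<in>UNIV. mfps_deriv l (\<Phi> $ j) * Y $ l) + \<eta> $ j + lieD \<omega>1 \<omega>2 (\<xi> $ j) + (\<Sum>l\<in>UNIV. T l)"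
    by (simp only: sum.distrib sum_delta_mult lieD_formal_lin)
  then have "residual F \<Phi>' (Y + \<eta>) $ j -
      (residual F \<Phi> Y $ j + \<eta> $ j + lieD \<omega>1 \<omega>2 (\<xi> $ j) - linop \<omega>1 \<omega>2 \<xi> $ j) =
      (\<Sum>l\<in>UNIV. T l) - (mfps_compose (F $ j) \<Phi>' - mfps_compose (F $ j) \<Phi> - linop \<omega>1 \<omega>2 \<xi> $ j)"
    by (simp add: residual_nth)
  then show "order_ge (Suc k) (residual F \<Phi>' (Y + \<eta>) $ j -
      (residual F \<Phi> Y $ j + \<eta> $ j + lieD \<omega>1 \<omega>2 (\<xi> $ j) - linop \<omega>1 \<omega>2 \<xi> $ j))"
    by (simp only: order_ge_diff [OF order_ge_sum [OF T] comp])
qed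

text \<open>Changing \<Phi> and \<open>Y\<close> from order \<open>m + 2\<close> on cannot affect
  the residual below that order: the order lost by differentiating \<Phi> is recovered from the
  factor \<open>Y'\<close>, which has no constant term. This carries the finite stages over to the
  limit.\<close>

lemma residual_limit:
  assumes \<Phi>: "\<And>j. order_ge 2 (\<Phi> $ j - mvar j)" and Y: "\<And>j. order_ge 2 (Y $ j - formal_lin \<omega>1 \<omega>2 $ j)"
    and d\<Phi>: "\<And>j. order_ge (Suc (Suc m)) (\<Phi>' $ j - \<Phi> $ j)" and dY: "\<And>j. order_ge (Suc (Suc m)) (Y' $ j - Y $ j)"
    and res: "order_ge (Suc (Suc m)) (residual F \<Phi> Y $ j)"
  shows "order_ge (Suc (Suc m)) (residual F \<Phi>' Y' $ j)"
proof -
  have \<Phi>1: "order_ge 1 (\<Phi> $ j)" for j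
    by (rule order_ge_from_diff [OF \<Phi> order_ge_mvar]) auto
  have \<Phi>'1: "order_ge 1 (\<Phi>' $ j)" for j
    by (rule order_ge_from_diff [OF d\<Phi> \<Phi>1]) auto
  have Y1: "order_ge 1 (Y $ j)" for j
    by (rule order_ge_from_diff [OF Y order_ge_lin]) auto
  have Y'1: "order_ge 1 (Y' $ j)" for j
    by (rule order_ge_from_diff [OF dY Y1]) auto
  have F1: "order_ge 1 (F $ j)"
    by (rule order_ge_from_diff [OF F order_ge_lin]) auto
  have eq: "residual F \<Phi>' Y' $ j = residual F \<Phi> Y $ j
      + (\<Sum>l\<in>UNIV. mfps_deriv l (\<Phi>' $ j - \<Phi> $ j) * Y' $ l + mfps_deriv l (\<Phi> $ j) * (Y' $ l - Y $ l))
      - (mfps_compose (F $ j) \<Phi>' - mfps_compose (F $ j) \<Phi>)"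
    by (simp add: residual_nth mfps_deriv_diff sum.distrib sum_subtractf algebra_simps)
  show ?thesis
    unfolding eq
    by (intro order_ge_add order_ge_diff res order_ge_sum order_ge_mult' [OF order_ge_deriv [OF d\<Phi>] Y'1]
        order_ge_mult' [OF order_ge_0 dY] order_ge_compose_perturb [OF \<Phi>1 \<Phi>'1 d\<Phi> F1]) auto
qed

lemma residual_parity:
  assumes F': "\<And>j. graded parity (parity (axis j 1) + 1) (F $ j)"
    and \<Phi>: "\<And>j. graded parity (parity (axis j 1)) (\<Phi> $ j)" and Y: "\<And>j. graded parity (parity (axis j 1) + 1) (Y $ j)"
  shows "graded parity (parity (axis j 1) + 1) (residual F \<Phi> Y $ j)"
proof -
  have "graded parity (parity (axis j 1) + 1) (mfps_deriv l (\<Phi> $ j) * Y $ l)" for l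
    using graded_parity_mult [OF graded_parity_deriv [OF \<Phi>] Y, of j l l]
    by (simp only: add.assoc bit_add_cancel)
  then show ?thesis
    unfolding residual_nth by (intro graded_diff graded_sum graded_parity_compose [OF F' \<Phi>])
qed

end

section \<open>Limits of coefficientwise stabilising sequences\<close>

lemma order_ge_sequence:
  assumes "\<And>m. order_ge (Suc (Suc m)) (a (Suc m) - a m)" "m \<le> n"
  shows "order_ge (Suc (Suc m)) (a n - a m)"
  using assms(2)
proof (induction n rule: dec_induct)
  case (step n)
  then have "order_ge (Suc (Suc m)) (a (Suc n) - a n)" using assms(1) order_ge_mono by (metis Suc_le_mono)
  from order_ge_add [OF this step.IH] show ?case by simp
qed simp

text \<open>A diagonal choice: stage \<open>m\<close> is final through degree \<open>m + 1\<close>,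
  so a coefficient of degree d may be read off at stage d.\<close>

lemma order_ge_sequence_limit:
  assumes "\<And>m. order_ge (Suc (Suc m)) (a (Suc m) - a m)"
  defines "l \<equiv> Abs_mfps (\<lambda>\<beta>. mcoeff (a (mdeg \<beta>)) \<beta>)"
  shows "order_ge (Suc (Suc m)) (l - a m)"
  unfolding order_ge_def
proof (intro allI impI)
  fix \<beta> :: "nat ^ 'b" assume \<beta>: "mdeg \<beta> < Suc (Suc m)"
  show "mcoeff (l - a m) \<beta> = 0"
  proof (cases "mdeg \<beta> \<le> m")
    case True
    from order_ge_sequence [OF assms(1) this] show ?thesis
      by (simp add: order_ge_def l_def)
  next
    case False
    then have "mdeg \<beta> = Suc m" using \<beta> by simp
    with assms(1) [of m] show ?thesis by (simp add: order_ge_def l_def)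
  qed
qed

lemma formal_lin_parity: "graded parity (parity (axis j 1) + 1) (formal_lin \<omega>1 \<omega>2 $ j)"
proof -
  have "revc (1 + 0) (iu * zz1)" "revc (1 + 0) (iu * zz2)"
    by (intro revc_mult revc_iu revc_vars)+
  then have "revc 1 (- (\<omega>1 *\<^sub>R (iu * zz1)))" "revc 1 (- (\<omega>2 *\<^sub>R (iu * zz2)))"
    by (auto intro: revc_uminus revc_scaleR simp del: add_bit_eq_xor)
  then show ?thesis
    unfolding formal_lin_def by (intro revc_real_coords graded_parity_mvar graded_0)
qed

lemma formal_nf_0 [simp]: "formal_nf n1 n2 (\<lambda>i. 0) $ j = 0"
  by (simp add: formal_nf_def)

theorem theorem5p1:
  fixes n1 n2 :: nat and \<omega>1 \<omega>2 :: real and h :: "real ^ 6 \<Rightarrow> real ^ 6"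
  assumes "n1 \<noteq> 0" and "n2 \<noteq> 0" and "coprime n1 n2"
    and "\<omega>1 \<noteq> 0" and "\<omega>2 \<noteq> 0"
    and "real n1 * \<omega>2 - real n2 * \<omega>1 = 0"
    and "smooth h" and "h 0 = 0" and "(h has_derivative (\<lambda>_. 0)) (at 0)"
    and "reversible_equivariant \<phi> (\<lambda>x. Lmat \<omega>1 \<omega>2 *v x + h x)"
  shows "\<exists>f :: nat \<Rightarrow> real ^ 4 \<Rightarrow> real. (\<forall>i\<le>9. smooth (f i)) \<and>
    formally_conjugate \<phi> (\<lambda>x. Lmat \<omega>1 \<omega>2 *v x + h x) (normal_form n1 n2 \<omega>1 \<omega>2 f)"
proof -
  note n = assms(1,2) and hyps = assms(1-6)
  let ?lin = "formal_lin \<omega>1 \<omega>2"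
  let ?id = "\<chi> j. (mvar j :: (real, 6) mfps)"
  define F where "F = taylor_map (\<lambda>x. Lmat \<omega>1 \<omega>2 *v x + h x)"
  have F: "order_ge 2 (F $ j - ?lin $ j)" "graded parity (parity (axis j 1) + 1) (F $ j)" for j
    unfolding F_def by (rule taylor_system [OF assms(7-10)])+
  \<comment> \<open>The state after \<open>m\<close> changes is a pair of accumulated change and
    current field, conjugate through degree \<open>m + 1\<close>. The first conjunct pins the
    initial state, which dependent choice would otherwise leave open.\<close>
  define P where "P m s \<longleftrightarrow> (m = 0 \<longrightarrow> s = (?id, ?lin)) \<and>
    (\<forall>j. order_ge 2 (fst s $ j - mvar j)) \<and> (\<forall>j. graded parity (parity (axis j 1)) (fst s $ j)) \<and>
    (\<forall>j. order_ge 2 (snd s $ j - ?lin $ j)) \<and> (\<forall>j. graded parity (parity (axis j 1) + 1) (snd s $ j)) \<and>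
    (\<forall>j. order_ge (Suc (Suc m)) (residual F (fst s) (snd s) $ j))" for m :: nat and s
  define step where "step m p s s' \<longleftrightarrow> homogeneous_polymap (m + 2) p \<and> (\<forall>x. p (\<phi> x) = \<phi> (p x)) \<and>
    (\<forall>j. order_ge (Suc (Suc m)) (fst s' $ j - fst s $ j)) \<and>
    fst s' = formal_comp (fst s) (taylor_map (\<lambda>x. x + p x))" for m and p :: "real ^ 6 \<Rightarrow> real ^ 6" and s s' :: "6 formal_map \<times> 6 formal_map"
  \<comment> \<open>Step \<open>m\<close> uses only coefficients of weight plus shift
    \<open>m + 2\<close>, so distinct steps have disjoint supports.\<close>
  define incr where "incr m g s s' \<longleftrightarrow>
    (\<forall>i \<alpha>. mcoeff (g i) \<alpha> \<noteq> 0 \<longrightarrow> nf_weight n1 n2 \<alpha> + nf_shift n1 n2 i = m + 2) \<and>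
    (\<forall>j. graded mdeg (m + 2) (formal_nf n1 n2 g $ j)) \<and> snd s' = snd s + formal_nf n1 n2 g"
    for m g and s s' :: "6 formal_map \<times> 6 formal_map"
  have "\<exists>S. \<forall>m. P m (S m) \<and> ((\<exists>p. step m p (S m) (S (Suc m))) \<and> (\<exists>g. incr m g (S m) (S (Suc m))))"
  proof (rule dependent_nat_choice)
    have "order_ge 2 (residual F ?id ?lin $ j)" for j
      using order_ge_uminus [OF F(1) [of j]]
      by (simp add: residual_nth sum_delta_mult mfps_compose_id)
    then have "P 0 (?id, ?lin)"
      unfolding P_def by (simp add: formal_lin_parity graded_mvar numeral_2_eq_2 del: add_bit_eq_xor)
    then show "\<exists>s. P 0 s" ..
  next
    fix s m assume "P m s"
    moreover obtain \<Phi> Y where s: "s = (\<Phi>, Y)" by (cases s)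
    ultimately have \<Phi>: "order_ge 2 (\<Phi> $ j - mvar j)" "graded parity (parity (axis j 1)) (\<Phi> $ j)"
      and Y: "order_ge 2 (Y $ j - ?lin $ j)" "graded parity (parity (axis j 1) + 1) (Y $ j)"
      and res: "order_ge (Suc (Suc m)) (residual F \<Phi> Y $ j)" for j
      unfolding P_def by auto
    define R where "R = (\<chi> j. hpart (m + 2) (residual F \<Phi> Y $ j))"
    have R: "graded mdeg (m + 2) (R $ j)" "graded parity (parity (axis j 1) + 1) (R $ j)" for j
      unfolding R_def vec_lambda_beta
      by (rule graded_hpart_self, rule graded_hpart [OF residual_parity [OF F(1) F(2) \<Phi>(2) Y(2)]])
    obtain \<xi> g where \<xi>: "\<And>j. graded mdeg (m + 2) (\<xi> $ j)" "\<And>j. graded parity (parity (axis j 1)) (\<xi> $ j)"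
      and g1: "\<And>i \<alpha>. mcoeff (g i) \<alpha> \<noteq> 0 \<Longrightarrow> nf_weight n1 n2 \<alpha> + nf_shift n1 n2 i = m + 2"
      and eq: "\<And>j. R $ j + formal_nf n1 n2 g $ j + lieD \<omega>1 \<omega>2 (\<xi> $ j) - linop \<omega>1 \<omega>2 \<xi> $ j = 0"
      and g2: "\<And>j. graded mdeg (m + 2) (formal_nf n1 n2 g $ j)"
    proof (rule homological_equation [OF hyps R], goal_cases)
      case (1 \<xi> g)
      show ?case by (rule 1(1) [of \<xi> g]) (fact 1)+
    qed
    obtain p where p: "homogeneous_polymap (m + 2) p" "\<And>x. p (\<phi> x) = \<phi> (p x)"
      "taylor_map (\<lambda>x. x + p x) = (\<chi> j. mvar j + \<xi> $ j)"
    proof (rule homogeneous_change [OF \<xi>], goal_cases)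
      case (1 p)
      show ?case by (rule 1(1) [of p]) (fact 1)+
    qed
    let ?\<Phi> = "formal_comp \<Phi> (\<chi> j. mvar j + \<xi> $ j)" and ?Y = "Y + formal_nf n1 n2 g"
    have ord: "order_ge (m + 2) (\<xi> $ j)" "order_ge (m + 2) (formal_nf n1 n2 g $ j)" for j
      by (rule graded_order_ge, rule \<xi> g2)+
    note new = residual_step [OF F(1) _ \<Phi>(1) Y(1) ord refl, simplified]
    have d\<Phi>: "order_ge (Suc (Suc m)) (?\<Phi> $ j - \<Phi> $ j)" for j
      by (rule order_ge_from_diff [OF new(1) ord(1)]) auto
    have "order_ge 2 (?\<Phi> $ j - mvar j)" for j
      by (rule order_ge_from_diff [where k = "Suc (Suc m)", OF _ \<Phi>(1) [of j]]) (use d\<Phi> in auto)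
    moreover have "graded parity (parity (axis j 1)) (?\<Phi> $ j)" for j
      unfolding formal_comp_def vec_lambda_beta
      by (rule graded_parity_compose [OF \<Phi>(2)]) (simp add: graded_add graded_mvar \<xi>)
    moreover have "order_ge 2 (?Y $ j - ?lin $ j)" for j
      by (rule order_ge_from_diff [where k = "m + 2", OF _ Y(1) [of j]]) (use ord(2) in auto)
    moreover have "graded parity (parity (axis j 1) + 1) (?Y $ j)" for j
      using graded_add [OF Y(2) formal_nf_parity [OF n]] by simp
    moreover have "order_ge (Suc (Suc (Suc m))) (residual F ?\<Phi> ?Y $ j)" for j
    proof -
      \<comment> \<open>The homological equation for \<open>R\<close> cancels precisely the lowest
        degree, \<open>m + 2\<close>, of the old residual.\<close>
      have "residual F \<Phi> Y $ j + formal_nf n1 n2 g $ j + lieD \<omega>1 \<omega>2 (\<xi> $ j) - linop \<omega>1 \<omega>2 \<xi> $ j =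
          residual F \<Phi> Y $ j - hpart (Suc (Suc m)) (residual F \<Phi> Y $ j)"
        using eq [of j] by (simp add: R_def algebra_simps)
      then have "order_ge (Suc (Suc (Suc m))) (residual F ?\<Phi> ?Y $ j -
          (residual F \<Phi> Y $ j - hpart (Suc (Suc m)) (residual F \<Phi> Y $ j)))"
        using new(2) [of j] by (simp only:)
      from order_ge_from_diff [OF this order_ge_diff_hpart [OF res] order_refl order_refl] show ?thesis .
    qed
    ultimately have "P (Suc m) (?\<Phi>, ?Y)"
      unfolding P_def by simp
    moreover have "step m p s (?\<Phi>, ?Y)"
      unfolding step_def using p d\<Phi> by (simp add: s)
    moreover have "incr m g s (?\<Phi>, ?Y)"
      unfolding incr_def using g1 g2 by (simp add: s)
    ultimately show "\<exists>s'. P (Suc m) s' \<and> ((\<exists>p. step m p s s') \<and> (\<exists>g. incr m g s s'))" by blast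
  qed
  then obtain S p g where S: "\<And>m. P m (S m)" and p: "\<And>m. step m (p m) (S m) (S (Suc m))"
    and g: "\<And>m. incr m (g m) (S m) (S (Suc m))" by metis
  define \<Phi> where "\<Phi> = (\<chi> j. Abs_mfps (\<lambda>\<beta>. mcoeff (fst (S (mdeg \<beta>)) $ j) \<beta>))"
  \<comment> \<open>Each coefficient is taken from the single step responsible for its degree.
    Degrees 0 and 1 get 0, since the constant and linear parts of the field are already
    normal.\<close>
  define G where "G i = Abs_mfps (\<lambda>\<alpha>. let k = nf_weight n1 n2 \<alpha> + nf_shift n1 n2 i in
      if k < 2 then 0 else mcoeff (g (k - 2) i) \<alpha>)" for i
  define \<xi> where "\<xi> k = p (k - 2)" for k
  have dS: "order_ge (Suc (Suc m)) (fst (S (Suc m)) $ j - fst (S m) $ j)" for m j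
    using p [of m] unfolding step_def by blast
  have changes: "formal_changes \<xi> m = fst (S m)" for m
  proof (induction m)
    case 0
    show ?case using S [of 0] by (simp add: P_def)
  next
    case (Suc m)
    then show ?case using p [of m] by (simp add: step_def \<xi>_def)
  qed
  have d\<Phi>: "order_ge (Suc (Suc m)) (\<Phi> $ j - fst (S m) $ j)" for m j
    unfolding \<Phi>_def vec_lambda_beta by (rule order_ge_sequence_limit [where a = "\<lambda>m. fst (S m) $ j", OF dS])
  have "is_infinite_composition \<xi> \<Phi>"
    unfolding is_infinite_composition_def
  proof (intro allI)
    fix i \<beta>
    show "\<forall>\<^sub>F m in sequentially. mcoeff (formal_changes \<xi> m $ i) \<beta> = mcoeff (\<Phi> $ i) \<beta>"
      using eventually_ge_at_top [of "mdeg \<beta>"]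
    proof eventually_elim
      case (elim m)
      then show ?case using d\<Phi> [of m i] by (simp add: order_ge_def changes)
    qed
  qed
  moreover have "homogeneous_polymap k (\<xi> k) \<and> (\<forall>x. \<xi> k (\<phi> x) = \<phi> (\<xi> k x))" if "k \<ge> 2" for k
  proof -
    have "k - 2 + 2 = k" using that by simp
    then show ?thesis using p [of "k - 2"] unfolding step_def \<xi>_def by metis
  qed
  moreover have "residual F \<Phi> (?lin + formal_nf n1 n2 G) = 0"
  proof -
    \<comment> \<open>By disjointness of supports, cutting \<open>G\<close> to degree
      \<open>k\<close> recovers exactly the series chosen in step \<open>k - 2\<close>.\<close>
    have cut: "nf_cut n1 n2 k G = (if k < 2 then (\<lambda>i. 0) else g (k - 2))" for k
    proof
      fix i
      show "nf_cut n1 n2 k G i = (if k < 2 then (\<lambda>i. 0) else g (k - 2)) i"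
      proof (rule mfps_eqI)
        fix \<alpha>
        have "mcoeff (g (k - 2) i) \<alpha> = 0" if "\<not> k < 2" "nf_weight n1 n2 \<alpha> + nf_shift n1 n2 i \<noteq> k"
          using g [of "k - 2"] that unfolding incr_def by (metis le_add_diff_inverse2 not_less)
        then show "mcoeff (nf_cut n1 n2 k G i) \<alpha> = mcoeff ((if k < 2 then (\<lambda>i. 0) else g (k - 2)) i) \<alpha>"
          by (auto simp: nf_cut_def G_def)
      qed
    qed
    have Y: "snd (S m) $ j = ?lin $ j + (\<Sum>l<m. formal_nf n1 n2 (g l) $ j)" for m j
    proof (induction m)
      case 0
      show ?case using S [of 0] by (simp add: P_def)
    next
      case (Suc m)
      then show ?case using g [of m] by (simp add: incr_def)
    qed
    \<comment> \<open>A fixed degree below \<open>m + 2\<close> is touched by at most one of the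
      first \<open>m\<close> increments, namely number \<open>mdeg \<beta> - 2\<close>.\<close>
    have dY: "order_ge (Suc (Suc m)) ((?lin + formal_nf n1 n2 G) $ j - snd (S m) $ j)" for m j
      unfolding order_ge_def
    proof (intro allI impI)
      fix \<beta> :: "nat ^ 6" assume \<beta>: "mdeg \<beta> < Suc (Suc m)"
      have g\<beta>: "mcoeff (formal_nf n1 n2 (g l) $ j) \<beta> = 0" if "l + 2 \<noteq> mdeg \<beta>" for l
        using g [of l] that unfolding incr_def graded_def by metis
      have "mcoeff (formal_nf n1 n2 G $ j) \<beta> = mcoeff (hpart (mdeg \<beta>) (formal_nf n1 n2 G $ j)) \<beta>"
        by (simp add: mcoeff_hpart)
      also have "\<dots> = (if mdeg \<beta> < 2 then 0 else mcoeff (formal_nf n1 n2 (g (mdeg \<beta> - 2)) $ j) \<beta>)"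
        by (simp add: hpart_formal_nf [OF n] cut)
      also have "\<dots> = (\<Sum>l<m. mcoeff (formal_nf n1 n2 (g l) $ j) \<beta>)"
      proof (cases "mdeg \<beta> < 2")
        case True
        then show ?thesis using g\<beta> by simp
      next
        case False
        then have "(\<Sum>l<m. mcoeff (formal_nf n1 n2 (g l) $ j) \<beta>) =
            (\<Sum>l<m. if l = mdeg \<beta> - 2 then mcoeff (formal_nf n1 n2 (g (mdeg \<beta> - 2)) $ j) \<beta> else 0)"
          by (intro sum.cong) (auto intro: g\<beta>)
        also have "\<dots> = mcoeff (formal_nf n1 n2 (g (mdeg \<beta> - 2)) $ j) \<beta>"
          using False \<beta> by (subst sum.delta) auto
        finally show ?thesis using False by simp
      qed
      finally show "mcoeff ((?lin + formal_nf n1 n2 G) $ j - snd (S m) $ j) \<beta> = 0"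
        by (simp add: Y)
    qed
    have "order_ge m (residual F \<Phi> (?lin + formal_nf n1 n2 G) $ j)" for m j
    proof (rule order_ge_mono [OF residual_limit [OF F(1) _ _ d\<Phi> dY]])
      show "order_ge (Suc (Suc m)) (residual F (fst (S m)) (snd (S m)) $ j)"
        "order_ge 2 (fst (S m) $ j - mvar j)" "order_ge 2 (snd (S m) $ j - ?lin $ j)" for j
        using S [of m] by (simp_all add: P_def)
    qed simp
    then show ?thesis
      by (simp add: vec_eq_iff mfps_eq_by_order [of _ 0])
  qed
  \<comment> \<open>Any smooth realisation will do, as formal conjugacy compares Taylor series
    only.\<close>
  moreover have "\<forall>i. \<exists>f. smooth f \<and> taylor f = G i"
  proof
    fix i
    obtain f where "smooth f" "taylor f = G i" by (rule borel_lemma)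
    then show "\<exists>f. smooth f \<and> taylor f = G i" by blast
  qed
  then obtain f where f: "\<And>i. smooth (f i)" "\<And>i. taylor (f i) = G i"
    using choice [of "\<lambda>i f. smooth f \<and> taylor f = G i"] by blast
  moreover have "taylor_map (normal_form n1 n2 \<omega>1 \<omega>2 f) = ?lin + formal_nf n1 n2 G"
    using taylor_normal_form [OF n f(1)] by (simp add: f(2))
  ultimately have "formally_conjugate \<phi> (\<lambda>x. Lmat \<omega>1 \<omega>2 *v x + h x) (normal_form n1 n2 \<omega>1 \<omega>2 f)"
    unfolding formally_conjugate_def F_def residual_def by (intro exI [of _ \<xi>] exI [of _ \<Phi>]) simp
  with f(1) show ?thesis by blast
qed

end
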